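(* Let $q\in(-1,1]$, $t\in\mathbb R$ with $(1-q)t^2<1$, $\boldsymbol\rho=(\rho_1,\dots,\rho_{d-1})\in((-1,1)\setminus\{0\})^{d-1}$, and $(X_1,\dots,X_d)\sim MMN_d(\boldsymbol\rho|q,t)$. Then every marginal of it is also modified multidimensional $q$-Normal: for $1\le i_1<\dots<i_p\le d$ the vector $(X_{i_1},\dots,X_{i_p})$ has a distribution of the form $MMN_p(\boldsymbol\rho'|q,t')$. In particular, for all $i=1,\dots,d$, $X_i$ has the $\big(t\prod_{k=1}^{i-1}\rho_k,\,q\big)$-MN distribution.
   Context: Convention $0^0=1$. $[n]_q=1+q+\dots+q^{n-1}$, $[0]_q=0$, $[n]_q!=\prod_{i=1}^n[i]_q$. $S(q)=[-2/\sqrt{1-q},\,2/\sqrt{1-q}]$ for $|q|<1$, $S(1)=\mathbb R$. $q$-Hermite polynomials: $H_{-1}(x|q)=0$, $H_0(x|q)=1$, $H_{n+1}(x|q)=xH_n(x|q)-[n]_qH_{n-1}(x|q)$ for $n\ge 0$. Their generating function is $\varphi(x,t|q)=\sum_{i\ge0}\frac{t^i}{[i]_q!}H_i(x|q)$ for $x\in S(q)$, $(1-q)t^2<1$; for $|q|<1$ it equals $\prod_{k\ge0}(1-(1-q)xtq^k+(1-q)t^2q^{2k})^{-1}$ and $\varphi(x,t|1)=e^{xt-t^2/2}$. For $|q|<1$ and $x\in S(q)$, $$f_N(x|q)=\frac{\sqrt{1-q}}{2\pi\sqrt{4-(1-q)x^2}}\prod_{k=0}^\infty\big((1+q^k)^2-(1-q)x^2q^k\big)\prod_{k=0}^\infty(1-q^{k+1}),$$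 and for $|\rho|<1$, $x,y\in S(q)$, $$f_{CN}(x|y,\rho,q)=f_N(x|q)\prod_{k=0}^\infty\frac{1-\rho^2q^k}{(1-\rho^2q^{2k})^2-(1-q)\rho q^k(1+\rho^2q^{2k})xy+(1-q)\rho^2(x^2+y^2)q^{2k}};$$ both are $0$ for $x\notin S(q)$ (and at the endpoints). For $q=1$: $f_N(x|1)=\frac1{\sqrt{2\pi}}e^{-x^2/2}$, $f_{CN}(x|y,\rho,1)=\frac1{\sqrt{2\pi(1-\rho^2)}}\exp\!\big(-\frac{(x-\rho y)^2}{2(1-\rho^2)}\big)$. The $(t,q)$-MN (modified $(t,q)$-Normal) distribution has density $\varphi(x,t|q)f_N(x|q)$ on $S(q)$. The modified multidimensional $q$-Normal distribution $MMN_d(\boldsymbol\rho|q,t)$ has density $\varphi(x_1,t|q)f_N(x_1|q)\prod_{i=1}^{d-1}f_{CN}(x_{i+1}|x_i,\rho_i,q)$ on $S(q)^d$; $MMN_1(q,t)$ is the $(t,q)$-MN distribution. *)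

theory Defs
  imports "HOL-Probability.Probability"
begin

definition q_bracket :: "real \<Rightarrow> nat \<Rightarrow> real" where
  "q_bracket q n = (\<Sum>i<n. q ^ i)"

definition q_fact :: "real \<Rightarrow> nat \<Rightarrow> real" where
  "q_fact q n = (\<Prod>i=1..n. q_bracket q i)"

text \<open>The second equation is the recurrence at index 0, where the term containing the Hermite
  polynomial of index -1 vanishes.\<close>
fun q_Hermite :: "real \<Rightarrow> nat \<Rightarrow> real \<Rightarrow> real" where
  "q_Hermite q 0 x = 1"
| "q_Hermite q (Suc 0) x = x"
| "q_Hermite q (Suc (Suc n)) x =
     x * q_Hermite q (Suc n) x - q_bracket q (Suc n) * q_Hermite q n x"

definition q_supp :: "real \<Rightarrow> real set" where
  "q_supp q = (if q = 1 then UNIV else {- 2 / sqrt (1 - q) .. 2 / sqrt (1 - q)})"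

text \<open>The series is meaningful for \<open>x \<in> q_supp q\<close> and \<open>(1 - q) * t\<^sup>2 < 1\<close>; below it is always
  multiplied by a density vanishing outside \<open>q_supp q\<close>.\<close>
definition q_Hermite_gf :: "real \<Rightarrow> real \<Rightarrow> real \<Rightarrow> real" where
  "q_Hermite_gf q t x = (\<Sum>i. t ^ i / q_fact q i * q_Hermite q i x)"

text \<open>At the endpoints of \<open>q_supp q\<close> (\<open>q < 1\<close>) the factor with \<open>k = 0\<close> vanishes, so the value is 0
  there.\<close>
definition f_N :: "real \<Rightarrow> real \<Rightarrow> real" where
  "f_N q x =
     (if q = 1 then std_normal_density x
      else if x \<in> q_supp q then
        sqrt (1 - q) / (2 * pi * sqrt (4 - (1 - q) * x\<^sup>2))
          * (\<Prod>k. (1 + q ^ k)\<^sup>2 - (1 - q) * x\<^sup>2 * q ^ k)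
          * (\<Prod>k. 1 - q ^ (k + 1))
      else 0)"

text \<open>\<open>f_CN q \<rho> y x\<close> is the conditional density at \<open>x\<close> given \<open>y\<close>. Only values with
  \<open>y \<in> q_supp q\<close> matter.\<close>
definition f_CN :: "real \<Rightarrow> real \<Rightarrow> real \<Rightarrow> real \<Rightarrow> real" where
  "f_CN q \<rho> y x =
     (if q = 1 then normal_density (\<rho> * y) (sqrt (1 - \<rho>\<^sup>2)) x
      else f_N q x *
        (\<Prod>k. (1 - \<rho>\<^sup>2 * q ^ k) /
          ((1 - \<rho>\<^sup>2 * q ^ (2 * k))\<^sup>2
            - (1 - q) * \<rho> * q ^ k * (1 + \<rho>\<^sup>2 * q ^ (2 * k)) * x * y
            + (1 - q) * \<rho>\<^sup>2 * (x\<^sup>2 + y\<^sup>2) * q ^ (2 * k))))"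

definition MN_density :: "real \<Rightarrow> real \<Rightarrow> real \<Rightarrow> real" where
  "MN_density q t x = q_Hermite_gf q t x * f_N q x"

text \<open>Points of \<open>d\<close>-dimensional space are functions on \<open>{1..d}\<close>, and \<open>\<rho>\<close> is used on
  \<open>{1..<d}\<close> only. For \<open>d = 1\<close> this is \<open>MN_density q t (x 1)\<close>.\<close>
definition MMN_density ::
  "nat \<Rightarrow> (nat \<Rightarrow> real) \<Rightarrow> real \<Rightarrow> real \<Rightarrow> (nat \<Rightarrow> real) \<Rightarrow> real" where
  "MMN_density d \<rho> q t x =
     MN_density q t (x 1) * (\<Prod>i\<in>{1..<d}. f_CN q (\<rho> i) (x i) (x (i + 1)))"

definition has_MN ::
  "'a measure \<Rightarrow> ('a \<Rightarrow> real) \<Rightarrow> real \<Rightarrow> real \<Rightarrow> bool" where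
  "has_MN M Y q t \<longleftrightarrow> distributed M lborel Y (\<lambda>x. ennreal (MN_density q t x))"

definition has_MMN ::
  "'a measure \<Rightarrow> nat \<Rightarrow> (nat \<Rightarrow> 'a \<Rightarrow> real) \<Rightarrow> (nat \<Rightarrow> real) \<Rightarrow> real \<Rightarrow> real \<Rightarrow> bool" where
  "has_MMN M d X \<rho> q t \<longleftrightarrow>
     distributed M (\<Pi>\<^sub>M i\<in>{1..d}. lborel) (\<lambda>\<omega>. \<lambda>i\<in>{1..d}. X i \<omega>)
       (\<lambda>x. ennreal (MMN_density d \<rho> q t x))"

end

theory Submission
  imports Defs
begin

text \<open>The densities form a Markov semigroup. For \<open>|q| < 1\<close>, the Poisson-Mehler formula writes
  \<open>f_CN(x|y,\<rho>) / f_N(x)\<close> as \<open>\<Sum>n. \<rho>\<^sup>n H_n(x) H_n(y) / [n]!\<close>; both this formula and the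
  product for \<open>\<phi>(x,t)\<close> come from comparing a power series at \<open>r\<close> and at \<open>q r\<close> and iterating. The
  \<open>H_n\<close> are orthogonal for \<open>f_N\<close>, because with \<open>x = 2 cos \<theta> / sqrt (1 - q)\<close> the Fourier coefficients
  of the weight are given by the triple product and the integral of \<open>H_2n\<close> becomes a terminating
  triple product at \<open>z = 1\<close>, which vanishes. Parseval's identity for series in the \<open>H_n\<close> then yields
  \<open>\<integral> f_CN(y|x,\<rho>) f_CN(z|y,\<sigma>) dy = f_CN(z|x,\<rho>\<sigma>)\<close> and
  \<open>\<integral> \<phi>(y,t) f_N(y) f_CN(z|y,\<sigma>) dy = \<phi>(z,t\<sigma>) f_N(z)\<close>. For \<open>q = 1\<close> these are Gaussian
  convolutions. Integrating out the coordinates one at a time gives the marginals, the parameters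
  \<open>\<rho>\<close> being multiplied along each gap.\<close>

section \<open>Continuous q-Hermite polynomials\<close>

text \<open>\<open>rogers\<close> is the q-Hermite polynomial in the variable s = sqrt (1 - q) * x,
  multiplied by sqrt (1 - q)^n: the support becomes [-2, 2] for every q, and [n]_q becomes 1 - q^n.
  For |q| < 1 the convergence of all series in these polynomials rests on one estimate,
  |\<open>rogers q n s\<close>| \<le> B (n + 1) on [-2, 2]. The weight contains an infinite product,
  so its Fourier integrals are never taken directly: they are computed exactly for the product cut
  after m + 1 factors, and m tends to infinity by dominated convergence. Marginals are computed as
  nonnegative integrals against arbitrary test functions. Tonelli then asks for measurability only,
  and an integrated coordinate can be absorbed into the test function. The semigroup laws hold for
  conditioning points in the support, while the abstract argument wants them at every real point.
  The kernels are therefore modified off the support, and the agreement with the given joint density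
  is recovered by an induction that also carries the vanishing of that density off the
  support.\<close>

fun rogers :: "real \<Rightarrow> nat \<Rightarrow> real \<Rightarrow> real" where
  "rogers q 0 s = 1"
| "rogers q (Suc 0) s = s"
| "rogers q (Suc (Suc n)) s = s * rogers q (Suc n) s - (1 - q ^ Suc n) * rogers q n s"

text \<open>This is (q;q)_n, the counterpart of [n]_q! after the rescaling.\<close>

definition q_poch :: "real \<Rightarrow> nat \<Rightarrow> real" where
  "q_poch q n = (\<Prod>i<n. 1 - q ^ Suc i)"

lemma q_poch_0 [simp]: "q_poch q 0 = 1"
  by (simp add: q_poch_def)

lemma q_poch_Suc: "q_poch q (Suc n) = q_poch q n * (1 - q ^ Suc n)"
  by (simp add: q_poch_def)

lemma rogers_continuous [continuous_intros]: "continuous_on A (rogers q n)"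
  by (induction q n "0::real" rule: rogers.induct) (auto intro!: continuous_intros)

lemma rogers_measurable [measurable]: "rogers q n \<in> borel_measurable borel"
  by (intro borel_measurable_continuous_onI rogers_continuous)

lemma rogers_minus: "rogers q n (- s) = (- 1) ^ n * rogers q n s"
  by (induction q n s rule: rogers.induct) (auto simp: algebra_simps)

text \<open>At n = 0 the truncated index n - 1 is harmless because its coefficient 1 - q^0 is 0. The
  uniform shape lets multiplication by s act on integrals without a case split.\<close>

lemma rogers_rec: "s * rogers q n s = rogers q (Suc n) s + (1 - q ^ n) * rogers q (n - 1) s"
  by (cases n) auto

lemma q_bracket_mult: "(1 - q) * q_bracket q n = 1 - q ^ n"
  by (simp add: q_bracket_def one_diff_power_eq)

lemma q_fact_eq: "q < 1 \<Longrightarrow> (1 - q) ^ n * q_fact q n = q_poch q n"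
proof (induction n)
  case 0
  then show ?case by (simp add: q_fact_def)
next
  case (Suc n)
  have "(1 - q) ^ Suc n * q_fact q (Suc n) = ((1 - q) ^ n * q_fact q n) * ((1 - q) * q_bracket q (Suc n))"
    by (simp add: q_fact_def)
  then show ?case
    using Suc by (simp add: q_poch_Suc q_bracket_mult del: power_Suc)
qed

lemma q_Hermite_eq:
  assumes "q < 1"
  shows "sqrt (1 - q) ^ n * q_Hermite q n x = rogers q n (sqrt (1 - q) * x)"
  using assms
proof (induction q n x rule: q_Hermite.induct)
  case (3 q n x)
  have sq: "sqrt (1 - q) * sqrt (1 - q) = 1 - q"
    using 3 by simp
  have "sqrt (1 - q) ^ Suc (Suc n) * q_Hermite q (Suc (Suc n)) x =
     sqrt (1 - q) * x * (sqrt (1 - q) ^ Suc n * q_Hermite q (Suc n) x)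
       - (sqrt (1 - q) * sqrt (1 - q)) * q_bracket q (Suc n) * (sqrt (1 - q) ^ n * q_Hermite q n x)"
    by (simp only: q_Hermite.simps power_Suc) algebra
  also have "\<dots> = rogers q (Suc (Suc n)) (sqrt (1 - q) * x)"
    using 3 by (simp only: sq q_bracket_mult rogers.simps)
  finally show ?case .
qed auto

section \<open>Convergence of (q;q)_n for |q| < 1\<close>

locale q_disc =
  fixes q :: real
  assumes q: "\<bar>q\<bar> < 1"
begin

lemma q_power_less: "q ^ Suc n < 1"
  by (metis q power_Suc_less_one power_abs order.strict_trans1 abs_ge_self zero_less_abs_iff power_0_Suc)

lemma q_poch_pos: "0 < q_poch q n"
  using q_power_less by (simp add: q_poch_def prod_pos)

lemma q_poch_nz [simp]: "q_poch q n \<noteq> 0"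
  using q_poch_pos[of n] by simp

lemma summable_abs_q: "summable (\<lambda>k. \<bar>q\<bar> ^ k)"
  using q by (simp add: summable_geometric)

lemma convergent_prod_q_lin:
  assumes "\<bar>c\<bar> \<le> 1" "\<And>k. c * q ^ k \<noteq> 1"
  shows "convergent_prod (\<lambda>k. 1 - c * q ^ k)"
proof -
  have "summable (\<lambda>k. \<bar>- (c * q ^ k)\<bar>)"
    using summable_mult[OF summable_abs_q, of "\<bar>c\<bar>"] by (simp add: abs_mult power_abs)
  then have "convergent_prod (\<lambda>k. 1 + - (c * q ^ k))"
    using assms by (intro summable_imp_convergent_prod_real) (auto simp: algebra_simps)
  then show ?thesis by simp
qed

definition q_inf :: real where
  "q_inf = (\<Prod>k. 1 - q ^ (k + 1))"

lemma convergent_prod_q_inf: "convergent_prod (\<lambda>k. 1 - q ^ (k + 1))"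
  using convergent_prod_q_lin[of q] q q_power_less by (auto simp: less_imp_neq)

lemma q_inf_nz: "q_inf \<noteq> 0"
  unfolding q_inf_def using q_power_less
  by (intro prodinf_nonzero convergent_prod_q_inf) (auto simp: less_imp_neq)

lemma q_poch_LIMSEQ: "q_poch q \<longlonglongrightarrow> q_inf"
proof -
  have "(\<lambda>n. \<Prod>i\<le>n. 1 - q ^ (i + 1)) \<longlonglongrightarrow> q_inf"
    unfolding q_inf_def by (intro convergent_prod_LIMSEQ convergent_prod_q_inf)
  then have "(\<lambda>n. q_poch q (Suc n)) \<longlonglongrightarrow> q_inf"
    by (simp add: q_poch_def lessThan_Suc_atMost del: power_Suc)
  then show ?thesis by (rule LIMSEQ_imp_Suc)
qed

lemma q_inf_pos: "0 < q_inf"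
  using LIMSEQ_le_const[OF q_poch_LIMSEQ, of 0] q_poch_pos q_inf_nz by (force intro: less_imp_le)

text \<open>The limit of (q;q)_n is nonzero, so the reciprocals converge too and are bounded. With
  the upper bound on (q;q)_n this controls Gaussian binomials uniformly in both indices.\<close>

lemma inverse_q_poch_bound: obtains C where "0 < C" "\<And>n. 1 / q_poch q n \<le> C"
proof -
  have "Bseq (\<lambda>n. inverse (q_poch q n))"
    using q_poch_LIMSEQ q_inf_nz by (intro convergent_imp_Bseq convergentI[of _ "inverse q_inf"] tendsto_inverse)
  then obtain C where C: "0 < C" "\<And>n. norm (inverse (q_poch q n)) \<le> C"
    unfolding Bseq_def by auto
  show ?thesis
    using C(2) q_poch_pos by (intro that[OF C(1)]) (simp add: divide_inverse abs_of_pos)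
qed

lemma q_poch_bound: obtains C where "0 < C" "\<And>n. q_poch q n \<le> C"
proof -
  have "Bseq (q_poch q)"
    using q_poch_LIMSEQ by (intro convergent_imp_Bseq convergentI)
  then obtain C where "0 < C" "\<And>n. norm (q_poch q n) \<le> C"
    unfolding Bseq_def by auto
  then show ?thesis
    by (intro that[of C]) (auto simp: abs_le_iff)
qed

end

text \<open>Coefficient form of a q-difference equation: if A(z) - A(rz) = u z A(z) and B(z) - B(rz)
  = v z B(z), then G = A B satisfies (1 - u z) (1 - v z) G(z) = G(rz). With u v = 1 this is the
  three-term recurrence.\<close>

lemma rogers_convolution:
  fixes u v s :: "'a :: field_char_0" and a b :: "nat \<Rightarrow> 'a"
  assumes nz: "u * v = 1"
  assumes a: "\<And>n. a (Suc n) * (1 - r ^ Suc n) = u * a n"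
  assumes b: "\<And>n. b (Suc n) * (1 - r ^ Suc n) = v * b n"
  defines "g \<equiv> \<lambda>n. \<Sum>j\<le>n. a j * b (n - j)"
  shows "(1 - r ^ Suc (Suc n)) * g (Suc (Suc n)) = (u + v) * g (Suc n) - g n"
    and "(1 - r) * g (Suc 0) = (u + v) * g 0"
proof -
  have A: "(\<Sum>j\<le>Suc n. (1 - r ^ j) * (a j * b (Suc n - j))) = u * g n" for n
  proof -
    have "(\<Sum>j\<le>Suc n. (1 - r ^ j) * (a j * b (Suc n - j)))
        = (\<Sum>j\<le>n. a (Suc j) * (1 - r ^ Suc j) * b (n - j))"
      by (subst sum.atMost_Suc_shift) (simp add: mult_ac)
    then show ?thesis
      by (simp only: a) (simp add: g_def sum_distrib_left mult_ac)
  qed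
  have B: "(\<Sum>j\<le>Suc n. (1 - r ^ (Suc n - j)) * (r ^ j * (a j * b (Suc n - j))))
      = v * (\<Sum>j\<le>n. r ^ j * (a j * b (n - j)))" for n
  proof -
    have "(\<Sum>j\<le>Suc n. (1 - r ^ (Suc n - j)) * (r ^ j * (a j * b (Suc n - j))))
        = (\<Sum>j\<le>n. (r ^ j * a j) * (b (Suc (n - j)) * (1 - r ^ Suc (n - j))))"
      by (simp add: Suc_diff_le mult_ac)
    then show ?thesis
      by (simp only: b) (simp add: sum_distrib_left mult_ac)
  qed
  \<comment> \<open>Splits 1 - r^(n+1) into (1 - r^j) + r^j (1 - r^(n+1-j)); the first part lowers
    the index of \<open>a\<close>, the second that of \<open>b\<close>.\<close>
  have C: "(1 - r ^ Suc n) * g (Suc n) = u * g n + v * (\<Sum>j\<le>n. r ^ j * (a j * b (n - j)))" for n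
  proof -
    have "(1 - r ^ Suc n) * g (Suc n) =
      (\<Sum>j\<le>Suc n. (1 - r ^ j) * (a j * b (Suc n - j))
         + (1 - r ^ (Suc n - j)) * (r ^ j * (a j * b (Suc n - j))))"
      unfolding g_def sum_distrib_left
    proof (intro sum.cong refl)
      fix j assume "j \<in> {..Suc n}"
      then have "r ^ Suc n = r ^ j * r ^ (Suc n - j)"
        by (simp flip: power_add)
      then show "(1 - r ^ Suc n) * (a j * b (Suc n - j)) = (1 - r ^ j) * (a j * b (Suc n - j))
         + (1 - r ^ (Suc n - j)) * (r ^ j * (a j * b (Suc n - j)))"
        by (simp only:) (simp add: algebra_simps)
    qed
    then show ?thesis
      by (simp only: sum.distrib A B)
  qed
  have D: "(\<Sum>j\<le>Suc n. r ^ j * (a j * b (Suc n - j))) = g (Suc n) - u * g n"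
    unfolding A[of n, symmetric] unfolding g_def sum_subtractf[symmetric]
    by (intro sum.cong) (auto simp: algebra_simps)
  show "(1 - r ^ Suc (Suc n)) * g (Suc (Suc n)) = (u + v) * g (Suc n) - g n"
    unfolding C[of "Suc n"] D using nz by algebra
  show "(1 - r) * g (Suc 0) = (u + v) * g 0"
  proof -
    have "(\<Sum>j\<le>0. r ^ j * (a j * b (0 - j))) = g 0"
      by (simp add: g_def)
    then show ?thesis
      using C[of 0] by (simp only: power_Suc power_0 mult_1_right distrib_right)
  qed
qed

text \<open>Rogers' formula: the polynomial at 2 cos \<theta> is the sum of Gaussian binomials times
  exp (i (2j - n) \<theta>). The binomial is kept as a product of two reciprocals, which makes the
  sum a convolution.\<close>

lemma (in q_disc) rogers_cis:
  "of_real (rogers q n (2 * cos \<theta>)) =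
     of_real (q_poch q n) * (\<Sum>j\<le>n. (cis \<theta> ^ j / of_real (q_poch q j)) * (cis (- \<theta>) ^ (n - j) / of_real (q_poch q (n - j))))"
proof -
  define a b where "a = (\<lambda>j. cis \<theta> ^ j / complex_of_real (q_poch q j))"
    and "b = (\<lambda>j. cis (- \<theta>) ^ j / complex_of_real (q_poch q j))"
  define g where "g = (\<lambda>n. \<Sum>j\<le>n. a j * b (n - j))"
  have nz: "1 - complex_of_real q ^ Suc n \<noteq> 0" for n
    using q_power_less[of n] by (metis of_real_1 of_real_diff of_real_eq_0_iff of_real_power diff_gt_0_iff_gt less_irrefl)
  have uv: "cis \<theta> * cis (- \<theta>) = 1" "cis \<theta> + cis (- \<theta>) = of_real (2 * cos \<theta>)"
    by (auto simp: cis_mult complex_eq_iff)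
  have pS: "complex_of_real (q_poch q (Suc n)) = of_real (q_poch q n) * (1 - of_real q ^ Suc n)" for n
    by (simp add: q_poch_Suc)
  have ab: "a (Suc n) * (1 - of_real q ^ Suc n) = cis \<theta> * a n"
     "b (Suc n) * (1 - of_real q ^ Suc n) = cis (- \<theta>) * b n" for n
    using nz[of n] by (simp_all only: a_def b_def pS) (simp_all add: field_simps del: power_Suc add: power_Suc[of "cis _"])
  have rec: "(1 - of_real q ^ Suc (Suc n)) * g (Suc (Suc n)) = of_real (2 * cos \<theta>) * g (Suc n) - g n"
    "(1 - of_real q) * g (Suc 0) = of_real (2 * cos \<theta>) * g 0" for n
    using rogers_convolution[OF uv(1), of a "of_real q" b, OF ab] unfolding g_def uv(2) by blast+
  have "of_real (rogers q n (2 * cos \<theta>)) = of_real (q_poch q n) * g n"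
  proof (induction n rule: induct_nat_012)
    case 0
    then show ?case by (simp add: g_def a_def b_def)
  next
    case 1
    have "g 0 = 1"
      by (simp add: g_def a_def b_def)
    then show ?case using rec(2) by (simp add: pS)
  next
    case (ge2 n)
    have "of_real (rogers q (Suc (Suc n)) (2 * cos \<theta>)) =
      of_real (2 * cos \<theta>) * (of_real (q_poch q (Suc n)) * g (Suc n))
        - (1 - of_real q ^ Suc n) * (of_real (q_poch q n) * g n)"
      unfolding ge2[symmetric] by simp
    also have "\<dots> = of_real (q_poch q (Suc n)) * (of_real (2 * cos \<theta>) * g (Suc n) - g n)"
      by (simp only: pS) algebra
    also have "\<dots> = of_real (q_poch q (Suc (Suc n))) * g (Suc (Suc n))"
      unfolding rec(1)[symmetric] pS[of "Suc n"] by (simp only: mult_ac)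
    finally show ?case .
  qed
  then show ?thesis by (simp add: g_def a_def b_def)
qed

text \<open>\<open>rogers_cis\<close> has n + 1 terms, each of modulus at most a constant, since
  (q;q)_n and its reciprocal are bounded.\<close>

lemma (in q_disc) rogers_bound: obtains B where "0 < B" "\<And>n s. \<bar>s\<bar> \<le> 2 \<Longrightarrow> \<bar>rogers q n s\<bar> \<le> B * (real n + 1)"
proof -
  obtain C where C: "0 < C" "\<And>n. 1 / q_poch q n \<le> C"
    using inverse_q_poch_bound by blast
  obtain D where D: "0 < D" "\<And>n. q_poch q n \<le> D"
    using q_poch_bound by blast
  show ?thesis
  proof (rule that[of "D * (C * C)"])
    fix n and s :: real assume s: "\<bar>s\<bar> \<le> 2"
    define \<theta> where "\<theta> = arccos (s / 2)"
    have s': "s = 2 * cos \<theta>"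
      using s by (simp add: \<theta>_def cos_arccos_abs)
    have "\<bar>rogers q n s\<bar> = cmod (of_real (rogers q n (2 * cos \<theta>)))"
      by (simp add: s')
    also have "\<dots> \<le> q_poch q n * (\<Sum>j\<le>n. 1 / q_poch q j * (1 / q_poch q (n - j)))"
      unfolding rogers_cis norm_mult
      using q_poch_pos by (intro mult_mono sum_norm_le) (auto simp: norm_mult norm_divide norm_power abs_of_pos intro!: sum_nonneg divide_nonneg_nonneg less_imp_le)
    also have "\<dots> \<le> D * (\<Sum>j\<le>n. C * C)"
      using q_poch_pos C D by (intro mult_mono sum_mono) (auto intro!: sum_nonneg mult_nonneg_nonneg intro: less_imp_le)
    finally show "\<bar>rogers q n s\<bar> \<le> D * (C * C) * (real n + 1)"
      by (simp add: algebra_simps)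
  qed (use C D in auto)
qed

section \<open>Generating function and Poisson-Mehler kernel\<close>

text \<open>Differentiating the geometric series twice gives the coefficients (n + 1) (n + 2), which
  dominate (n + 1)^2.\<close>

lemma summable_quadratic_geometric:
  fixes r :: real
  assumes "\<bar>r\<bar> < 1"
  shows "summable (\<lambda>n. (real n + 1)\<^sup>2 * \<bar>r\<bar> ^ n)"
proof -
  have *: "summable (\<lambda>n. diffs (\<lambda>_. 1::real) n * x ^ n)" if "norm x < 1" for x
    using that by (rule termdiff_converges) (simp add: summable_geometric)
  have "summable (\<lambda>n. diffs (diffs (\<lambda>_. 1)) n * \<bar>r\<bar> ^ n)"
    by (rule termdiff_converges[where K = 1]) (use assms * in auto)
  then show ?thesis
    by (rule summable_comparison_test'[where N = 0])
       (auto simp: diffs_def power2_eq_square algebra_simps intro!: mult_mono)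
qed

text \<open>Coefficients of r^k times a power series; with it a functional equation becomes an
  identity between coefficients.\<close>

definition shift_seq :: "nat \<Rightarrow> (nat \<Rightarrow> real) \<Rightarrow> nat \<Rightarrow> real" where
  "shift_seq k c n = (if n < k then 0 else c (n - k))"

lemma shift_seq_simps [simp]:
  "shift_seq 0 c n = c n" "shift_seq (Suc k) c 0 = 0" "shift_seq (Suc k) c (Suc n) = shift_seq k c n"
  "shift_seq (numeral l) c 0 = 0" "shift_seq (numeral l) c (Suc n) = shift_seq (pred_numeral l) c n"
  by (simp_all add: shift_seq_def numeral_eq_Suc)

lemma sums_shift_seq:
  assumes "summable (\<lambda>n. c n * r ^ n)"
  shows "(\<lambda>n. shift_seq k c n * r ^ n) sums (r ^ k * (\<Sum>n. c n * r ^ n))"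
proof -
  have "(\<lambda>n. c n * r ^ n) sums (\<Sum>n. c n * r ^ n)"
    using assms by (rule summable_sums)
  then have "(\<lambda>n. r ^ k * (c n * r ^ n)) sums (r ^ k * (\<Sum>n. c n * r ^ n))"
    by (rule sums_mult)
  then have "(\<lambda>n. shift_seq k c (n + k) * r ^ (n + k)) sums (r ^ k * (\<Sum>n. c n * r ^ n))"
    by (simp add: shift_seq_def power_add mult_ac)
  then show ?thesis
    by (subst (asm) sums_zero_iff_shift) (auto simp: shift_seq_def)
qed

text \<open>D0 to D4 stand for consecutive Mehler coefficients with indices m to m + 4, P for
  (q;q)_m, and e, f, g, h for 1 - q^(m+1) to 1 - q^(m+4). Treating these as independent unknowns
  leaves a polynomial identity. The factor P e f g suffices to clear denominators because D4 has net
  coefficient h.\<close>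

lemma mehler_coeff_identity:
  fixes P e f g h s a b s' a' b' D0 D1 D2 D3 D4 :: real
  assumes nz: "P \<noteq> 0" "e \<noteq> 0" "f \<noteq> 0" "g \<noteq> 0"
    and D0: "D0 * P = a * a'"
    and D1: "D1 * (P * e) = b * b'"
    and D2: "D2 * (P * e * f) = (s * b - e * a) * (s' * b' - e * a')"
    and D3: "D3 * (P * e * f * g) = (s * (s * b - e * a) - f * b) * (s' * (s' * b' - e * a') - f * b')"
    and D4: "D4 * (P * e * f * g * h) = (s * (s * (s * b - e * a) - f * b) - g * (s * b - e * a)) *
           (s' * (s' * (s' * b' - e * a') - f * b') - g * (s' * b' - e * a'))"
  shows "D4 - s * s' * D3 + (s\<^sup>2 + s'\<^sup>2 - 2) * D2 - s * s' * D1 + D0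
    = (1 - h) * D4 - (2 - f - g) * D2 + (1 - e) * D0"
proof -
  have "(D4 - s * s' * D3 + (s\<^sup>2 + s'\<^sup>2 - 2) * D2 - s * s' * D1 + D0
    - ((1 - h) * D4 - (2 - f - g) * D2 + (1 - e) * D0)) * (P * e * f * g)
    = D4 * (P * e * f * g * h) - s * s' * (D3 * (P * e * f * g)) + (s\<^sup>2 + s'\<^sup>2 - f - g) * (D2 * (P * e * f)) * g
      - s * s' * (D1 * (P * e)) * f * g + e * (D0 * P) * e * f * g"
    by (simp add: ring_distribs mult_ac)
  also have "\<dots> = 0"
    unfolding D0 D1 D2 D3 D4 power2_eq_square by (simp add: ring_distribs mult_ac)
  finally show ?thesis
    using nz by simp
qed

text \<open>In terms of p = |r|, a = |s|/2 and b = |s'|/2 the expression is at least (1 - p)^2 ((1 -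
  p)^2 + 4 p (1 - a b)) + 4 p^2 (a - b)^2, and a b \<le> 1.\<close>

lemma mehler_denominator_pos:
  fixes r s s' :: real
  assumes r: "\<bar>r\<bar> < 1" and s: "\<bar>s\<bar> \<le> 2" "\<bar>s'\<bar> \<le> 2"
  shows "0 < (1 - r\<^sup>2)\<^sup>2 - r * (1 + r\<^sup>2) * s * s' + r\<^sup>2 * (s\<^sup>2 + s'\<^sup>2)"
proof -
  define a where "a = \<bar>s\<bar> / 2"
  define b where "b = \<bar>s'\<bar> / 2"
  define p where "p = \<bar>r\<bar>"
  have ab: "0 \<le> a" "a \<le> 1" "0 \<le> b" "b \<le> 1" and p: "0 \<le> p" "p < 1"
    using s r by (auto simp: a_def b_def p_def)
  have "a * b \<le> 1" using ab by (simp add: mult_le_one)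
  have "r * (1 + r\<^sup>2) * s * s' \<le> \<bar>r * (1 + r\<^sup>2) * s * s'\<bar>" by simp
  also have "\<dots> = 4 * p * (1 + p\<^sup>2) * a * b"
    by (simp add: a_def b_def p_def abs_mult)
  finally have 1: "(1 - p\<^sup>2)\<^sup>2 - 4 * p * (1 + p\<^sup>2) * a * b + p\<^sup>2 * (4 * a\<^sup>2 + 4 * b\<^sup>2)
     \<le> (1 - r\<^sup>2)\<^sup>2 - r * (1 + r\<^sup>2) * s * s' + r\<^sup>2 * (s\<^sup>2 + s'\<^sup>2)"
    by (simp add: a_def b_def p_def power_divide)
  have "0 < (1 - p)\<^sup>2 * ((1 - p)\<^sup>2 + 4 * p * (1 - a * b))"
    using p \<open>a * b \<le> 1\<close> by (intro mult_pos_pos add_pos_nonneg) auto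
  also have "\<dots> \<le> (1 - p)\<^sup>2 * ((1 - p)\<^sup>2 + 4 * p * (1 - a * b)) + 4 * p\<^sup>2 * (a - b)\<^sup>2"
    by simp
  also have "\<dots> = (1 - p\<^sup>2)\<^sup>2 - 4 * p * (1 + p\<^sup>2) * a * b + p\<^sup>2 * (4 * a\<^sup>2 + 4 * b\<^sup>2)"
    by (simp add: power2_eq_square ring_distribs mult_ac)
  finally show ?thesis using 1 by simp
qed

lemma genf_denominator_pos:
  fixes s t :: real
  assumes "\<bar>t\<bar> < 1" "\<bar>s\<bar> \<le> 2"
  shows "0 < 1 - s * t + t\<^sup>2"
proof -
  have "s * t \<le> \<bar>s\<bar> * \<bar>t\<bar>"
    unfolding abs_mult[symmetric] by simp
  also have "\<dots> \<le> 2 * \<bar>t\<bar>"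
    using assms by (intro mult_right_mono) auto
  finally have "s * t \<le> 2 * \<bar>t\<bar>" .
  moreover have "0 < (1 - \<bar>t\<bar>)\<^sup>2" using assms by simp
  then have "0 < 1 - 2 * \<bar>t\<bar> + t\<^sup>2" by (simp add: power2_diff)
  ultimately show ?thesis by linarith
qed

context q_disc
begin

definition genf :: "real \<Rightarrow> real \<Rightarrow> real" where
  "genf t s = (\<Sum>n. rogers q n s / q_poch q n * t ^ n)"

definition mehler :: "real \<Rightarrow> real \<Rightarrow> real \<Rightarrow> real" where
  "mehler r s s' = (\<Sum>n. rogers q n s * rogers q n s' / q_poch q n * r ^ n)"

lemma rogers_coeff_bound:
  obtains B where "0 < B" "\<And>n s. \<bar>s\<bar> \<le> 2 \<Longrightarrow> \<bar>rogers q n s / q_poch q n\<bar> \<le> B * (real n + 1)"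
proof -
  obtain B where B: "0 < B" "\<And>n s. \<bar>s\<bar> \<le> 2 \<Longrightarrow> \<bar>rogers q n s\<bar> \<le> B * (real n + 1)"
    using rogers_bound by blast
  obtain C where C: "0 < C" "\<And>n. 1 / q_poch q n \<le> C"
    using inverse_q_poch_bound by blast
  show ?thesis
  proof (rule that[of "B * C"])
    fix n and s :: real assume "\<bar>s\<bar> \<le> 2"
    then have "\<bar>rogers q n s\<bar> * (1 / q_poch q n) \<le> B * (real n + 1) * C"
      using B C q_poch_pos[of n] by (intro mult_mono) (auto intro: less_imp_le)
    then show "\<bar>rogers q n s / q_poch q n\<bar> \<le> B * C * (real n + 1)"
      using q_poch_pos[of n] by (simp add: mult_ac)
  qed (use B C in auto)
qed

text \<open>The extra weight n + 1 pays for one more q-Hermite polynomial, as in the Mehler series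
  and in \<open>rogers_summable\<close>.\<close>

lemma summable_rogers_coeff:
  assumes "\<bar>t\<bar> < 1" "\<bar>s\<bar> \<le> 2"
  shows "summable (\<lambda>n. \<bar>rogers q n s / q_poch q n * t ^ n\<bar> * (real n + 1))"
proof -
  obtain B where B: "0 < B" "\<And>n s. \<bar>s\<bar> \<le> 2 \<Longrightarrow> \<bar>rogers q n s / q_poch q n\<bar> \<le> B * (real n + 1)"
    using rogers_coeff_bound by blast
  have "summable (\<lambda>n. B * ((real n + 1)\<^sup>2 * \<bar>t\<bar> ^ n))"
    using summable_quadratic_geometric[OF assms(1)] by (rule summable_mult)
  then show ?thesis
  proof (rule summable_comparison_test'[where N = 0])
    fix n
    have "\<bar>rogers q n s / q_poch q n\<bar> * (\<bar>t\<bar> ^ n * (real n + 1))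
        \<le> (B * (real n + 1)) * (\<bar>t\<bar> ^ n * (real n + 1))"
      using B(2)[OF assms(2)] by (intro mult_right_mono) auto
    then show "norm (\<bar>rogers q n s / q_poch q n * t ^ n\<bar> * (real n + 1)) \<le> B * ((real n + 1)\<^sup>2 * \<bar>t\<bar> ^ n)"
      by (simp add: abs_mult power_abs power2_eq_square mult_ac)
  qed
qed

lemma summable_genf:
  assumes "\<bar>t\<bar> < 1" "\<bar>s\<bar> \<le> 2"
  shows "summable (\<lambda>n. rogers q n s / q_poch q n * t ^ n)"
  using summable_rogers_coeff[OF assms]
proof (rule summable_comparison_test'[where N = 0])
  fix n
  have "\<bar>x\<bar> * 1 \<le> \<bar>x\<bar> * (real n + 1)" for x :: real
    by (intro mult_left_mono) auto
  then show "norm (rogers q n s / q_poch q n * t ^ n) \<le> \<bar>rogers q n s / q_poch q n * t ^ n\<bar> * (real n + 1)"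
    by (metis mult_1_right real_norm_def)
qed

lemma summable_mehler:
  assumes "\<bar>r\<bar> < 1" "\<bar>s\<bar> \<le> 2" "\<bar>s'\<bar> \<le> 2"
  shows "summable (\<lambda>n. rogers q n s * rogers q n s' / q_poch q n * r ^ n)"
proof -
  obtain B where B: "0 < B" "\<And>n s. \<bar>s\<bar> \<le> 2 \<Longrightarrow> \<bar>rogers q n s\<bar> \<le> B * (real n + 1)"
    using rogers_bound by blast
  have "summable (\<lambda>n. B * (\<bar>rogers q n s / q_poch q n * r ^ n\<bar> * (real n + 1)))"
    by (intro summable_mult summable_rogers_coeff assms)
  then show ?thesis
  proof (rule summable_comparison_test'[where N = 0])
    fix n
    have "\<bar>rogers q n s'\<bar> * \<bar>rogers q n s / q_poch q n * r ^ n\<bar>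
      \<le> B * (real n + 1) * \<bar>rogers q n s / q_poch q n * r ^ n\<bar>"
      by (intro mult_right_mono B assms) auto
    then show "norm (rogers q n s * rogers q n s' / q_poch q n * r ^ n) \<le> B * (\<bar>rogers q n s / q_poch q n * r ^ n\<bar> * (real n + 1))"
      by (simp add: abs_mult mult_ac)
  qed
qed

section \<open>Functional equations under multiplication of the argument by q, and their
  iteration\<close>

lemma q_mult_less: "\<bar>t\<bar> < 1 \<Longrightarrow> \<bar>q * t\<bar> < 1"
  using abs_mult_less[OF q, of t 1] by (simp add: abs_mult)

text \<open>Divided by (q;q)_n, the recurrence says c_n - s c_(n-1) + c_(n-2) = q^n c_n, and the
  factor q^n turns t into q t.\<close>

lemma genf_functional_eq:
  assumes t: "\<bar>t\<bar> < 1" and s: "\<bar>s\<bar> \<le> 2"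
  shows "(1 - s * t + t\<^sup>2) * genf t s = genf (q * t) s"
proof -
  define c where "c = (\<lambda>n. rogers q n s / q_poch q n)"
  have sm: "summable (\<lambda>n. c n * t ^ n)"
    using summable_genf[OF assms] by (simp add: c_def)
  have qp: "1 - q ^ Suc n \<noteq> 0" for n
    using q_power_less[of n] by simp
  have coeff: "shift_seq 0 c n - s * shift_seq 1 c n + shift_seq 2 c n = q ^ n * c n" for n
  proof -
    consider "n = 0" | "n = 1" | m where "n = Suc (Suc m)"
      by (metis One_nat_def not0_implies_Suc)
    then show ?thesis
    proof cases
      case 2
      then show ?thesis
        using qp[of 0] by (simp add: c_def q_poch_Suc field_simps)
    next
      case (3 m)
      define P e f a b where "P = q_poch q m" and "e = 1 - q ^ Suc m" and "f = 1 - q ^ Suc (Suc m)"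
        and "a = rogers q m s" and "b = rogers q (Suc m) s"
      have nz: "P \<noteq> 0" "e \<noteq> 0" "f \<noteq> 0"
        using qp[of m] qp[of "Suc m"] by (auto simp: P_def e_def f_def simp del: power_Suc)
      have "(s * b - e * a) / (P * e * f) - s * (b / (P * e)) + a / P
          = (1 - f) * ((s * b - e * a) / (P * e * f))"
        using nz by (simp add: field_simps)
      moreover have "c (Suc (Suc m)) = (s * b - e * a) / (P * e * f)" "c (Suc m) = b / (P * e)" "c m = a / P"
        by (simp_all only: c_def rogers.simps q_poch_Suc P_def e_def f_def a_def b_def)
      moreover have "q ^ Suc (Suc m) = 1 - f" by (simp add: f_def)
      ultimately show ?thesis
        by (simp only: 3 shift_seq_simps One_nat_def numeral_2_eq_2)
    qed (simp add: c_def)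
  qed
  have "(\<lambda>n. shift_seq 0 c n * t ^ n - s * (shift_seq 1 c n * t ^ n) + shift_seq 2 c n * t ^ n)
     sums (t ^ 0 * suminf (\<lambda>n. c n * t ^ n) - s * (t ^ 1 * suminf (\<lambda>n. c n * t ^ n)) + t ^ 2 * suminf (\<lambda>n. c n * t ^ n))"
    by (intro sums_add sums_diff sums_mult sums_shift_seq sm)
  also have "(\<lambda>n. shift_seq 0 c n * t ^ n - s * (shift_seq 1 c n * t ^ n) + shift_seq 2 c n * t ^ n)
     = (\<lambda>n. (shift_seq 0 c n - s * shift_seq 1 c n + shift_seq 2 c n) * t ^ n)"
    by (simp add: algebra_simps)
  also have "\<dots> = (\<lambda>n. c n * (q * t) ^ n)"
    unfolding coeff by (simp add: power_mult_distrib mult_ac)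
  finally show ?thesis
    by (simp add: sums_iff genf_def c_def algebra_simps)
qed

text \<open>Again a comparison of coefficients: products of two q-Hermite polynomials satisfy a
  relation over five consecutive indices. The prefactor on the right is 1 - (1 + q) r^2 + q
  r^4.\<close>

lemma mehler_functional_eq:
  assumes r: "\<bar>r\<bar> < 1" and s: "\<bar>s\<bar> \<le> 2" "\<bar>s'\<bar> \<le> 2"
  shows "((1 - r\<^sup>2)\<^sup>2 - r * (1 + r\<^sup>2) * s * s' + r\<^sup>2 * (s\<^sup>2 + s'\<^sup>2)) * mehler r s s'
    = (1 - r\<^sup>2) * (1 - q * r\<^sup>2) * mehler (q * r) s s'"
proof -
  define c where "c = (\<lambda>n. rogers q n s * rogers q n s' / q_poch q n)"
  define d where "d = (\<lambda>n. q ^ n * c n)"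
  have sm: "summable (\<lambda>n. c n * r ^ n)"
    using summable_mehler[OF assms] by (simp add: c_def)
  have "summable (\<lambda>n. c n * (q * r) ^ n)"
    using summable_mehler[OF q_mult_less[OF r] s] by (simp add: c_def)
  then have sm': "summable (\<lambda>n. d n * r ^ n)"
    by (simp add: d_def power_mult_distrib mult_ac)
  have qp: "1 - q ^ Suc n \<noteq> 0" for n
    using q_power_less[of n] by simp
  have coeff: "shift_seq 0 c n - s * s' * shift_seq 1 c n + (s\<^sup>2 + s'\<^sup>2 - 2) * shift_seq 2 c n
      - s * s' * shift_seq 3 c n + shift_seq 4 c n
    = shift_seq 0 d n - (1 + q) * shift_seq 2 d n + q * shift_seq 4 d n" for n
  proof -
    \<comment> \<open>For n < 4 some shifted coefficients are 0 and
      \<open>mehler_coeff_identity\<close> does not apply; these four cases are checked by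
      hand.\<close>
    consider "n = 0" | "n = 1" | "n = 2" | "n = 3" | m where "n = Suc (Suc (Suc (Suc m)))"
      by (metis One_nat_def numeral_2_eq_2 numeral_3_eq_3 not0_implies_Suc)
    then show ?thesis
    proof cases
      case 1
      then show ?thesis by (simp add: c_def d_def)
    next
      case 2
      have "s * s' / (1 - q) - s * s' = q * (s * s' / (1 - q))"
        using qp[of 0] by (simp add: field_simps)
      then show ?thesis
        by (simp add: 2 c_def d_def q_poch_Suc)
    next
      case 3
      have nz: "1 - q \<noteq> 0" "1 - q * q \<noteq> 0"
        using qp[of 0] qp[of 1] by auto
      define f g where "f = 1 - q" and "g = 1 - q * q"
      have c: "c 2 * (f * g) = (s * s - f) * (s' * s' - f)" "c 1 * f = s * s'" "c 0 = 1"
        using nz by (simp_all add: f_def g_def c_def q_poch_Suc numeral_2_eq_2)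
      have "(c 2 - s * s' * c 1 + (s\<^sup>2 + s'\<^sup>2 - 2) - ((1 - g) * c 2 - (2 - f))) * f
        = c 2 * (f * g) - s * s' * (c 1 * f) + (s\<^sup>2 + s'\<^sup>2 - f) * f"
        by (simp add: ring_distribs mult_ac)
      also have "\<dots> = 0"
        unfolding c power2_eq_square by (simp add: ring_distribs mult_ac)
      finally have "c 2 - s * s' * c 1 + (s\<^sup>2 + s'\<^sup>2 - 2) = (1 - g) * c 2 - (2 - f)"
        using nz(1) by (simp add: f_def)
      then show ?thesis
        using c(3) by (simp add: 3 numeral_2_eq_2 d_def f_def g_def)
    next
      case 4
      have nz: "1 - q \<noteq> 0" "1 - q * q \<noteq> 0" "1 - q * (q * q) \<noteq> 0"
        using qp[of 0] qp[of 1] qp[of 2] by (auto simp: numeral_2_eq_2)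
      define f g h where "f = 1 - q" and "g = 1 - q * q" and "h = 1 - q * (q * q)"
      have c: "c 3 * (f * g * h) = (s * (s * s - f) - g * s) * (s' * (s' * s' - f) - g * s')"
        "c 2 * (f * g) = (s * s - f) * (s' * s' - f)" "c 1 * f = s * s'" "c 0 = 1"
        using nz by (simp_all add: f_def g_def h_def c_def q_poch_Suc numeral_2_eq_2 numeral_3_eq_3)
      have "(c 3 - s * s' * c 2 + (s\<^sup>2 + s'\<^sup>2 - 2) * c 1 - s * s' - ((1 - h) * c 3 - (2 - f - g) * c 1)) * (f * g)
        = c 3 * (f * g * h) - s * s' * (c 2 * (f * g)) + (s\<^sup>2 + s'\<^sup>2 - f - g) * (c 1 * f) * g - s * s' * f * g"
        by (simp add: ring_distribs mult_ac)
      also have "\<dots> = 0"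
        unfolding c power2_eq_square by (simp add: ring_distribs mult_ac)
      finally have "c 3 - s * s' * c 2 + (s\<^sup>2 + s'\<^sup>2 - 2) * c 1 - s * s' = (1 - h) * c 3 - (2 - f - g) * c 1"
        using nz(1,2) by (simp add: f_def g_def)
      moreover have "(2 - f - g) * c 1 = (1 + q) * d 1" "d 3 = (1 - h) * c 3"
        by (simp_all add: f_def g_def h_def d_def numeral_3_eq_3 algebra_simps)
      ultimately show ?thesis
        using c(4) by (simp add: 4 numeral_3_eq_3 numeral_2_eq_2)
    next
      case (5 m)
      define P X e f g h where "P = q_poch q m" and "X = q ^ m" and "e = 1 - q ^ Suc m" and "f = 1 - q ^ Suc (Suc m)"
        and "g = 1 - q ^ Suc (Suc (Suc m))" and "h = 1 - q ^ Suc (Suc (Suc (Suc m)))"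
      define a b a' b' where "a = rogers q m s" and "b = rogers q (Suc m) s" 
        and "a' = rogers q m s'" and "b' = rogers q (Suc m) s'"
      have nz: "P \<noteq> 0" "e \<noteq> 0" "f \<noteq> 0" "g \<noteq> 0" "h \<noteq> 0"
        using qp[of m] qp[of "Suc m"] qp[of "Suc (Suc m)"] qp[of "Suc (Suc (Suc m))"]
        by (auto simp: P_def e_def f_def g_def h_def simp del: power_Suc)
      have c: "c m * P = a * a'" "c (Suc m) * (P * e) = b * b'"
         "c (Suc (Suc m)) * (P * e * f) = (s * b - e * a) * (s' * b' - e * a')"
         "c (Suc (Suc (Suc m))) * (P * e * f * g) = (s * (s * b - e * a) - f * b) * (s' * (s' * b' - e * a') - f * b')"
         "c (Suc (Suc (Suc (Suc m)))) * (P * e * f * g * h) = (s * (s * (s * b - e * a) - f * b) - g * (s * b - e * a)) *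
           (s' * (s' * (s' * b' - e * a') - f * b') - g * (s' * b' - e * a'))"
        using nz
        by (simp_all only: c_def rogers.simps q_poch_Suc flip: P_def e_def f_def g_def h_def a_def b_def a'_def b'_def) auto
      have d: "d (Suc (Suc (Suc (Suc m)))) = (1 - h) * c (Suc (Suc (Suc (Suc m))))"
        "(1 + q) * d (Suc (Suc m)) = (2 - f - g) * c (Suc (Suc m))"
        "q * d m = (1 - e) * c m"
        by (simp_all add: d_def e_def f_def g_def h_def algebra_simps)
      show ?thesis
        using mehler_coeff_identity[OF nz(1-4) c] d by (simp add: 5 shift_seq_def numeral_2_eq_2)
    qed
  qed
  define S where "S = suminf (\<lambda>n. c n * r ^ n)"
  define T where "T = suminf (\<lambda>n. d n * r ^ n)"
  have "(\<lambda>n. shift_seq 0 c n * r ^ n - s * s' * (shift_seq 1 c n * r ^ n) + (s\<^sup>2 + s'\<^sup>2 - 2) * (shift_seq 2 c n * r ^ n)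
      - s * s' * (shift_seq 3 c n * r ^ n) + shift_seq 4 c n * r ^ n)
     sums (r ^ 0 * S - s * s' * (r ^ 1 * S) + (s\<^sup>2 + s'\<^sup>2 - 2) * (r ^ 2 * S) - s * s' * (r ^ 3 * S) + r ^ 4 * S)"
    unfolding S_def by (intro sums_add sums_diff sums_mult sums_shift_seq sm)
  moreover have "(\<lambda>n. shift_seq 0 d n * r ^ n - (1 + q) * (shift_seq 2 d n * r ^ n) + q * (shift_seq 4 d n * r ^ n))
     sums (r ^ 0 * T - (1 + q) * (r ^ 2 * T) + q * (r ^ 4 * T))"
    unfolding T_def by (intro sums_add sums_diff sums_mult sums_shift_seq sm')
  moreover have "shift_seq 0 c n * r ^ n - s * s' * (shift_seq 1 c n * r ^ n) + (s\<^sup>2 + s'\<^sup>2 - 2) * (shift_seq 2 c n * r ^ n)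
      - s * s' * (shift_seq 3 c n * r ^ n) + shift_seq 4 c n * r ^ n =
      shift_seq 0 d n * r ^ n - (1 + q) * (shift_seq 2 d n * r ^ n) + q * (shift_seq 4 d n * r ^ n)" for n
    using arg_cong[OF coeff[of n], of "\<lambda>x. x * r ^ n"] by (simp only: ring_distribs mult.assoc)
  ultimately have "r ^ 0 * S - s * s' * (r ^ 1 * S) + (s\<^sup>2 + s'\<^sup>2 - 2) * (r ^ 2 * S) - s * s' * (r ^ 3 * S) + r ^ 4 * S
     = r ^ 0 * T - (1 + q) * (r ^ 2 * T) + q * (r ^ 4 * T)"
    by (metis (no_types, lifting) sums_cong sums_unique2)
  moreover have "S = mehler r s s'"
    by (simp add: S_def mehler_def c_def)
  moreover have "T = mehler (q * r) s s'"
    by (simp add: T_def mehler_def d_def c_def power_mult_distrib mult_ac)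
  ultimately show ?thesis
    by (simp add: eval_nat_numeral ring_distribs mult_ac)
qed

lemma q_power_tendsto_0: "(\<lambda>n. q ^ n) \<longlonglongrightarrow> 0"
  using q by (intro LIMSEQ_power_zero) simp

lemma q_power_mult_less: "\<bar>t\<bar> < 1 \<Longrightarrow> \<bar>q ^ n * t\<bar> < 1"
proof (induction n)
  case (Suc n)
  then show ?case using q_mult_less[of "q ^ n * t"] by (simp add: mult.assoc)
qed simp

text \<open>A power series is continuous at 0; summability at 1/2 merely provides a positive radius
  of convergence.\<close>

lemma powser_q_tendsto:
  fixes c :: "nat \<Rightarrow> real"
  assumes "summable (\<lambda>n. c n * (1 / 2) ^ n)"
  shows "(\<lambda>n. \<Sum>k. c k * (q ^ n * t) ^ k) \<longlonglongrightarrow> c 0"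
proof -
  have "isCont (\<lambda>x. \<Sum>n. c n * x ^ n) 0"
    using assms by (rule isCont_powser) simp
  moreover have "(\<lambda>n. q ^ n * t) \<longlonglongrightarrow> 0"
    using tendsto_mult[OF q_power_tendsto_0 tendsto_const[of t]] by simp
  ultimately have "(\<lambda>n. \<Sum>k. c k * (q ^ n * t) ^ k) \<longlonglongrightarrow> (\<Sum>n. c n * 0 ^ n)"
    by (rule isCont_tendsto_compose)
  then show ?thesis by simp
qed

lemma genf_tendsto: "\<bar>s\<bar> \<le> 2 \<Longrightarrow> (\<lambda>n. genf (q ^ n * t) s) \<longlonglongrightarrow> 1"
  unfolding genf_def using powser_q_tendsto[OF summable_genf[of "1/2" s]] by simp

lemma mehler_tendsto:
  "\<bar>s\<bar> \<le> 2 \<Longrightarrow> \<bar>s'\<bar> \<le> 2 \<Longrightarrow> (\<lambda>n. mehler (q ^ n * r) s s') \<longlonglongrightarrow> 1"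
  unfolding mehler_def using powser_q_tendsto[OF summable_mehler[of "1/2" s s']] by simp

text \<open>Positivity is pulled back along t, q t, q^2 t, ...: it holds far out because the values
  tend to 1, and the functional equation divides by a positive quadratic at each step.\<close>

lemma genf_pos:
  assumes "\<bar>t\<bar> < 1" "\<bar>s\<bar> \<le> 2"
  shows "0 < genf t s"
proof -
  have "0 < genf t s" if "0 < genf (q ^ n * t) s" for n
    using that
  proof (induction n)
    case (Suc n)
    have "0 < (1 - s * (q ^ n * t) + (q ^ n * t)\<^sup>2) * genf (q ^ n * t) s"
      using Suc.prems genf_functional_eq[OF q_power_mult_less[OF assms(1)] assms(2), of n]
      by (simp add: mult_ac)
    then have "0 < genf (q ^ n * t) s"
      using genf_denominator_pos[OF q_power_mult_less[OF assms(1)] assms(2), of n]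
      by (simp add: zero_less_mult_iff)
    then show ?case by (rule Suc.IH)
  qed simp
  moreover have "eventually (\<lambda>n. 0 < genf (q ^ n * t) s) sequentially"
    using genf_tendsto[OF assms(2)] by (rule order_tendstoD) simp
  ultimately show ?thesis
    by (auto dest: eventually_happens)
qed

lemma one_minus_rsq_pos: "\<bar>r\<bar> < 1 \<Longrightarrow> 0 < 1 - r\<^sup>2 * q ^ k"
proof -
  assume r: "\<bar>r\<bar> < 1"
  have "\<bar>q ^ k * r\<bar> * \<bar>r\<bar> < 1 * 1"
    by (intro abs_mult_less[of _ 1 _ 1, unfolded abs_mult] q_power_mult_less r) 
  then have "\<bar>r\<^sup>2 * q ^ k\<bar> < 1"
    by (simp add: abs_mult power2_eq_square mult_ac)
  then show ?thesis by linarith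
qed

definition mehler_denom :: "real \<Rightarrow> real \<Rightarrow> real \<Rightarrow> real" where
  "mehler_denom r s s' = (1 - r\<^sup>2)\<^sup>2 - r * (1 + r\<^sup>2) * s * s' + r\<^sup>2 * (s\<^sup>2 + s'\<^sup>2)"

text \<open>Each use of the functional equation consumes one denominator D_k but two numerators, 1 -
  r^2 q^(2k) and 1 - r^2 q^(2k+1). After n steps there are thus 2n numerators over n denominators,
  which differs from the partial product in \<open>f_CN\<close>.\<close>

lemma mehler_has_prod:
  assumes r: "\<bar>r\<bar> < 1" and s: "\<bar>s\<bar> \<le> 2" "\<bar>s'\<bar> \<le> 2"
  shows "0 < mehler r s s'"
    and "(\<lambda>k. (1 - r\<^sup>2 * q ^ k) / mehler_denom (q ^ k * r) s s') has_prod mehler r s s'"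
proof -
  let ?D = "\<lambda>k. mehler_denom (q ^ k * r) s s'"
  let ?F = "\<lambda>n. mehler (q ^ n * r) s s'"
  let ?R = "\<lambda>n. \<Prod>k<n. 1 - r\<^sup>2 * q ^ k"
  have D: "0 < ?D k" for k
    unfolding mehler_denom_def by (intro mehler_denominator_pos q_power_mult_less assms)
  have Rpos: "0 < ?R n" for n
    using one_minus_rsq_pos[OF r] by (simp add: prod_pos)
  have F: "(\<Prod>k<n. ?D k) * mehler r s s' = ?R (2 * n) * ?F n" for n
  proof (induction n)
    case (Suc n)
    have "(\<Prod>k<Suc n. ?D k) * mehler r s s' = ?R (2 * n) * (?D n * ?F n)"
      using Suc by (simp add: mult_ac)
    also have "?D n * ?F n = (1 - (q ^ n * r)\<^sup>2) * (1 - q * (q ^ n * r)\<^sup>2) * ?F (Suc n)"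
      unfolding mehler_denom_def
      using mehler_functional_eq[OF q_power_mult_less[OF r] s, of n] by (simp add: mult_ac)
    also have "(1 - (q ^ n * r)\<^sup>2) * (1 - q * (q ^ n * r)\<^sup>2) = (1 - r\<^sup>2 * q ^ (2 * n)) * (1 - r\<^sup>2 * q ^ Suc (2 * n))"
      by (simp add: power_mult_distrib power_mult[symmetric] mult_ac)
    finally show ?case by (simp add: mult_ac)
  qed simp
  have "eventually (\<lambda>n. 0 < ?F n) sequentially"
    using mehler_tendsto[OF s] by (rule order_tendstoD) simp
  then obtain n where "0 < ?F n" by (auto dest: eventually_happens)
  then have "0 < (\<Prod>k<n. ?D k) * mehler r s s'"
    unfolding F using Rpos by simp
  moreover have "0 < (\<Prod>k<n. ?D k)" using D by (simp add: prod_pos)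
  ultimately show pos: "0 < mehler r s s'"
    by (rule zero_less_mult_pos)
  have cp: "convergent_prod (\<lambda>k. 1 - r\<^sup>2 * q ^ k)"
  proof (rule convergent_prod_q_lin)
    show "\<bar>r\<^sup>2\<bar> \<le> 1" using r by (simp add: abs_square_le_1)
    show "r\<^sup>2 * q ^ k \<noteq> 1" for k using one_minus_rsq_pos[OF r, of k] by simp
  qed
  define L where "L = (\<Prod>k. 1 - r\<^sup>2 * q ^ k)"
  have L: "L \<noteq> 0"
    unfolding L_def using one_minus_rsq_pos[OF r] by (intro prodinf_nonzero cp) (simp add: less_imp_neq[symmetric])
  have "(\<lambda>n. ?R (Suc n)) \<longlonglongrightarrow> L"
    using convergent_prod_LIMSEQ[OF cp] by (simp add: L_def lessThan_Suc_atMost)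
  then have R: "?R \<longlonglongrightarrow> L" by (rule LIMSEQ_imp_Suc)
  \<comment> \<open>The numerators have a nonzero limit L, so R n / R (2n) tends to 1: trading 2n
    numerators for n does not change the limit.\<close>
  have R2: "(\<lambda>n. ?R (2 * n)) \<longlonglongrightarrow> L"
    by (intro LIMSEQ_subseq_LIMSEQ[OF R, unfolded o_def, of "\<lambda>n. 2 * n"]) (simp add: strict_mono_def)
  have "(\<lambda>n. mehler r s s' * ?R n / (?R (2 * n) * ?F n)) \<longlonglongrightarrow> mehler r s s' * L / (L * 1)"
    by (intro tendsto_intros R R2 mehler_tendsto s) (use L in auto)
  moreover have "eventually (\<lambda>n. mehler r s s' * ?R n / (?R (2 * n) * ?F n) = (\<Prod>k<n. (1 - r\<^sup>2 * q ^ k) / ?D k)) sequentially"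
    using \<open>eventually (\<lambda>n. 0 < ?F n) sequentially\<close>
  proof eventually_elim
    case (elim n)
    have "(\<Prod>k<n. ?D k) \<noteq> 0" using D by (simp add: prod_pos less_imp_neq[symmetric])
    moreover have "?R (2 * n) \<noteq> 0" using Rpos[of "2 * n"] by (rule less_imp_neq[symmetric])
    ultimately show ?case
      using F[of n] elim by (simp only: prod_dividef) (simp add: frac_eq_eq mult_ac)
  qed
  ultimately have "(\<lambda>n. \<Prod>k<n. (1 - r\<^sup>2 * q ^ k) / ?D k) \<longlonglongrightarrow> mehler r s s'"
    using L by (simp add: tendsto_cong)
  then have "(\<lambda>n. \<Prod>k<Suc n. (1 - r\<^sup>2 * q ^ k) / ?D k) \<longlonglongrightarrow> mehler r s s'"
    by (rule LIMSEQ_Suc)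
  then show "(\<lambda>k. (1 - r\<^sup>2 * q ^ k) / ?D k) has_prod mehler r s s'"
    using pos by (simp add: has_prod_def raw_has_prod_def lessThan_Suc_atMost)
qed

end

section \<open>A finite form of the Jacobi triple product\<close>

text \<open>For every integer i the product i (i - 1) is even and nonnegative, so neither
  \<open>div\<close> nor \<open>nat\<close> loses anything, and q^\<open>tri i\<close> is an
  ordinary power even for q = 0.\<close>

definition tri :: "int \<Rightarrow> nat" where
  "tri i = nat (i * (i - 1) div 2)"

lemma tri_eq: "2 * int (tri i) = i * (i - 1)"
proof -
  have "0 \<le> i * (i - 1)"
    by (cases "i \<le> 0") (auto simp: mult_nonpos_nonpos)
  moreover have "even (i * (i - 1))" by simp
  ultimately show ?thesis
    by (simp add: tri_def)
qed

text \<open>Exponents of q are compared after doubling, where \<open>tri_eq\<close> replaces the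
  division by a polynomial.\<close>

lemma nat_eq_by_twice_int: "2 * int m = 2 * int n \<Longrightarrow> m = n"
  by simp

lemma tri_0 [simp]: "tri 0 = 0"
  by (simp add: tri_def)

lemma poly_mult_linear:
  fixes z x y :: complex and c c' :: "nat \<Rightarrow> real"
  assumes "of_real (c' 0) = x * of_real (c 0)"
    and "\<And>j. j \<le> N \<Longrightarrow> of_real (c' (Suc j)) = x * of_real (c (Suc j)) + y * of_real (c j)"
    and "c (Suc N) = 0"
  shows "(x + y * z) * (\<Sum>j\<le>N. of_real (c j) * z ^ j) = (\<Sum>j\<le>Suc N. of_real (c' j) * z ^ j)"
proof -
  have "(\<Sum>j\<le>Suc N. of_real (c' j) * z ^ j)
      = x * of_real (c 0) + (\<Sum>j\<le>N. (x * of_real (c (Suc j)) + y * of_real (c j)) * z ^ Suc j)"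
    unfolding sum.atMost_Suc_shift using assms(1,2) by simp
  also have "\<dots> = x * (of_real (c 0) + (\<Sum>j\<le>N. of_real (c (Suc j)) * z ^ Suc j)) + y * z * (\<Sum>j\<le>N. of_real (c j) * z ^ j)"
    by (simp add: sum_distrib_left sum.distrib ring_distribs mult_ac)
  also have "of_real (c 0) + (\<Sum>j\<le>N. of_real (c (Suc j)) * z ^ Suc j) = (\<Sum>j\<le>Suc N. of_real (c j) * z ^ j)"
    unfolding sum.atMost_Suc_shift[where g = "\<lambda>j. of_real (c j) * z ^ j"] by simp
  also have "\<dots> = (\<Sum>j\<le>N. of_real (c j) * z ^ j)"
    using assms(3) by simp
  finally show ?thesis by (simp add: ring_distribs)
qed

context q_disc
begin

definition qbin :: "nat \<Rightarrow> nat \<Rightarrow> real" where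
  "qbin n j = (if j \<le> n then q_poch q n / (q_poch q j * q_poch q (n - j)) else 0)"

lemma qbin_simps [simp]: "qbin n 0 = 1" "qbin n n = 1" "n < j \<Longrightarrow> qbin n j = 0"
  by (simp_all add: qbin_def)

text \<open>Two q-Pascal rules, one for each kind of linear factor in the triple product: the first
  adds a factor 1 - q^a z, the second a factor z - q^(b+1).\<close>

lemma qbin_pascal:
  assumes "j \<le> n"
  shows "qbin (Suc n) (Suc j) = qbin n (Suc j) + q ^ (n - j) * qbin n j"
    and "qbin (Suc n) (Suc j) = qbin n j + q ^ Suc j * qbin n (Suc j)"
proof -
  have *: "qbin (Suc n) (Suc j) = qbin n (Suc j) + q ^ (n - j) * qbin n j \<and>
     qbin (Suc n) (Suc j) = qbin n j + q ^ Suc j * qbin n (Suc j)"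
  proof (cases "j = n")
    case True
    then show ?thesis by simp
  next
    case False
    then obtain m where n: "n = Suc (j + m)"
      using assms less_imp_Suc_add[of j n] by auto
    define A B C e f where "A = q_poch q n" and "B = q_poch q j" and "C = q_poch q m"
      and "e = q ^ Suc j" and "f = q ^ Suc m"
    have nz: "A \<noteq> 0" "B \<noteq> 0" "C \<noteq> 0" "1 - e \<noteq> 0" "1 - f \<noteq> 0"
      using q_power_less[of j] q_power_less[of m] by (auto simp: A_def B_def C_def e_def f_def simp del: power_Suc)
    have ef: "q ^ Suc n = e * f" by (simp add: e_def f_def n power_add)
    have "qbin (Suc n) (Suc j) = A * (1 - e * f) / (B * (1 - e) * (C * (1 - f)))"
      using n unfolding qbin_def A_def B_def C_def q_poch_Suc ef e_def f_def
      by (simp add: q_poch_Suc del: power_Suc)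
    moreover have "qbin n (Suc j) = A / (B * (1 - e) * C)"
      using n by (simp add: qbin_def A_def B_def C_def e_def q_poch_Suc del: power_Suc)
    moreover have "qbin n j = A / (B * (C * (1 - f)))"
      using n by (simp add: qbin_def A_def B_def C_def f_def q_poch_Suc Suc_diff_le del: power_Suc)
    moreover have "q ^ (n - j) = f" using n by (simp add: f_def Suc_diff_le del: power_Suc)
    moreover have "A * (1 - e * f) / (B * (1 - e) * (C * (1 - f))) = A / (B * (1 - e) * C) + f * (A / (B * (C * (1 - f))))"
       "A * (1 - e * f) / (B * (1 - e) * (C * (1 - f))) = A / (B * (C * (1 - f))) + e * (A / (B * (1 - e) * C))"
      using nz by (simp_all add: divide_simps) (simp_all add: algebra_simps)
    ultimately show ?thesis
      unfolding e_def[symmetric] by (simp only: simp_thms)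
  qed
  show "qbin (Suc n) (Suc j) = qbin n (Suc j) + q ^ (n - j) * qbin n j"
    and "qbin (Suc n) (Suc j) = qbin n j + q ^ Suc j * qbin n (Suc j)"
    using * by auto
qed

text \<open>The exponent is shifted by b to avoid negative powers: after division by z^b, index j
  carries z^(j-b) with coefficient (-1)^(j-b) q^\<open>tri (j - b)\<close> times a Gaussian
  binomial, as in Jacobi's series.\<close>

definition jac :: "nat \<Rightarrow> nat \<Rightarrow> nat \<Rightarrow> real" where
  "jac a b j = (- 1) ^ (j + b) * q ^ tri (int j - int b) * qbin (a + b) j"

text \<open>Induction adding one linear factor at a time, first all factors 1 - q^k z with b = 0,
  then the factors z - q^(k+1).\<close>

lemma finite_triple_product:
  fixes z :: complex
  shows "(\<Prod>k<a. 1 - of_real (q ^ k) * z) * (\<Prod>k<b. z - of_real (q ^ Suc k)) =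
     (\<Sum>j\<le>a + b. of_real (jac a b j) * z ^ j)"
proof (induction b)
  case 0
  show ?case
  proof (induction a)
    case 0
    then show ?case by (simp add: jac_def)
  next
    case (Suc a)
    have "(\<Prod>k<Suc a. 1 - of_real (q ^ k) * z) = (1 + (- of_real (q ^ a)) * z) * (\<Sum>j\<le>a. of_real (jac a 0 j) * z ^ j)"
      using Suc by (simp add: mult.commute)
    also have "\<dots> = (\<Sum>j\<le>Suc a. of_real (jac (Suc a) 0 j) * z ^ j)"
    proof (rule poly_mult_linear)
      fix j assume j: "j \<le> a"
      have "2 * int (a + tri (int j)) = 2 * int (tri (int (Suc j)) + (a - j))"
        unfolding of_nat_add ring_distribs tri_eq using j by (simp add: of_nat_diff algebra_simps)
      then have "a + tri (int j) = tri (int (Suc j)) + (a - j)" by (rule nat_eq_by_twice_int)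
      then have "q ^ a * q ^ tri (int j) = q ^ tri (int (Suc j)) * q ^ (a - j)"
        by (simp flip: power_add)
      then have "jac (Suc a) 0 (Suc j) = jac a 0 (Suc j) - q ^ a * jac a 0 j"
        using qbin_pascal(1)[OF j] unfolding jac_def by (simp add: algebra_simps)
      then show "of_real (jac (Suc a) 0 (Suc j)) = 1 * of_real (jac a 0 (Suc j)) + - of_real (q ^ a) * complex_of_real (jac a 0 j)"
        by simp
    qed (simp_all add: jac_def)
    finally show ?case by simp
  qed
next
  case (Suc b)
  have "(\<Prod>k<a. 1 - of_real (q ^ k) * z) * (\<Prod>k<Suc b. z - of_real (q ^ Suc k)) =
      (- of_real (q ^ Suc b) + 1 * z) * (\<Sum>j\<le>a + b. of_real (jac a b j) * z ^ j)"
    unfolding Suc[symmetric] by (simp add: algebra_simps)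
  also have "\<dots> = (\<Sum>j\<le>Suc (a + b). of_real (jac a (Suc b) j) * z ^ j)"
  proof (rule poly_mult_linear)
    have "2 * int (tri (- int (Suc b))) = 2 * int (Suc b + tri (- int b))"
      unfolding of_nat_add ring_distribs tri_eq by (simp add: algebra_simps)
    then have "tri (- int (Suc b)) = Suc b + tri (- int b)" by (rule nat_eq_by_twice_int)
    then have "jac a (Suc b) 0 = - (q ^ Suc b) * jac a b 0"
      by (simp add: jac_def power_add del: of_nat_Suc)
    then show "of_real (jac a (Suc b) 0) = - of_real (q ^ Suc b) * complex_of_real (jac a b 0)"
      by simp
  next
    fix j assume j: "j \<le> a + b"
    have "2 * int (Suc b + tri (int (Suc j) - int b)) = 2 * int (tri (int j - int b) + Suc j)"
      unfolding of_nat_add ring_distribs tri_eq by (simp add: algebra_simps)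
    then have "Suc b + tri (int (Suc j) - int b) = tri (int j - int b) + Suc j" by (rule nat_eq_by_twice_int)
    then have "q ^ Suc b * q ^ tri (int (Suc j) - int b) = q ^ tri (int j - int b) * q ^ Suc j"
      by (simp only: power_add[symmetric])
    moreover have "q ^ Suc b * jac a b (Suc j) = (- 1) ^ (Suc j + b) * (q ^ Suc b * q ^ tri (int (Suc j) - int b)) * qbin (a + b) (Suc j)"
      by (simp only: jac_def mult_ac)
    ultimately have "q ^ Suc b * jac a b (Suc j) = - ((- 1) ^ (j + b)) * (q ^ tri (int j - int b) * q ^ Suc j) * qbin (a + b) (Suc j)"
      by simp
    moreover have "jac a (Suc b) (Suc j) = (- 1) ^ (j + b) * q ^ tri (int j - int b) * qbin (Suc (a + b)) (Suc j)"
      by (simp add: jac_def)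
    ultimately have "jac a (Suc b) (Suc j) = - (q ^ Suc b) * jac a b (Suc j) + jac a b j"
      unfolding qbin_pascal(2)[OF j] by (simp add: jac_def ring_distribs mult_ac del: power_Suc)
    then show "of_real (jac a (Suc b) (Suc j)) = - of_real (q ^ Suc b) * of_real (jac a b (Suc j)) + 1 * complex_of_real (jac a b j)"
      by simp
  qed (simp add: jac_def)
  finally show ?case by simp
qed

end

section \<open>Fourier coefficients of the weight\<close>

text \<open>The interval is [-pi, 0] rather than [0, pi] because cos increases there, as the
  substitution rules used later demand.\<close>

lemma has_integral_cos_even:
  "((\<lambda>\<theta>. cos (2 * of_int k * \<theta>)) has_integral (if k = 0 then pi else 0)) {-pi..0}"
proof (cases "k = 0")
  case True
  then show ?thesis using has_integral_const_real[of "1::real" "-pi" 0] by simp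
next
  case False
  have "((\<lambda>\<theta>. cos (2 * of_int k * \<theta>)) has_integral
      (sin (2 * of_int k * 0) / (2 * of_int k) - sin (2 * of_int k * (-pi)) / (2 * of_int k))) {-pi..0}"
    using False by (intro fundamental_theorem_of_calculus)
      (auto simp flip: has_real_derivative_iff_has_vector_derivative intro!: derivative_eq_intros)
  moreover have "sin (2 * of_int k * (-pi)) = (0::real)"
    using sin_int_2pin[of "- k"] by (simp add: mult_ac)
  ultimately show ?thesis using False by simp
qed

text \<open>The two forms (1 + x)^2 - s^2 x and (1 - x)^2 + (4 - s^2) x of the factor show its sign
  for x \<le> 0 and x \<ge> 0 respectively. Strictness fails at |s| = 2, x = 1, the endpoints of the
  support.\<close>

lemma weight_factor_bounds:
  fixes x s :: real
  assumes "-1 < x" "x \<le> 1" "\<bar>s\<bar> \<le> 2"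
  shows "0 \<le> (1 + x)\<^sup>2 - s\<^sup>2 * x" "(1 + x)\<^sup>2 - s\<^sup>2 * x \<le> (1 + \<bar>x\<bar>)\<^sup>2"
    and "\<bar>s\<bar> < 2 \<Longrightarrow> 0 < (1 + x)\<^sup>2 - s\<^sup>2 * x"
proof -
  have s: "s\<^sup>2 \<le> 4" using assms(3) abs_le_square_iff[of s 2] by simp
  have eq: "(1 + x)\<^sup>2 - s\<^sup>2 * x = (1 - x)\<^sup>2 + (4 - s\<^sup>2) * x"
    by (simp add: power2_eq_square algebra_simps)
  show "0 \<le> (1 + x)\<^sup>2 - s\<^sup>2 * x"
  proof (cases "0 \<le> x")
    case True
    then show ?thesis unfolding eq using s by simp
  next
    case False
    then have "s\<^sup>2 * x \<le> 0" by (simp add: mult_nonneg_nonpos)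
    then show ?thesis by (smt (verit) zero_le_power2)
  qed
  show "(1 + x)\<^sup>2 - s\<^sup>2 * x \<le> (1 + \<bar>x\<bar>)\<^sup>2"
  proof (cases "0 \<le> x")
    case True
    then show ?thesis by simp
  next
    case False
    then have "(4 - s\<^sup>2) * x \<le> 0" using s by (simp add: mult_nonneg_nonpos)
    then show ?thesis unfolding eq using False by simp
  qed
  assume s2: "\<bar>s\<bar> < 2"
  have s': "s\<^sup>2 < 4" using power_strict_mono[of "\<bar>s\<bar>" 2 2] s2 by simp
  show "0 < (1 + x)\<^sup>2 - s\<^sup>2 * x"
  proof (cases "0 < x")
    case True
    then have "0 < (4 - s\<^sup>2) * x" using s' by simp
    then show ?thesis unfolding eq by (smt (verit) zero_le_power2)
  next
    case False
    then have "s\<^sup>2 * x \<le> 0" by (simp add: mult_nonneg_nonpos)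
    moreover have "0 < (1 + x)\<^sup>2" using assms by simp
    ultimately show ?thesis by linarith
  qed
qed

lemma tri_reflect: "tri (1 - i) = tri i"
  by (rule nat_eq_by_twice_int) (simp only: tri_eq, simp add: algebra_simps)

lemma Re_mult_real: "Re (of_real x * z) = x * Re z"
  by simp

context q_disc
begin

definition weight :: "nat \<Rightarrow> real \<Rightarrow> real" where
  "weight n s = (\<Prod>k<n. (1 + q ^ k)\<^sup>2 - s\<^sup>2 * q ^ k)"

lemma q_power_range: "-1 < q ^ k" "q ^ k \<le> 1"
proof -
  have "-1 < q ^ k \<and> q ^ k \<le> 1"
  proof (cases k)
    case (Suc m)
    then have "\<bar>q ^ k\<bar> < 1"
      using q power_Suc_le_self[of "\<bar>q\<bar>" m] by (simp add: power_abs del: power_Suc)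
    then show ?thesis by linarith
  qed simp
  then show "-1 < q ^ k" "q ^ k \<le> 1" by auto
qed

lemmas weight_factor_q = weight_factor_bounds[OF q_power_range]

lemma weight_nonneg: "\<bar>s\<bar> \<le> 2 \<Longrightarrow> 0 \<le> weight n s"
  unfolding weight_def by (intro prod_nonneg weight_factor_q ballI)

text \<open>Each factor is at most (1 + |q|^k)^2 \<le> exp (2 |q|^k), so the geometric series bounds
  all truncations at once. This constant is later the dominating function.\<close>

lemma weight_bounded: "\<exists>C. \<forall>n s. \<bar>s\<bar> \<le> 2 \<longrightarrow> weight n s \<le> C"
proof (intro exI allI impI)
  fix n and s :: real assume s: "\<bar>s\<bar> \<le> 2"
  have "weight n s \<le> (\<Prod>k<n. exp (2 * \<bar>q\<bar> ^ k))"
    unfolding weight_def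
  proof (intro prod_mono conjI weight_factor_q s)
    fix k
    have "(1 + q ^ k)\<^sup>2 - s\<^sup>2 * q ^ k \<le> (1 + \<bar>q ^ k\<bar>)\<^sup>2"
      by (rule weight_factor_q[OF s])
    also have "\<dots> \<le> (exp \<bar>q ^ k\<bar>)\<^sup>2"
      by (intro power_mono) auto
    also have "\<dots> = exp (2 * \<bar>q\<bar> ^ k)"
      by (simp add: power_abs flip: exp_double)
    finally show "(1 + q ^ k)\<^sup>2 - s\<^sup>2 * q ^ k \<le> exp (2 * \<bar>q\<bar> ^ k)" .
  qed
  also have "\<dots> = exp (2 * (\<Sum>k<n. \<bar>q\<bar> ^ k))"
    by (simp add: exp_sum sum_distrib_left)
  also have "\<dots> \<le> exp (2 * (\<Sum>k. \<bar>q\<bar> ^ k))"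
    using summable_abs_q by (simp add: sum_le_suminf)
  finally show "weight n s \<le> exp (2 * (\<Sum>k. \<bar>q\<bar> ^ k))" .
qed

text \<open>For z = exp (2 i \<theta>) the factor (1 + x)^2 - 4 x (cos \<theta>)^2 is (1 - x z) (1 -
  x / z). After multiplication by z^(m+1) the second product starts at z - q^0, while
  \<open>finite_triple_product\<close> starts at z - q^1; the surplus factor is z - 1.\<close>

lemma weight_cis:
  assumes z: "z = cis (2 * \<theta>)"
  shows "of_real (weight (Suc m) (2 * cos \<theta>)) * z ^ Suc m =
     (z - 1) * (\<Sum>j\<le>Suc (2 * m). of_real (jac (Suc m) m j) * z ^ j)"
proof -
  have zc: "z * cnj z = 1" "z \<noteq> 0"
    unfolding z by (simp_all add: cis_cnj cis_mult)
  have fac: "of_real ((1 + x)\<^sup>2 - (2 * cos \<theta>)\<^sup>2 * x) = (1 - of_real x * z) * (1 - of_real x * cnj z)" for x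
  proof -
    have "z + cnj z = of_real (2 * cos (2 * \<theta>))"
      unfolding z by (simp add: complex_eq_iff)
    then have "(1 - of_real x * z) * (1 - of_real x * cnj z) = 1 - of_real x * of_real (2 * cos (2 * \<theta>)) + of_real (x\<^sup>2) * (z * cnj z)"
      by (simp only: ring_distribs of_real_power power2_eq_square flip: \<open>z + cnj z = _\<close>) (simp add: algebra_simps)
    also have "\<dots> = of_real (1 - x * (2 * cos (2 * \<theta>)) + x\<^sup>2)"
      unfolding zc by simp
    also have "1 - x * (2 * cos (2 * \<theta>)) + x\<^sup>2 = (1 + x)\<^sup>2 - (2 * cos \<theta>)\<^sup>2 * x"
      unfolding cos_double_cos by (simp add: power2_eq_square algebra_simps)
    finally show ?thesis by simp
  qed
  have zfac: "(1 - of_real x * cnj z) * z = z - of_real x" for x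
    using zc by (simp add: algebra_simps)
  have "of_real (weight (Suc m) (2 * cos \<theta>)) * z ^ Suc m =
     (\<Prod>k<Suc m. (1 - of_real (q ^ k) * z) * ((1 - of_real (q ^ k) * cnj z) * z))"
    unfolding weight_def of_real_prod fac prod.distrib
    by (simp add: mult_ac)
  also have "\<dots> = (\<Prod>k<Suc m. 1 - of_real (q ^ k) * z) * (\<Prod>k<Suc m. z - of_real (q ^ k))"
    unfolding zfac prod.distrib ..
  also have "(\<Prod>k<Suc m. z - of_real (q ^ k)) = (z - 1) * (\<Prod>k<m. z - of_real (q ^ Suc k))"
    by (subst prod.lessThan_Suc_shift) simp
  also have "(\<Prod>k<Suc m. 1 - of_real (q ^ k) * z) * \<dots> =
      (z - 1) * (\<Sum>j\<le>Suc m + m. of_real (jac (Suc m) m j) * z ^ j)"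
    unfolding finite_triple_product[symmetric] by (simp only: mult_ac)
  also have "Suc m + m = Suc (2 * m)" by simp
  finally show ?thesis .
qed

text \<open>For even degree the polynomial, like the weight, is a Laurent polynomial in z = exp (2 i
  \<theta>); odd degrees are later dismissed by parity. The factor z - 1 of
  \<open>weight_cis\<close> becomes the difference of two cosines.\<close>

lemma weight_rogers_fourier:
  "weight (Suc m) (2 * cos \<theta>) * rogers q (2 * n) (2 * cos \<theta>) =
    (\<Sum>j\<le>Suc (2 * m). \<Sum>l\<le>2 * n. jac (Suc m) m j * qbin (2 * n) l *
       (cos (2 * of_int (int (j + l) - int (m + n)) * \<theta>) - cos (2 * of_int (int (j + l) - int (Suc m + n)) * \<theta>)))"
proof -
  define z where "z = cis (2 * \<theta>)"
  have zn: "z \<noteq> 0" by (simp add: z_def)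
  have zp: "z powi k = cis (2 * of_int k * \<theta>)" for k
    unfolding z_def by (simp add: cis_power_int mult_ac)
  have r: "of_real (rogers q (2 * n) (2 * cos \<theta>)) * z ^ n = (\<Sum>l\<le>2 * n. of_real (qbin (2 * n) l) * z ^ l)"
  proof -
    have "cis \<theta> ^ l * cis (- \<theta>) ^ (2 * n - l) * z ^ n = z ^ l" if "l \<le> 2 * n" for l
    proof -
      have "real l * \<theta> + real (2 * n - l) * (- \<theta>) + real n * (2 * \<theta>) = real l * (2 * \<theta>)"
        using that by (simp add: of_nat_diff algebra_simps)
      then have "cis (real l * \<theta>) * cis (real (2 * n - l) * (- \<theta>)) * cis (real n * (2 * \<theta>)) = cis (real l * (2 * \<theta>))"
        by (simp only: cis_mult)
      then show ?thesis
        unfolding z_def by (simp only: Complex.DeMoivre)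
    qed
    note pw = this
    show ?thesis
      unfolding rogers_cis sum_distrib_left sum_distrib_right
    proof (intro sum.cong refl)
      fix l assume l: "l \<in> {..2 * n}"
      have "of_real (q_poch q (2 * n)) * (cis \<theta> ^ l / of_real (q_poch q l) * (cis (- \<theta>) ^ (2 * n - l) / of_real (q_poch q (2 * n - l)))) * z ^ n
         = of_real (qbin (2 * n) l) * (cis \<theta> ^ l * cis (- \<theta>) ^ (2 * n - l) * z ^ n)"
        using l by (simp add: qbin_def)
      then show "of_real (q_poch q (2 * n)) * (cis \<theta> ^ l / of_real (q_poch q l) * (cis (- \<theta>) ^ (2 * n - l) / of_real (q_poch q (2 * n - l)))) * z ^ n
         = of_real (qbin (2 * n) l) * z ^ l"
        using pw l by simp
    qed
  qed
  have "of_real (weight (Suc m) (2 * cos \<theta>) * rogers q (2 * n) (2 * cos \<theta>)) * z ^ (Suc m + n) =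
     (of_real (weight (Suc m) (2 * cos \<theta>)) * z ^ Suc m) * (of_real (rogers q (2 * n) (2 * cos \<theta>)) * z ^ n)"
    by (simp add: power_add mult_ac)
  also have "\<dots> = (\<Sum>j\<le>Suc (2 * m). \<Sum>l\<le>2 * n. of_real (jac (Suc m) m j * qbin (2 * n) l) * (z ^ Suc (j + l) - z ^ (j + l)))"
    unfolding weight_cis[OF z_def] r mult.assoc unfolding sum_product unfolding sum_distrib_left
    by (intro sum.cong refl) (simp add: power_add algebra_simps)
  finally have "of_real (weight (Suc m) (2 * cos \<theta>) * rogers q (2 * n) (2 * cos \<theta>)) =
     (\<Sum>j\<le>Suc (2 * m). \<Sum>l\<le>2 * n. of_real (jac (Suc m) m j * qbin (2 * n) l) * (z ^ Suc (j + l) - z ^ (j + l))) / z ^ (Suc m + n)"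
    using zn by (intro nonzero_eq_divide_eq[THEN iffD2]) (simp_all only: power_not_zero not_False_eq_True)
  also have "\<dots> = (\<Sum>j\<le>Suc (2 * m). \<Sum>l\<le>2 * n. of_real (jac (Suc m) m j * qbin (2 * n) l) *
      (cis (2 * of_int (int (j + l) - int (m + n)) * \<theta>) - cis (2 * of_int (int (j + l) - int (Suc m + n)) * \<theta>)))"
    unfolding sum_divide_distrib zp[symmetric]
  proof (intro sum.cong refl)
    fix j l
    have "z powi (int (j + l) - int (m + n)) = z ^ Suc (j + l) / z ^ (Suc m + n)"
      using zn power_int_diff[of z "int (Suc (j + l))" "int (Suc m + n)"] by (simp add: power_int_of_nat del: of_nat_Suc of_nat_add) (simp add: algebra_simps)
    moreover have "z powi (int (j + l) - int (Suc m + n)) = z ^ (j + l) / z ^ (Suc m + n)"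
      using zn power_int_diff[of z "int (j + l)" "int (Suc m + n)"] by (simp only: power_int_of_nat disj_not1 simp_thms)
    ultimately show "of_real (jac (Suc m) m j * qbin (2 * n) l) * (z ^ Suc (j + l) - z ^ (j + l)) / z ^ (Suc m + n) =
      of_real (jac (Suc m) m j * qbin (2 * n) l) * (z powi (int (j + l) - int (m + n)) - z powi (int (j + l) - int (Suc m + n)))"
      by (simp only: diff_divide_distrib right_diff_distrib times_divide_eq_right)
  qed
  finally have "Re (of_real (weight (Suc m) (2 * cos \<theta>) * rogers q (2 * n) (2 * cos \<theta>))) =
    Re (\<Sum>j\<le>Suc (2 * m). \<Sum>l\<le>2 * n. of_real (jac (Suc m) m j * qbin (2 * n) l) *
      (cis (2 * of_int (int (j + l) - int (m + n)) * \<theta>) - cis (2 * of_int (int (j + l) - int (Suc m + n)) * \<theta>)))"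
    by (rule arg_cong)
  then show ?thesis
    by (simp only: Re_complex_of_real Re_sum Re_mult_real minus_complex.sel cis.sel)
qed

text \<open>Only the constant terms survive, at j = m + n - l and j = m + 1 + n - l. The assumption
  n \<le> m keeps both within the range of summation and makes the natural subtractions
  genuine.\<close>

lemma weight_rogers_integral:
  assumes "n \<le> m"
  shows "((\<lambda>\<theta>. weight (Suc m) (2 * cos \<theta>) * rogers q (2 * n) (2 * cos \<theta>)) has_integral
     pi * (\<Sum>l\<le>2 * n. qbin (2 * n) l * (jac (Suc m) m (m + n - l) - jac (Suc m) m (Suc m + n - l)))) {-pi..0}"
proof -
  let ?I = "\<lambda>k::int. if k = 0 then pi else 0"
  have "((\<lambda>\<theta>. weight (Suc m) (2 * cos \<theta>) * rogers q (2 * n) (2 * cos \<theta>)) has_integral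
    (\<Sum>j\<le>Suc (2 * m). \<Sum>l\<le>2 * n. jac (Suc m) m j * qbin (2 * n) l *
       (?I (int (j + l) - int (m + n)) - ?I (int (j + l) - int (Suc m + n))))) {-pi..0}"
    unfolding weight_rogers_fourier
    by (intro has_integral_sum has_integral_mult_right has_integral_diff has_integral_cos_even) auto
  also have "(\<Sum>j\<le>Suc (2 * m). \<Sum>l\<le>2 * n. jac (Suc m) m j * qbin (2 * n) l *
       (?I (int (j + l) - int (m + n)) - ?I (int (j + l) - int (Suc m + n)))) =
     (\<Sum>l\<le>2 * n. \<Sum>j\<le>Suc (2 * m). jac (Suc m) m j * qbin (2 * n) l *
       (?I (int (j + l) - int (m + n)) - ?I (int (j + l) - int (Suc m + n))))"
    by (rule sum.swap)
  also have "\<dots> = (\<Sum>l\<le>2 * n. pi * (qbin (2 * n) l * (jac (Suc m) m (m + n - l) - jac (Suc m) m (Suc m + n - l))))"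
  proof (intro sum.cong refl)
    fix l assume l: "l \<in> {..2 * n}"
    have I: "?I (int (j + l) - int k) = (if j = k - l then pi else 0)" if "l \<le> k" for j k
      using that by (auto simp: of_nat_diff)
    have "(\<Sum>j\<le>Suc (2 * m). jac (Suc m) m j * qbin (2 * n) l *
       (?I (int (j + l) - int (m + n)) - ?I (int (j + l) - int (Suc m + n)))) =
      (\<Sum>j\<le>Suc (2 * m). (if j = m + n - l then jac (Suc m) m j * qbin (2 * n) l * pi else 0))
      - (\<Sum>j\<le>Suc (2 * m). (if j = Suc m + n - l then jac (Suc m) m j * qbin (2 * n) l * pi else 0))"
      unfolding sum_subtractf[symmetric]
    proof (intro sum.cong refl)
      fix j
      have "l \<le> m + n" "l \<le> Suc m + n" using l assms by auto
      then show "jac (Suc m) m j * qbin (2 * n) l * (?I (int (j + l) - int (m + n)) - ?I (int (j + l) - int (Suc m + n))) =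
        (if j = m + n - l then jac (Suc m) m j * qbin (2 * n) l * pi else 0)
        - (if j = Suc m + n - l then jac (Suc m) m j * qbin (2 * n) l * pi else 0)"
        by (simp only: I) auto
    qed
    also have "\<dots> = pi * (qbin (2 * n) l * (jac (Suc m) m (m + n - l) - jac (Suc m) m (Suc m + n - l)))"
    proof -
      have "m + n - l \<in> {..Suc (2 * m)}" "Suc m + n - l \<in> {..Suc (2 * m)}" using l assms by auto
      then show ?thesis by (simp only: sum.delta finite_atMost if_True) (simp add: algebra_simps)
    qed
    finally show "(\<Sum>j\<le>Suc (2 * m). jac (Suc m) m j * qbin (2 * n) l *
       (?I (int (j + l) - int (m + n)) - ?I (int (j + l) - int (Suc m + n)))) =
       pi * (qbin (2 * n) l * (jac (Suc m) m (m + n - l) - jac (Suc m) m (Suc m + n - l)))" .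
  qed
  finally show ?thesis by (simp add: sum_distrib_left)
qed

lemma qbin_tendsto:
  assumes "filterlim a at_top sequentially" "filterlim b at_top sequentially"
    and "\<And>m. c m = a m + b m"
  shows "(\<lambda>m. qbin (c m) (a m)) \<longlonglongrightarrow> 1 / q_inf"
proof -
  have c: "filterlim c at_top sequentially"
    by (rule filterlim_at_top_mono[OF assms(1)]) (simp add: assms(3))
  have "(\<lambda>m. q_poch q (c m) / (q_poch q (a m) * q_poch q (b m))) \<longlonglongrightarrow> q_inf / (q_inf * q_inf)"
    using q_inf_nz by (intro tendsto_intros filterlim_compose[OF q_poch_LIMSEQ] assms c) auto
  then show ?thesis
    using q_inf_nz by (simp add: qbin_def assms(3))
qed

text \<open>For n > 0 the factor 1 - q^0 z of the triple product with a = b = n vanishes at z =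
  1.\<close>

lemma jac_sum: "(\<Sum>l\<le>2 * n. (- 1) ^ (l + n) * q ^ tri (int l - int n) * qbin (2 * n) l) = (if n = 0 then 1 else 0)"
proof -
  have "(\<Sum>j\<le>n + n. complex_of_real (jac n n j) * 1 ^ j) = (if n = 0 then 1 else 0)"
    unfolding finite_triple_product[symmetric] by (auto intro: bexI[of _ 0])
  then have "(\<Sum>j\<le>n + n. jac n n j) = (if n = 0 then 1 else 0)"
    by (simp flip: of_real_sum split: if_splits)
  then show ?thesis by (simp add: jac_def mult_2)
qed

lemma jac_sum': "(\<Sum>l\<le>2 * n. (- 1) ^ (l + n) * q ^ tri (int n - int l) * qbin (2 * n) l) = (if n = 0 then 1 else 0)"
proof -
  have "(\<Sum>l\<le>2 * n. (- 1) ^ (l + n) * q ^ tri (int n - int l) * qbin (2 * n) l) =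
     (\<Sum>l\<le>2 * n. (- 1) ^ (l + n) * q ^ tri (int l - int n) * qbin (2 * n) l)"
  proof (rule sum.reindex_bij_witness[of _ "\<lambda>l. 2 * n - l" "\<lambda>l. 2 * n - l"])
    fix l assume l: "l \<in> {..2 * n}"
    have "(- 1 :: real) ^ (2 * n - l + n) = (- 1) ^ (l + n)"
      using l by (simp add: minus_one_power_iff)
    moreover have "int (2 * n - l) - int n = int n - int l" using l by (simp add: of_nat_diff)
    moreover have "qbin (2 * n) (2 * n - l) = qbin (2 * n) l" using l by (simp add: qbin_def mult.commute)
    ultimately show "(- 1) ^ (2 * n - l + n) * q ^ tri (int (2 * n - l) - int n) * qbin (2 * n) (2 * n - l) =
      (- 1) ^ (l + n) * q ^ tri (int n - int l) * qbin (2 * n) l" by simp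
  qed auto
  then show ?thesis by (simp add: jac_sum)
qed

text \<open>As m grows, every binomial with top 2m + 1 tends to 1/\<open>q_inf\<close>, and the sums
  of \<open>jac_sum\<close> and \<open>jac_sum'\<close> remain, one for each surviving constant
  term. At n = 0 both equal 1, whence the factor 2.\<close>

lemma weight_rogers_integral_tendsto:
  "(\<lambda>m. integral {-pi..0} (\<lambda>\<theta>. weight (Suc m) (2 * cos \<theta>) * rogers q (2 * n) (2 * cos \<theta>)))
    \<longlonglongrightarrow> (if n = 0 then 2 * pi / q_inf else 0)"
proof -
  let ?e = "\<lambda>l. (- 1) ^ (l + n) :: real"
  have lim: "(\<lambda>m. qbin (2 * n) l * (?e l * q ^ tri (int n - int l) * qbin (Suc (2 * m)) (m + n - l)
      + ?e l * q ^ tri (int l - int n) * qbin (Suc (2 * m)) (Suc m + n - l)))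
    \<longlonglongrightarrow> qbin (2 * n) l * (?e l * q ^ tri (int n - int l) * (1 / q_inf) + ?e l * q ^ tri (int l - int n) * (1 / q_inf))" if l: "l \<le> 2 * n" for l
  proof -
    have top: "filterlim (\<lambda>m. m + k) at_top sequentially" for k :: nat
      by (rule filterlim_at_top_mono[OF filterlim_ident]) auto
    \<comment> \<open>With m + n in place of m the truncated difference m + n - l becomes m + (2n -
      l), which visibly tends to infinity; the shift is undone by
      \<open>LIMSEQ_offset\<close>.\<close>
    have "(\<lambda>m. qbin (Suc (2 * (m + n))) (m + (2 * n - l))) \<longlonglongrightarrow> 1 / q_inf"
      using l by (intro qbin_tendsto[where b = "\<lambda>m. m + Suc l"] top) auto
    moreover have "m + (2 * n - l) = m + n + n - l" for m using l by simp
    ultimately have "(\<lambda>m. qbin (Suc (2 * (m + n))) (m + n + n - l)) \<longlonglongrightarrow> 1 / q_inf" by simp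
    then have L1: "(\<lambda>m. qbin (Suc (2 * m)) (m + n - l)) \<longlonglongrightarrow> 1 / q_inf"
      by (rule LIMSEQ_offset)
    have "(\<lambda>m. qbin (Suc (2 * (m + n))) (m + (Suc (2 * n) - l))) \<longlonglongrightarrow> 1 / q_inf"
      using l by (intro qbin_tendsto[where b = "\<lambda>m. m + l"] top) auto
    moreover have "m + (Suc (2 * n) - l) = Suc (m + n) + n - l" for m using l by simp
    ultimately have "(\<lambda>m. qbin (Suc (2 * (m + n))) (Suc (m + n) + n - l)) \<longlonglongrightarrow> 1 / q_inf" by simp
    then have L2: "(\<lambda>m. qbin (Suc (2 * m)) (Suc m + n - l)) \<longlonglongrightarrow> 1 / q_inf"
      by (rule LIMSEQ_offset)
    show ?thesis by (intro tendsto_mult tendsto_add tendsto_const L1 L2)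
  qed
  have "(\<lambda>m. pi * (\<Sum>l\<le>2 * n. qbin (2 * n) l * (?e l * q ^ tri (int n - int l) * qbin (Suc (2 * m)) (m + n - l)
      + ?e l * q ^ tri (int l - int n) * qbin (Suc (2 * m)) (Suc m + n - l))))
    \<longlonglongrightarrow> pi * (\<Sum>l\<le>2 * n. qbin (2 * n) l * (?e l * q ^ tri (int n - int l) * (1 / q_inf) + ?e l * q ^ tri (int l - int n) * (1 / q_inf)))"
    by (intro tendsto_mult tendsto_const tendsto_sum lim) auto
  also have "(\<Sum>l\<le>2 * n. qbin (2 * n) l * (?e l * q ^ tri (int n - int l) * (1 / q_inf) + ?e l * q ^ tri (int l - int n) * (1 / q_inf)))
    = (1 / q_inf) * ((\<Sum>l\<le>2 * n. ?e l * q ^ tri (int n - int l) * qbin (2 * n) l) + (\<Sum>l\<le>2 * n. ?e l * q ^ tri (int l - int n) * qbin (2 * n) l))"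
    unfolding sum.distrib[symmetric] sum_distrib_left by (intro sum.cong refl) (simp only: ring_distribs mult_ac)
  also have "pi * \<dots> = (if n = 0 then 2 * pi / q_inf else 0)"
    unfolding jac_sum jac_sum' by simp
  finally have L: "(\<lambda>m. pi * (\<Sum>l\<le>2 * n. qbin (2 * n) l * (?e l * q ^ tri (int n - int l) * qbin (Suc (2 * m)) (m + n - l)
      + ?e l * q ^ tri (int l - int n) * qbin (Suc (2 * m)) (Suc m + n - l)))) \<longlonglongrightarrow> (if n = 0 then 2 * pi / q_inf else 0)" .
  show ?thesis
  proof (rule Lim_transform_eventually[OF L])
    show "\<forall>\<^sub>F m in sequentially. pi * (\<Sum>l\<le>2 * n. qbin (2 * n) l * (?e l * q ^ tri (int n - int l) * qbin (Suc (2 * m)) (m + n - l)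
      + ?e l * q ^ tri (int l - int n) * qbin (Suc (2 * m)) (Suc m + n - l))) =
        integral {-pi..0} (\<lambda>\<theta>. weight (Suc m) (2 * cos \<theta>) * rogers q (2 * n) (2 * cos \<theta>))"
      using eventually_ge_at_top[of n]
    proof eventually_elim
      case (elim m)
      have "(\<Sum>l\<le>2 * n. qbin (2 * n) l * (?e l * q ^ tri (int n - int l) * qbin (Suc (2 * m)) (m + n - l)
          + ?e l * q ^ tri (int l - int n) * qbin (Suc (2 * m)) (Suc m + n - l)))
        = (\<Sum>l\<le>2 * n. qbin (2 * n) l * (jac (Suc m) m (m + n - l) - jac (Suc m) m (Suc m + n - l)))"
      proof (intro sum.cong refl)
        fix l assume "l \<in> {..2 * n}"
        then have l: "l \<le> m + n" "l \<le> Suc m + n" using elim by auto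
        \<comment> \<open>The second index yields 1 - (l - n), and \<open>tri\<close> is invariant
          under i -> 1 - i. The sign from the extra index cancels the minus sign of the
          difference.\<close>
        have "int (m + n - l) - int m = int n - int l" "int (Suc m + n - l) - int m = 1 - (int l - int n)"
          using l by (simp_all add: of_nat_diff)
        then have "int (m + n - l) - int m = int n - int l" "tri (int (Suc m + n - l) - int m) = tri (int l - int n)"
          by (simp_all only: tri_reflect)
        moreover have "(- 1 :: real) ^ (m + n - l + m) = ?e l" "(- 1 :: real) ^ (Suc m + n - l + m) = - ?e l"
          using l by (auto simp: minus_one_power_iff)
        ultimately show "qbin (2 * n) l * (?e l * q ^ tri (int n - int l) * qbin (Suc (2 * m)) (m + n - l)
          + ?e l * q ^ tri (int l - int n) * qbin (Suc (2 * m)) (Suc m + n - l)) =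
          qbin (2 * n) l * (jac (Suc m) m (m + n - l) - jac (Suc m) m (Suc m + n - l))"
          unfolding jac_def by (simp add: tri_reflect mult_2)
      qed
      then show ?case
        using integral_unique[OF weight_rogers_integral[OF elim]] by simp
    qed
  qed
qed

end

section \<open>Integration against the q-normal density\<close>

lemma abs_2_cos: "\<bar>2 * cos \<theta>\<bar> \<le> (2::real)"
  by (simp add: abs_mult)

context q_disc
begin

abbreviation scale :: real where "scale \<equiv> sqrt (1 - q)"

lemma q_less_1: "q < 1" and q_neq_1: "q \<noteq> 1"
  using q by auto

lemma scale_pos: "0 < scale"
  using q_less_1 by simp

lemma scale_sq: "(scale * x)\<^sup>2 = (1 - q) * x\<^sup>2"
  using q_less_1 by (simp add: power_mult_distrib)

lemma q_supp_iff: "x \<in> q_supp q \<longleftrightarrow> \<bar>scale * x\<bar> \<le> 2"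
proof -
  have "x \<in> q_supp q \<longleftrightarrow> - 2 / scale \<le> x \<and> x \<le> 2 / scale"
    using q_neq_1 by (simp add: q_supp_def)
  also have "\<dots> \<longleftrightarrow> - 2 \<le> scale * x \<and> scale * x \<le> 2"
    using pos_divide_le_eq[OF scale_pos, of "- 2" x] pos_le_divide_eq[OF scale_pos, of x 2]
    by (simp only: mult.commute)
  finally show ?thesis by (auto simp: abs_le_iff)
qed

text \<open>Only the product depending on x is truncated; the constant \<open>q_inf\<close> stays
  exact, so it appears unchanged as the normalisation of the limit.\<close>

definition f_approx :: "nat \<Rightarrow> real \<Rightarrow> real" where
  "f_approx n x = (if x \<in> q_supp q then
      scale / (2 * pi * sqrt (4 - (scale * x)\<^sup>2)) * weight n (scale * x) * q_inf else 0)"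

lemma f_N_eq:
  "f_N q x = (if x \<in> q_supp q then scale / (2 * pi * sqrt (4 - (scale * x)\<^sup>2)) *
     (\<Prod>k. (1 + q ^ k)\<^sup>2 - (scale * x)\<^sup>2 * q ^ k) * q_inf else 0)"
  using q_neq_1 by (simp add: f_N_def q_inf_def scale_sq)

lemma weight_tendsto:
  assumes "\<bar>s\<bar> < 2"
  shows "(\<lambda>n. weight n s) \<longlonglongrightarrow> (\<Prod>k. (1 + q ^ k)\<^sup>2 - s\<^sup>2 * q ^ k)"
proof -
  have eq: "(1 + q ^ k)\<^sup>2 - s\<^sup>2 * q ^ k = 1 + (q ^ k * (q ^ k + 2 - s\<^sup>2))" for k
    by (simp add: power2_eq_square algebra_simps)
  have "convergent_prod (\<lambda>k. (1 + q ^ k)\<^sup>2 - s\<^sup>2 * q ^ k)"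
    unfolding eq
  proof (rule summable_imp_convergent_prod_real)
    have "summable (\<lambda>k. (3 + s\<^sup>2) * \<bar>q\<bar> ^ k)"
      by (intro summable_mult summable_abs_q)
    then show "summable (\<lambda>k. \<bar>q ^ k * (q ^ k + 2 - s\<^sup>2)\<bar>)"
    proof (rule summable_comparison_test'[where N = 0])
      fix k
      have "\<bar>q ^ k + 2 - s\<^sup>2\<bar> \<le> 3 + s\<^sup>2"
        using q_power_range[of k] zero_le_power2[of s] by (intro abs_leI) linarith+
      then have "\<bar>q ^ k\<bar> * \<bar>q ^ k + 2 - s\<^sup>2\<bar> \<le> \<bar>q ^ k\<bar> * (3 + s\<^sup>2)"
        by (intro mult_left_mono) auto
      then show "norm \<bar>q ^ k * (q ^ k + 2 - s\<^sup>2)\<bar> \<le> (3 + s\<^sup>2) * \<bar>q\<bar> ^ k"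
        by (simp add: abs_mult power_abs mult.commute)
    qed
    fix k
    have "0 < (1 + q ^ k)\<^sup>2 - s\<^sup>2 * q ^ k"
      using assms by (intro weight_factor_q) auto
    then show "q ^ k * (q ^ k + 2 - s\<^sup>2) \<noteq> - 1" unfolding eq by simp
  qed
  then have "(\<lambda>n. weight (Suc n) s) \<longlonglongrightarrow> (\<Prod>k. (1 + q ^ k)\<^sup>2 - s\<^sup>2 * q ^ k)"
    unfolding weight_def lessThan_Suc_atMost by (rule convergent_prod_LIMSEQ)
  then show ?thesis by (rule LIMSEQ_imp_Suc)
qed

lemma f_approx_tendsto: "(\<lambda>n. f_approx n x) \<longlonglongrightarrow> f_N q x"
proof (cases "\<bar>scale * x\<bar> < 2")
  case True
  then have "x \<in> q_supp q" by (simp add: q_supp_iff)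
  then show ?thesis
    unfolding f_N_eq f_approx_def by (simp only: if_True) (intro tendsto_mult tendsto_const weight_tendsto True)
next
  case False
  \<comment> \<open>\<open>weight_tendsto\<close> excludes the endpoints, where the factor with k =
    0 is 0. There the square root is 0 and division by 0 gives 0, so density and approximations all
    vanish.\<close>
  then have "x \<notin> q_supp q \<or> sqrt (4 - (scale * x)\<^sup>2) = 0"
  proof (cases "\<bar>scale * x\<bar> = 2")
    case True
    then have sq: "(scale * x)\<^sup>2 = 4" using power2_abs[of "scale * x"] by simp
    have "sqrt (4 - (scale * x)\<^sup>2) = 0" unfolding sq by simp
    then show ?thesis ..
  qed (auto simp: q_supp_iff)
  then show ?thesis
  proof
    assume r: "sqrt (4 - (scale * x)\<^sup>2) = 0"
    show ?thesis unfolding f_N_eq f_approx_def r by simp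
  qed (simp add: f_N_eq f_approx_def)
qed

lemma f_approx_nonneg: "0 \<le> f_approx n x"
proof -
  have "(scale * x)\<^sup>2 \<le> 4" if "\<bar>scale * x\<bar> \<le> 2"
    using that abs_le_square_iff[of "scale * x" 2] by simp
  then show ?thesis
    unfolding f_approx_def q_supp_iff using scale_pos q_inf_pos weight_nonneg
    by (auto intro!: mult_nonneg_nonneg divide_nonneg_nonneg less_imp_le[OF q_inf_pos])
qed

lemma f_N_nonneg: "0 \<le> f_N q x"
  by (rule LIMSEQ_le_const[OF f_approx_tendsto]) (use f_approx_nonneg in blast)

lemma weight_continuous [continuous_intros]: "continuous_on A f \<Longrightarrow> continuous_on A (\<lambda>x. weight n (f x))"
  unfolding weight_def by (intro continuous_intros)

lemma weight_measurable [measurable]: "weight n \<in> borel_measurable borel"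
  unfolding weight_def by measurable

lemma q_supp_sets [measurable]: "q_supp q \<in> sets borel"
  by (simp add: q_supp_def)

lemma f_N_measurable [measurable]: "f_N q \<in> borel_measurable borel"
proof (rule borel_measurable_LIMSEQ_real[OF f_approx_tendsto])
  fix n
  show "f_approx n \<in> borel_measurable borel"
    unfolding f_approx_def by measurable
qed

text \<open>On [-pi, 0] the root of 4 - 4 (cos \<theta>)^2 is - 2 sin \<theta>, so the Jacobian
  cancels the singular denominator.\<close>

lemma integral_f_approx_substitution:
  assumes "-pi \<le> \<theta>" "\<theta> \<le> 0"
  shows "f_approx (Suc n) (2 * cos \<theta> / scale) * (- 2 * sin \<theta> / scale) = q_inf / (2 * pi) * weight (Suc n) (2 * cos \<theta>)"
proof -
  have s: "scale * (2 * cos \<theta> / scale) = 2 * cos \<theta>" using scale_pos by simp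
  have supp: "2 * cos \<theta> / scale \<in> q_supp q" unfolding q_supp_iff s by (rule abs_2_cos)
  have sin: "sin \<theta> \<le> 0"
    using sin_ge_zero[of "- \<theta>"] assms by simp
  have "4 - (2 * cos \<theta>)\<^sup>2 = (- 2 * sin \<theta>)\<^sup>2"
    by (simp add: sin_squared_eq)
  then have root: "sqrt (4 - (2 * cos \<theta>)\<^sup>2) = - 2 * sin \<theta>"
    using sin by (simp only: real_sqrt_abs)
  show ?thesis
  proof (cases "sin \<theta> = 0")
    case True
    \<comment> \<open>At the ends of the interval the cancellation is 0/0. The truncation index is a
      successor, so the vanishing factor with k = 0 is present and both sides are 0.\<close>
    then have "(1 + q ^ 0)\<^sup>2 - (2 * cos \<theta>)\<^sup>2 * q ^ 0 = 0"
      using sin_cos_squared_add[of \<theta>] by simp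
    then have "weight (Suc n) (2 * cos \<theta>) = 0"
      unfolding weight_def by (intro prod_zero bexI[of _ 0]) auto
    then show ?thesis using True by simp
  next
    case False
    then show ?thesis
      using supp scale_pos unfolding f_approx_def s root by (simp add: field_simps)
  qed
qed

lemma f_N_substitution_tendsto:
  assumes "-pi \<le> \<theta>" "\<theta> \<le> 0"
  shows "(\<lambda>n. q_inf / (2 * pi) * weight (Suc n) (2 * cos \<theta>)) \<longlonglongrightarrow> f_N q (2 * cos \<theta> / scale) * (- 2 * sin \<theta> / scale)"
  unfolding integral_f_approx_substitution[OF assms, symmetric]
  by (intro tendsto_intros LIMSEQ_Suc f_approx_tendsto)

lemma f_N_substitution_bound: "\<exists>C. \<forall>\<theta>\<in>{-pi..0}. f_N q (2 * cos \<theta> / scale) * (- 2 * sin \<theta> / scale) \<le> C"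
proof -
  obtain C where C: "\<And>n s. \<bar>s\<bar> \<le> 2 \<Longrightarrow> weight n s \<le> C" using weight_bounded by blast
  show ?thesis
  proof (intro exI ballI)
    fix \<theta> assume "\<theta> \<in> {-pi..0}"
    then show "f_N q (2 * cos \<theta> / scale) * (- 2 * sin \<theta> / scale) \<le> q_inf / (2 * pi) * C"
      using q_inf_pos by (intro LIMSEQ_le_const2[OF f_N_substitution_tendsto] exI[of _ 0] allI impI mult_left_mono C abs_2_cos) auto
  qed
qed

lemma scale_deriv: "((\<lambda>\<theta>. 2 * cos \<theta> / scale) has_real_derivative - 2 * sin \<theta> / scale) (at \<theta>)"
proof -
  have "((\<lambda>\<theta>. 2 * cos \<theta>) has_real_derivative - 2 * sin \<theta>) (at \<theta>)"
    by (auto intro!: derivative_eq_intros)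
  then show ?thesis by (rule DERIV_cdivide)
qed

lemma scale_deriv_nonneg: "\<theta> \<in> {-pi..0} \<Longrightarrow> 0 \<le> - 2 * sin \<theta> / scale"
  using sin_ge_zero[of "- \<theta>"] by (intro divide_nonneg_pos scale_pos) auto

lemma f_N_outside: "x \<notin> q_supp q \<Longrightarrow> f_N q x = 0"
  by (simp add: f_N_eq)

lemma q_supp_eq: "q_supp q = {2 * cos (-pi) / scale..2 * cos 0 / scale}"
  using q_neq_1 by (simp add: q_supp_def)

text \<open>The substitution rule for Bochner integrals presupposes integrability, so the
  nonnegative version comes first; it leads to a bounded integrand on a bounded interval.\<close>

lemma f_N_integrable: "integrable lborel (f_N q)"
proof (rule integrableI_nonneg)
  obtain C where C: "\<And>\<theta>. \<theta> \<in> {-pi..0} \<Longrightarrow> f_N q (2 * cos \<theta> / scale) * (- 2 * sin \<theta> / scale) \<le> C"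
    using f_N_substitution_bound by blast
  have "(\<integral>\<^sup>+x. ennreal (f_N q x) \<partial>lborel) = (\<integral>\<^sup>+x. ennreal (f_N q x) * indicator {2 * cos (-pi) / scale..2 * cos 0 / scale} x \<partial>lborel)"
    unfolding q_supp_eq[symmetric] by (intro nn_integral_cong) (auto simp: f_N_outside split: split_indicator)
  also have "\<dots> = (\<integral>\<^sup>+x. ennreal (f_N q x * indicator {2 * cos (-pi) / scale..2 * cos 0 / scale} x) \<partial>lborel)"
    by (intro nn_integral_cong) (auto split: split_indicator)
  also have "\<dots> = (\<integral>\<^sup>+\<theta>. ennreal (f_N q (2 * cos \<theta> / scale) * (- 2 * sin \<theta> / scale) * indicator {-pi..0} \<theta>) \<partial>lborel)"
    by (intro nn_integral_substitution scale_deriv scale_deriv_nonneg continuous_intros)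
       (use scale_pos in \<open>auto simp: set_borel_measurable_def\<close>)
  also have "\<dots> \<le> (\<integral>\<^sup>+\<theta>. ennreal C * indicator {-pi..0} \<theta> \<partial>lborel)"
    using C by (intro nn_integral_mono) (auto split: split_indicator intro!: ennreal_leI)
  also have "\<dots> < \<infinity>"
    by (subst nn_integral_cmult_indicator) (auto simp: ennreal_mult_less_top)
  finally show "(\<integral>\<^sup>+x. ennreal (f_N q x) \<partial>lborel) < \<infinity>" .
qed (auto simp: f_N_nonneg)

lemma integrable_mult_f_N:
  assumes [measurable]: "g \<in> borel_measurable borel" and "\<And>x. x \<in> q_supp q \<Longrightarrow> \<bar>g x\<bar> \<le> C"
  shows "integrable lborel (\<lambda>x. g x * f_N q x)"
proof (rule Bochner_Integration.integrable_bound)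
  show "integrable lborel (\<lambda>x. C * f_N q x)"
    using f_N_integrable by simp
  have "\<bar>g x * f_N q x\<bar> \<le> \<bar>C * f_N q x\<bar>" for x
  proof (cases "x \<in> q_supp q")
    case True
    then show ?thesis
      using assms(2)[OF True] f_N_nonneg[of x] by (simp add: abs_mult mult_right_mono)
  qed (simp add: f_N_outside)
  then show "AE x in lborel. norm (g x * f_N q x) \<le> norm (C * f_N q x)" by simp
qed simp

text \<open>Bridge from the density to the exactly computable integrals over \<theta>: substitution
  on the left, dominated convergence in the truncation index on the right. Continuity of g on
  [-2, 2] supplies its bound.\<close>

lemma integral_mult_f_N_tendsto:
  assumes g: "continuous_on {-2..2} g" and [measurable]: "g \<in> borel_measurable borel"
  shows "(\<lambda>n. q_inf / (2 * pi) * integral {-pi..0} (\<lambda>\<theta>. weight (Suc n) (2 * cos \<theta>) * g (2 * cos \<theta>)))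
    \<longlonglongrightarrow> (\<integral>x. g (scale * x) * f_N q x \<partial>lborel)"
proof -
  have "bounded (g ` {-2..2})"
    by (intro compact_imp_bounded compact_continuous_image g) simp
  then obtain B where B: "\<And>s. \<bar>s\<bar> \<le> 2 \<Longrightarrow> \<bar>g s\<bar> \<le> B"
    unfolding bounded_iff by (fastforce simp: abs_le_iff)
  then have "0 \<le> B" by (metis abs_ge_zero abs_zero order_trans zero_le_numeral)
  obtain C where C: "\<And>n s. \<bar>s\<bar> \<le> 2 \<Longrightarrow> weight n s \<le> C" using weight_bounded by blast
  have gc: "continuous_on {-pi..0} (\<lambda>\<theta>. g (2 * cos \<theta>))"
    by (rule continuous_on_compose2[OF g]) (auto intro!: continuous_intros)
  have int: "integrable lborel (\<lambda>x. g (scale * x) * f_N q x)"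
    by (rule integrable_mult_f_N[where C = B]) (auto simp: q_supp_iff intro!: B)
  have set_int: "set_integrable lborel A (\<lambda>x. g (scale * x) * f_N q x)" if "A \<in> sets lborel" for A
    unfolding set_integrable_def using that by (intro integrable_mult_indicator int)
  let ?s = "\<lambda>n \<theta>. indicator {-pi..0} \<theta> * (q_inf / (2 * pi) * weight (Suc n) (2 * cos \<theta>) * g (2 * cos \<theta>))"
  have "(\<integral>x. g (scale * x) * f_N q x \<partial>lborel)
    = (\<integral>x. (g (scale * x) * f_N q x) * indicator {2 * cos (-pi) / scale..2 * cos 0 / scale} x \<partial>lborel)"
    unfolding q_supp_eq[symmetric]
    by (intro Bochner_Integration.integral_cong) (auto simp: f_N_outside split: split_indicator)
  also have "\<dots> = (\<integral>\<theta>. (g (scale * (2 * cos \<theta> / scale)) * f_N q (2 * cos \<theta> / scale)) * (- 2 * sin \<theta> / scale) * indicator {-pi..0} \<theta> \<partial>lborel)"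
    by (intro integral_substitution(2) scale_deriv scale_deriv_nonneg continuous_intros set_int) (use scale_pos in auto)
  also have "\<dots> = (\<integral>\<theta>. indicator {-pi..0} \<theta> * (f_N q (2 * cos \<theta> / scale) * (- 2 * sin \<theta> / scale) * g (2 * cos \<theta>)) \<partial>lborel)"
    using scale_pos by (intro Bochner_Integration.integral_cong) (auto simp: mult_ac)
  finally have eq: "(\<integral>x. g (scale * x) * f_N q x \<partial>lborel) = \<dots>" .
  have "(\<lambda>n. integral\<^sup>L lborel (?s n)) \<longlonglongrightarrow>
    (\<integral>\<theta>. indicator {-pi..0} \<theta> * (f_N q (2 * cos \<theta> / scale) * (- 2 * sin \<theta> / scale) * g (2 * cos \<theta>)) \<partial>lborel)"
  proof (rule integral_dominated_convergence[where w = "\<lambda>\<theta>. q_inf / (2 * pi) * C * B * indicator {-pi..0} \<theta>"])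
    show "integrable lborel (\<lambda>\<theta>. q_inf / (2 * pi) * C * B * indicator {-pi..0} \<theta>)"
      by (intro integrable_mult_right integrable_real_indicator) auto
    show "AE \<theta> in lborel. (\<lambda>n. ?s n \<theta>) \<longlonglongrightarrow> indicator {-pi..0} \<theta> * (f_N q (2 * cos \<theta> / scale) * (- 2 * sin \<theta> / scale) * g (2 * cos \<theta>))"
    proof (rule AE_I2)
      fix \<theta> :: real
      show "(\<lambda>n. ?s n \<theta>) \<longlonglongrightarrow> indicator {-pi..0} \<theta> * (f_N q (2 * cos \<theta> / scale) * (- 2 * sin \<theta> / scale) * g (2 * cos \<theta>))"
      proof (cases "\<theta> \<in> {-pi..0}")
        case True
        then show ?thesis
          by (intro tendsto_mult tendsto_const f_N_substitution_tendsto) auto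
      qed simp
    qed
    fix n
    have "\<bar>q_inf / (2 * pi) * weight (Suc n) (2 * cos \<theta>) * g (2 * cos \<theta>)\<bar> \<le> q_inf / (2 * pi) * C * B" for \<theta>
    proof -
      have "\<bar>q_inf / (2 * pi) * weight (Suc n) (2 * cos \<theta>)\<bar> = q_inf / (2 * pi) * weight (Suc n) (2 * cos \<theta>)"
        using q_inf_pos weight_nonneg[OF abs_2_cos, of "Suc n" \<theta>] by (intro abs_of_nonneg mult_nonneg_nonneg) auto
      also have "\<dots> \<le> q_inf / (2 * pi) * C"
        using q_inf_pos by (intro mult_left_mono C abs_2_cos) auto
      finally show ?thesis
        unfolding abs_mult[of _ "g _"] using B[OF abs_2_cos, of \<theta>] \<open>0 \<le> B\<close> q_inf_pos C[of 0 0]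
        by (intro mult_mono mult_nonneg_nonneg divide_nonneg_nonneg) (auto simp: weight_def)
    qed
    then show "AE \<theta> in lborel. norm (?s n \<theta>) \<le> q_inf / (2 * pi) * C * B * indicator {-pi..0} \<theta>"
      by (intro AE_I2) (auto split: split_indicator)
  qed (measurable)
  moreover have "integral\<^sup>L lborel (?s n) = q_inf / (2 * pi) * integral {-pi..0} (\<lambda>\<theta>. weight (Suc n) (2 * cos \<theta>) * g (2 * cos \<theta>))" for n
  proof -
    have "set_integrable lborel {-pi..0} (\<lambda>\<theta>. weight (Suc n) (2 * cos \<theta>) * g (2 * cos \<theta>))"
      by (intro borel_integrable_atLeastAtMost' continuous_intros gc)
    from set_borel_integral_eq_integral(2)[OF this]
    have *: "(\<integral>\<theta>. indicator {-pi..0} \<theta> * (weight (Suc n) (2 * cos \<theta>) * g (2 * cos \<theta>)) \<partial>lborel)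
      = integral {-pi..0} (\<lambda>\<theta>. weight (Suc n) (2 * cos \<theta>) * g (2 * cos \<theta>))"
      by (simp add: set_lebesgue_integral_def)
    have "integral\<^sup>L lborel (?s n) = (\<integral>\<theta>. q_inf / (2 * pi) * (indicator {-pi..0} \<theta> * (weight (Suc n) (2 * cos \<theta>) * g (2 * cos \<theta>))) \<partial>lborel)"
      by (simp only: mult_ac)
    then show ?thesis
      unfolding integral_mult_right_zero * .
  qed
  ultimately show ?thesis unfolding eq by simp
qed

text \<open>Even degrees come from the Fourier computation; for odd degrees the density is even and
  the polynomial odd, so the integral equals its own negative.\<close>

lemma integral_rogers_f_N:
  "(\<integral>x. rogers q n (scale * x) * f_N q x \<partial>lborel) = (if n = 0 then 1 else 0)"
proof (cases "even n")
  case True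
  then obtain m where n: "n = 2 * m" by (elim evenE)
  have "(\<lambda>k. q_inf / (2 * pi) * integral {-pi..0} (\<lambda>\<theta>. weight (Suc k) (2 * cos \<theta>) * rogers q n (2 * cos \<theta>)))
    \<longlonglongrightarrow> q_inf / (2 * pi) * (if m = 0 then 2 * pi / q_inf else 0)"
    unfolding n by (intro tendsto_mult tendsto_const weight_rogers_integral_tendsto)
  moreover have "(\<lambda>k. q_inf / (2 * pi) * integral {-pi..0} (\<lambda>\<theta>. weight (Suc k) (2 * cos \<theta>) * rogers q n (2 * cos \<theta>)))
    \<longlonglongrightarrow> (\<integral>x. rogers q n (scale * x) * f_N q x \<partial>lborel)"
    by (intro integral_mult_f_N_tendsto rogers_continuous) simp
  ultimately show ?thesis
    using LIMSEQ_unique q_inf_nz by (fastforce simp: n)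
next
  case False
  let ?I = "\<integral>x. rogers q n (scale * x) * f_N q x \<partial>lborel"
  have "f_N q (- x) = f_N q x" for x
    by (simp add: f_N_eq q_supp_iff)
  then have "?I = (\<integral>x. - (rogers q n (scale * x) * f_N q x) \<partial>lborel)"
    using False by (subst lborel_integral_real_affine[where c = "-1" and t = 0]) (simp_all add: rogers_minus)
  then have "?I = - ?I" by simp
  then show ?thesis using False by (auto elim: oddE)
qed

end

section \<open>Orthogonality and the semigroup laws for |q| < 1\<close>

context q_disc
begin

lemma rogers_bound_supp:
  "\<exists>B>0. \<forall>n. \<forall>x\<in>q_supp q. \<bar>rogers q n (scale * x)\<bar> \<le> B * (real n + 1)"
proof -
  obtain B where "0 < B" "\<And>n s. \<bar>s\<bar> \<le> 2 \<Longrightarrow> \<bar>rogers q n s\<bar> \<le> B * (real n + 1)"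
    using rogers_bound by blast
  then show ?thesis by (intro exI[of _ B]) (simp add: q_supp_iff)
qed

lemma integrable_rogers_rogers:
  "integrable lborel (\<lambda>x. rogers q m (scale * x) * rogers q n (scale * x) * f_N q x)"
proof -
  obtain B where B: "0 < B" "\<And>n x. x \<in> q_supp q \<Longrightarrow> \<bar>rogers q n (scale * x)\<bar> \<le> B * (real n + 1)"
    using rogers_bound_supp by blast
  show ?thesis
  proof (rule integrable_mult_f_N[where C = "(B * (real m + 1)) * (B * (real n + 1))"])
    show "\<bar>rogers q m (scale * x) * rogers q n (scale * x)\<bar> \<le> (B * (real m + 1)) * (B * (real n + 1))"
      if "x \<in> q_supp q" for x
      unfolding abs_mult using B that by (intro mult_mono) auto
  qed measurable
qed

text \<open>A factor s may be absorbed by either polynomial through the recurrence; equating both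
  ways expresses row m + 2 of the Gram matrix by rows m + 1 and m. The initial row is
  \<open>integral_rogers_f_N\<close>.\<close>

lemma integral_rogers_rogers:
  "(\<integral>x. rogers q m (scale * x) * rogers q n (scale * x) * f_N q x \<partial>lborel) = (if m = n then q_poch q n else 0)"
proof -
  define I where "I = (\<lambda>m n. \<integral>x. rogers q m (scale * x) * rogers q n (scale * x) * f_N q x \<partial>lborel)"
  have I0: "I 0 n = (if n = 0 then 1 else 0)" for n
    unfolding I_def using integral_rogers_f_N[of n] by simp
  have Is: "(\<integral>x. (scale * x) * rogers q m (scale * x) * rogers q n (scale * x) * f_N q x \<partial>lborel)
    = I m (Suc n) + (1 - q ^ n) * I m (n - 1)" for m n
  proof -
    have "(\<lambda>x. (scale * x) * rogers q m (scale * x) * rogers q n (scale * x) * f_N q x)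
      = (\<lambda>x. rogers q m (scale * x) * (scale * x * rogers q n (scale * x)) * f_N q x)"
      by (simp add: mult_ac)
    also have "\<dots> = (\<lambda>x. rogers q m (scale * x) * rogers q (Suc n) (scale * x) * f_N q x
      + (1 - q ^ n) * (rogers q m (scale * x) * rogers q (n - 1) (scale * x) * f_N q x))"
      unfolding rogers_rec by (simp add: ring_distribs mult_ac)
    finally show ?thesis
      unfolding I_def
      by (simp only: Bochner_Integration.integral_add integrable_mult_right integrable_rogers_rogers integral_mult_right_zero)
  qed
  have "I m n = (if m = n then q_poch q n else 0)" for n
  proof (induction m arbitrary: n rule: induct_nat_012)
    case 0
    then show ?case by (simp add: I0)
  next
    case 1
    have "I (Suc 0) n = I 0 (Suc n) + (1 - q ^ n) * I 0 (n - 1)"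
      using Is[of 0 n] by (simp add: I_def)
    then show ?case by (cases n) (auto simp: I0 q_poch_Suc)
  next
    case (ge2 m)
    have "I (Suc (Suc m)) n = (\<integral>x. (scale * x) * rogers q (Suc m) (scale * x) * rogers q n (scale * x) * f_N q x
       - (1 - q ^ Suc m) * (rogers q m (scale * x) * rogers q n (scale * x) * f_N q x) \<partial>lborel)"
      unfolding I_def by (simp add: algebra_simps)
    also have "\<dots> = I (Suc m) (Suc n) + (1 - q ^ n) * I (Suc m) (n - 1) - (1 - q ^ Suc m) * I m n"
    proof -
      have "integrable lborel (\<lambda>x. (scale * x) * rogers q (Suc m) (scale * x) * rogers q n (scale * x) * f_N q x)"
      proof -
        have "(\<lambda>x. (scale * x) * rogers q (Suc m) (scale * x) * rogers q n (scale * x) * f_N q x)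
          = (\<lambda>x. rogers q (Suc (Suc m)) (scale * x) * rogers q n (scale * x) * f_N q x
             + (1 - q ^ Suc m) * (rogers q m (scale * x) * rogers q n (scale * x) * f_N q x))"
          by (simp add: algebra_simps)
        then show ?thesis
          by (simp only: Bochner_Integration.integrable_add integrable_mult_right integrable_rogers_rogers)
      qed
      then show ?thesis
        by (subst Bochner_Integration.integral_diff)
          (simp_all only: Is integrable_mult_right integrable_rogers_rogers integral_mult_right_zero, simp only: I_def)
    qed
    also have "\<dots> = (if Suc (Suc m) = n then q_poch q n else 0)"
      unfolding ge2 by (cases n) (auto simp: q_poch_Suc)
    finally show ?case .
  qed
  then show ?thesis by (simp add: I_def)
qed

section \<open>Series in q-Hermite polynomials and Parseval's identity\<close>

definition rogers_series :: "(nat \<Rightarrow> real) \<Rightarrow> real \<Rightarrow> real" where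
  "rogers_series a s = (\<Sum>n. a n * rogers q n s)"

text \<open>The weight n + 1 is the growth rate in \<open>rogers_bound\<close>, so this means
  absolute convergence with a bound uniform on [-2, 2].\<close>

definition rogers_summable :: "(nat \<Rightarrow> real) \<Rightarrow> bool" where
  "rogers_summable a \<longleftrightarrow> summable (\<lambda>n. \<bar>a n\<bar> * (real n + 1))"

lemma rogers_series_measurable [measurable]: "rogers_series a \<in> borel_measurable borel"
  unfolding rogers_series_def by measurable

lemma rogers_summable_norm:
  assumes "rogers_summable a" "\<bar>s\<bar> \<le> 2"
  shows "summable (\<lambda>n. norm (a n * rogers q n s))"
proof -
  obtain B where B: "0 < B" "\<And>n s. \<bar>s\<bar> \<le> 2 \<Longrightarrow> \<bar>rogers q n s\<bar> \<le> B * (real n + 1)"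
    using rogers_bound by blast
  have "summable (\<lambda>n. B * (\<bar>a n\<bar> * (real n + 1)))"
    using assms(1) unfolding rogers_summable_def by (rule summable_mult)
  then show ?thesis
  proof (rule summable_comparison_test'[where N = 0])
    fix n
    show "norm (norm (a n * rogers q n s)) \<le> B * (\<bar>a n\<bar> * (real n + 1))"
      using mult_left_mono[OF B(2)[OF assms(2)], of "\<bar>a n\<bar>" n] by (simp add: abs_mult mult_ac)
  qed
qed

lemma rogers_series_bound:
  assumes "rogers_summable a"
  shows "\<exists>C. \<forall>s. \<bar>s\<bar> \<le> 2 \<longrightarrow> \<bar>rogers_series a s\<bar> \<le> C"
proof -
  obtain B where B: "0 < B" "\<And>n s. \<bar>s\<bar> \<le> 2 \<Longrightarrow> \<bar>rogers q n s\<bar> \<le> B * (real n + 1)"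
    using rogers_bound by blast
  have sm: "summable (\<lambda>n. B * (\<bar>a n\<bar> * (real n + 1)))"
    using assms(1) unfolding rogers_summable_def by (rule summable_mult)
  show ?thesis
  proof (intro exI allI impI)
    fix s :: real assume s: "\<bar>s\<bar> \<le> 2"
    have "norm (rogers_series a s) \<le> (\<Sum>n. norm (a n * rogers q n s))"
      unfolding rogers_series_def by (intro summable_norm rogers_summable_norm assms s)
    also have "\<dots> \<le> (\<Sum>n. B * (\<bar>a n\<bar> * (real n + 1)))"
    proof (intro suminf_le rogers_summable_norm assms s sm)
      show "norm (a n * rogers q n s) \<le> B * (\<bar>a n\<bar> * (real n + 1))" for n
        using mult_left_mono[OF B(2)[OF s], of "\<bar>a n\<bar>" n] by (simp add: abs_mult mult_ac)
    qed
    finally show "\<bar>rogers_series a s\<bar> \<le> (\<Sum>n. B * (\<bar>a n\<bar> * (real n + 1)))" by simp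
  qed
qed

text \<open>The bounded function g is left general because Parseval uses it twice, once with a
  single polynomial and once with a whole series.\<close>

lemma sums_integral_rogers_series:
  assumes a: "rogers_summable a"
    and [measurable]: "g \<in> borel_measurable borel" and g: "\<And>x. x \<in> q_supp q \<Longrightarrow> \<bar>g x\<bar> \<le> C"
  shows "(\<lambda>n. a n * (\<integral>x. g x * rogers q n (scale * x) * f_N q x \<partial>lborel)) sums
    (\<integral>x. g x * rogers_series a (scale * x) * f_N q x \<partial>lborel)"
proof -
  obtain B where B: "0 < B" "\<And>n x. x \<in> q_supp q \<Longrightarrow> \<bar>rogers q n (scale * x)\<bar> \<le> B * (real n + 1)"
    using rogers_bound_supp by blast
  have "0 \<in> q_supp q" by (simp add: q_supp_iff)
  then have C: "0 \<le> C" using g[of 0] by (auto intro: order_trans[OF abs_ge_zero])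
  let ?f = "\<lambda>n x. a n * (g x * rogers q n (scale * x) * f_N q x)"
  have bd: "norm (?f n x) \<le> C * B * (\<bar>a n\<bar> * (real n + 1)) * f_N q x" for n x
  proof (cases "x \<in> q_supp q")
    case True
    have "\<bar>a n\<bar> * ((\<bar>g x\<bar> * \<bar>rogers q n (scale * x)\<bar>) * f_N q x) \<le> \<bar>a n\<bar> * ((C * (B * (real n + 1))) * f_N q x)"
      using C f_N_nonneg B g True by (intro mult_left_mono mult_right_mono mult_mono) auto
    then show ?thesis
      using f_N_nonneg[of x] by (simp add: abs_mult mult_ac)
  qed (simp add: f_N_outside)
  have int: "integrable lborel (?f n)" for n
  proof (rule Bochner_Integration.integrable_bound)
    show "integrable lborel (\<lambda>x. C * B * (\<bar>a n\<bar> * (real n + 1)) * f_N q x)"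
      using f_N_integrable by simp
    show "AE x in lborel. norm (?f n x) \<le> norm (C * B * (\<bar>a n\<bar> * (real n + 1)) * f_N q x)"
      by (intro AE_I2 order_trans[OF bd]) simp
  qed measurable
  have "(\<lambda>n. integral\<^sup>L lborel (?f n)) sums (\<integral>x. (\<Sum>n. ?f n x) \<partial>lborel)"
  proof (rule sums_integral[OF int])
    have sm: "summable (\<lambda>n. C * B * (\<bar>a n\<bar> * (real n + 1)))"
      using a unfolding rogers_summable_def by (rule summable_mult)
    show "AE x in lborel. summable (\<lambda>n. norm (?f n x))"
      using bd by (intro AE_I2 summable_comparison_test'[OF summable_mult2[OF sm, of "f_N q _"], where N = 0]) simp
    show "summable (\<lambda>n. \<integral>x. norm (?f n x) \<partial>lborel)"
    proof (rule summable_comparison_test'[OF summable_mult2[OF sm, of "integral\<^sup>L lborel (f_N q)"], where N = 0])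
      fix n
      have "(\<integral>x. norm (?f n x) \<partial>lborel) \<le> (\<integral>x. C * B * (\<bar>a n\<bar> * (real n + 1)) * f_N q x \<partial>lborel)"
        using f_N_integrable bd by (intro integral_mono integrable_norm int) auto
      then show "norm (\<integral>x. norm (?f n x) \<partial>lborel) \<le> C * B * (\<bar>a n\<bar> * (real n + 1)) * integral\<^sup>L lborel (f_N q)"
        by (simp add: Bochner_Integration.integral_nonneg)
    qed
  qed
  moreover have "(\<Sum>n. ?f n x) = g x * rogers_series a (scale * x) * f_N q x" for x
  proof (cases "x \<in> q_supp q")
    case True
    then have "summable (\<lambda>n. a n * rogers q n (scale * x))"
      by (intro summable_norm_cancel[OF rogers_summable_norm] a) (simp add: q_supp_iff)
    then have "(\<Sum>n. (g x * f_N q x) * (a n * rogers q n (scale * x))) = (g x * f_N q x) * rogers_series a (scale * x)"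
      unfolding rogers_series_def by (rule suminf_mult)
    then show ?thesis by (simp only: mult_ac)
  qed (simp add: f_N_outside)
  ultimately show ?thesis by simp
qed

text \<open>Integrating the first series against the m-th polynomial leaves a_m (q;q)_m by
  orthogonality; the second series is then integrated term by term with the bounded first series as
  test function.\<close>

lemma rogers_parseval:
  assumes a: "rogers_summable a" and b: "rogers_summable b"
  shows "(\<lambda>n. a n * b n * q_poch q n) sums
    (\<integral>x. rogers_series a (scale * x) * rogers_series b (scale * x) * f_N q x \<partial>lborel)"
proof -
  obtain B where B: "0 < B" "\<And>n x. x \<in> q_supp q \<Longrightarrow> \<bar>rogers q n (scale * x)\<bar> \<le> B * (real n + 1)"
    using rogers_bound_supp by blast
  obtain A where A: "\<And>s. \<bar>s\<bar> \<le> 2 \<Longrightarrow> \<bar>rogers_series a s\<bar> \<le> A"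
    using rogers_series_bound[OF a] by blast
  have "(\<integral>x. rogers q m (scale * x) * rogers_series a (scale * x) * f_N q x \<partial>lborel) = a m * q_poch q m" for m
  proof -
    have "(\<lambda>n. a n * (if m = n then q_poch q n else 0)) sums
      (\<integral>x. rogers q m (scale * x) * rogers_series a (scale * x) * f_N q x \<partial>lborel)"
      using sums_integral_rogers_series[OF a, of "\<lambda>x. rogers q m (scale * x)" "B * (real m + 1)"] B(2)
      by (simp add: integral_rogers_rogers)
    moreover have "(\<lambda>n. a n * (if m = n then q_poch q n else 0)) sums (a m * q_poch q m)"
      using sums_single[of m "\<lambda>n. a n * q_poch q n"] by (simp add: if_distrib eq_commute cong: if_cong)
    ultimately show ?thesis by (rule sums_unique2)
  qed
  then have "(\<integral>x. rogers_series a (scale * x) * rogers q m (scale * x) * f_N q x \<partial>lborel) = a m * q_poch q m" for m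
    by (simp add: mult.commute[of "rogers_series a _"])
  moreover have "(\<lambda>n. b n * (\<integral>x. rogers_series a (scale * x) * rogers q n (scale * x) * f_N q x \<partial>lborel)) sums
    (\<integral>x. rogers_series a (scale * x) * rogers_series b (scale * x) * f_N q x \<partial>lborel)"
    using A by (intro sums_integral_rogers_series[OF b, where C = A]) (auto simp: q_supp_iff)
  ultimately show ?thesis by (simp add: mult_ac)
qed

text \<open>\<open>f_N\<close> stays with the first series, as in a density followed by a function
  of its argument. It vanishes off the support, where the series may have any sign.\<close>

lemma nn_integral_rogers_series:
  assumes a: "rogers_summable a" and b: "rogers_summable b"
    and nonneg: "\<And>x. x \<in> q_supp q \<Longrightarrow> 0 \<le> rogers_series a (scale * x)" "\<And>x. x \<in> q_supp q \<Longrightarrow> 0 \<le> rogers_series b (scale * x)"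
  shows "(\<integral>\<^sup>+x. ennreal (rogers_series a (scale * x) * f_N q x) * ennreal (rogers_series b (scale * x)) \<partial>lborel)
    = ennreal (\<Sum>n. a n * b n * q_poch q n)"
proof -
  obtain A where A: "\<And>s. \<bar>s\<bar> \<le> 2 \<Longrightarrow> \<bar>rogers_series a s\<bar> \<le> A"
    using rogers_series_bound[OF a] by blast
  obtain B where B: "\<And>s. \<bar>s\<bar> \<le> 2 \<Longrightarrow> \<bar>rogers_series b s\<bar> \<le> B"
    using rogers_series_bound[OF b] by blast
  let ?g = "\<lambda>x. rogers_series a (scale * x) * rogers_series b (scale * x)"
  have int: "integrable lborel (\<lambda>x. ?g x * f_N q x)"
  proof (rule integrable_mult_f_N)
    show "\<bar>?g x\<bar> \<le> A * B" if "x \<in> q_supp q" for x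
      using that A[of "scale * x"] B[of "scale * x"] unfolding abs_mult q_supp_iff by (intro mult_mono) auto
  qed measurable
  have "(\<integral>\<^sup>+x. ennreal (rogers_series a (scale * x) * f_N q x) * ennreal (rogers_series b (scale * x)) \<partial>lborel)
    = (\<integral>\<^sup>+x. ennreal (?g x * f_N q x) \<partial>lborel)"
  proof (intro nn_integral_cong)
    fix x
    show "ennreal (rogers_series a (scale * x) * f_N q x) * ennreal (rogers_series b (scale * x)) = ennreal (?g x * f_N q x)"
    proof (cases "x \<in> q_supp q")
      case True
      then show ?thesis using nonneg f_N_nonneg[of x] by (simp add: ennreal_mult'[symmetric] mult_ac)
    qed (simp add: f_N_outside)
  qed
  also have "\<dots> = ennreal (\<integral>x. ?g x * f_N q x \<partial>lborel)"
  proof (rule nn_integral_eq_integral[OF int], rule AE_I2)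
    show "0 \<le> ?g x * f_N q x" for x
      using nonneg f_N_nonneg[of x] by (cases "x \<in> q_supp q") (auto simp: f_N_outside)
  qed
  also have "(\<integral>x. ?g x * f_N q x \<partial>lborel) = (\<Sum>n. a n * b n * q_poch q n)"
    using rogers_parseval[OF a b] by (rule sums_unique)
  finally show ?thesis .
qed

section \<open>Semigroup laws as instances of Parseval\<close>

definition mehler_coeff :: "real \<Rightarrow> real \<Rightarrow> nat \<Rightarrow> real" where
  "mehler_coeff r s n = rogers q n s / q_poch q n * r ^ n"

definition genf_coeff :: "real \<Rightarrow> nat \<Rightarrow> real" where
  "genf_coeff t n = t ^ n / q_poch q n"

lemma rogers_summable_mehler: "\<bar>r\<bar> < 1 \<Longrightarrow> \<bar>s\<bar> \<le> 2 \<Longrightarrow> rogers_summable (mehler_coeff r s)"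
  unfolding rogers_summable_def mehler_coeff_def by (rule summable_rogers_coeff)

lemma rogers_summable_genf: "\<bar>t\<bar> < 1 \<Longrightarrow> rogers_summable (genf_coeff t)"
proof -
  assume t: "\<bar>t\<bar> < 1"
  obtain C where C: "0 < C" "\<And>n. 1 / q_poch q n \<le> C"
    using inverse_q_poch_bound by blast
  have "summable (\<lambda>n. C * ((real n + 1)\<^sup>2 * \<bar>t\<bar> ^ n))"
    by (intro summable_mult summable_quadratic_geometric t)
  then show ?thesis
    unfolding rogers_summable_def
  proof (rule summable_comparison_test'[where N = 0])
    fix n
    have "(1 / q_poch q n) * ((real n + 1) * \<bar>t\<bar> ^ n) \<le> C * ((real n + 1)\<^sup>2 * \<bar>t\<bar> ^ n)"
      using C by (intro mult_mono mult_right_mono) (auto simp: power2_eq_square)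
    then show "norm (\<bar>genf_coeff t n\<bar> * (real n + 1)) \<le> C * ((real n + 1)\<^sup>2 * \<bar>t\<bar> ^ n)"
      using q_poch_pos[of n] by (simp add: genf_coeff_def abs_mult power_abs mult_ac)
  qed
qed

lemma mehler_eq_series: "mehler r s s' = rogers_series (mehler_coeff r s) s'"
  unfolding mehler_def rogers_series_def mehler_coeff_def by (simp add: mult_ac)

lemma mehler_sym: "mehler r s s' = mehler r s' s"
  unfolding mehler_def by (simp add: mult_ac)

lemma mehler_eq_series': "mehler r s s' = rogers_series (mehler_coeff r s') s"
  by (subst mehler_sym) (rule mehler_eq_series)

lemma genf_eq_series: "genf t s = rogers_series (genf_coeff t) s"
  unfolding genf_def rogers_series_def genf_coeff_def by (simp add: mult_ac)

text \<open>The k-th denominator of \<open>f_CN\<close> is \<open>mehler_denom\<close> at q^k \<rho>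
  in the rescaled variables. For x off the support \<open>f_N\<close> makes both sides 0.\<close>

lemma f_CN_eq_mehler:
  assumes "\<bar>\<rho>\<bar> < 1" "y \<in> q_supp q"
  shows "f_CN q \<rho> y x = f_N q x * mehler \<rho> (scale * x) (scale * y)"
proof (cases "x \<in> q_supp q")
  case True
  have eq: "(1 - \<rho>\<^sup>2 * q ^ (2 * k))\<^sup>2 - (1 - q) * \<rho> * q ^ k * (1 + \<rho>\<^sup>2 * q ^ (2 * k)) * x * y + (1 - q) * \<rho>\<^sup>2 * (x\<^sup>2 + y\<^sup>2) * q ^ (2 * k)
     = mehler_denom (q ^ k * \<rho>) (scale * x) (scale * y)" for k
  proof -
    have "(1 - \<rho>\<^sup>2 * X\<^sup>2)\<^sup>2 - c\<^sup>2 * \<rho> * X * (1 + \<rho>\<^sup>2 * X\<^sup>2) * x * y + c\<^sup>2 * \<rho>\<^sup>2 * (x\<^sup>2 + y\<^sup>2) * X\<^sup>2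
      = mehler_denom (X * \<rho>) (c * x) (c * y)" for X c
      by (simp add: mehler_denom_def power2_eq_square algebra_simps)
    note gen = this[of "q ^ k" scale]
    have "(q ^ k)\<^sup>2 = q ^ (2 * k)" by (metis power_mult mult.commute)
    moreover have "scale\<^sup>2 = 1 - q" using q_less_1 by simp
    ultimately show ?thesis using gen by (simp only:)
  qed
  have "(\<lambda>k. (1 - \<rho>\<^sup>2 * q ^ k) / ((1 - \<rho>\<^sup>2 * q ^ (2 * k))\<^sup>2 - (1 - q) * \<rho> * q ^ k * (1 + \<rho>\<^sup>2 * q ^ (2 * k)) * x * y
      + (1 - q) * \<rho>\<^sup>2 * (x\<^sup>2 + y\<^sup>2) * q ^ (2 * k))) has_prod mehler \<rho> (scale * x) (scale * y)"
    using mehler_has_prod(2)[OF assms(1), of "scale * x" "scale * y"] True assms(2) unfolding eq by (simp add: q_supp_iff)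
  from has_prod_unique[OF this] show ?thesis
    using q_neq_1 by (simp add: f_CN_def)
qed (use q_neq_1 in \<open>simp add: f_CN_def f_N_outside\<close>)

lemma MN_density_eq: "MN_density q t x = genf (scale * t) (scale * x) * f_N q x"
proof -
  have "t ^ n / q_fact q n * q_Hermite q n x = rogers q n (scale * x) / q_poch q n * (scale * t) ^ n" for n
  proof -
    have poch: "q_poch q n = scale ^ n * scale ^ n * q_fact q n"
      using q_fact_eq[OF q_less_1, of n] q_less_1 by (simp flip: power_mult_distrib)
    have nz: "scale ^ n \<noteq> 0" using scale_pos by simp
    have frac: "T / F * H = Q * H / (Q * Q * F) * (Q * T)" if "Q \<noteq> 0" for F H Q T :: real
      using that by simp
    show ?thesis
      unfolding q_Hermite_eq[OF q_less_1, symmetric] power_mult_distrib poch by (rule frac[OF nz])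
  qed
  then show ?thesis
    by (simp add: MN_density_def q_Hermite_gf_def genf_def)
qed

lemma abs_scale_less: "(1 - q) * t\<^sup>2 < 1 \<Longrightarrow> \<bar>scale * t\<bar> < 1"
  by (simp add: scale_sq flip: abs_square_less_1)

lemma MN_density_nonneg:
  assumes t: "(1 - q) * t\<^sup>2 < 1"
  shows "0 \<le> MN_density q t x"
  using genf_pos[OF abs_scale_less[OF t], of "scale * x"] f_N_nonneg[of x]
  by (cases "x \<in> q_supp q") (auto simp: MN_density_eq f_N_outside q_supp_iff)

lemma f_CN_nonneg: "\<bar>\<rho>\<bar> < 1 \<Longrightarrow> y \<in> q_supp q \<Longrightarrow> 0 \<le> f_CN q \<rho> y x"
  using mehler_has_prod(1)[of \<rho> "scale * x" "scale * y"] f_N_nonneg[of x]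
  by (cases "x \<in> q_supp q") (auto simp: f_CN_eq_mehler f_N_outside q_supp_iff intro!: mult_nonneg_nonneg less_imp_le)

lemma nn_integral_f_CN:
  assumes \<rho>: "\<bar>\<rho>\<bar> < 1" and y: "y \<in> q_supp q"
  shows "(\<integral>\<^sup>+x. ennreal (f_CN q \<rho> y x) \<partial>lborel) = 1"
proof -
  \<comment> \<open>The total mass is Parseval's sum against the constant 1, written as a series
    with a single coefficient.\<close>
  let ?a = "mehler_coeff \<rho> (scale * y)" and ?b = "\<lambda>n::nat. if n = 0 then 1 else 0 :: real"
  have b: "rogers_summable ?b"
    unfolding rogers_summable_def by (rule summable_finite[of "{0}"]) auto
  have one: "rogers_series ?b s = 1" for s
    unfolding rogers_series_def by (subst suminf_finite[of "{0}"]) auto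
  have "(\<integral>\<^sup>+x. ennreal (f_CN q \<rho> y x) \<partial>lborel)
    = (\<integral>\<^sup>+x. ennreal (rogers_series ?a (scale * x) * f_N q x) * ennreal (rogers_series ?b (scale * x)) \<partial>lborel)"
    by (simp add: one f_CN_eq_mehler[OF \<rho> y] mehler_eq_series'[of _ _ "scale * y"] mult.commute[of "f_N q _"])
  also have "\<dots> = ennreal (\<Sum>n. ?a n * ?b n * q_poch q n)"
    using y mehler_has_prod(1)[OF \<rho>, of "scale * y"]
    by (intro nn_integral_rogers_series rogers_summable_mehler \<rho> b)
       (auto simp: one q_supp_iff mehler_eq_series[symmetric] intro: less_imp_le)
  also have "(\<Sum>n. ?a n * ?b n * q_poch q n) = 1"
    by (subst suminf_finite[of "{0}"]) (auto simp: mehler_coeff_def)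
  finally show ?thesis by simp
qed

text \<open>In Parseval's sum one (q;q)_n cancels and \<rho>^n \<sigma>^n = (\<rho> \<sigma>)^n, so
  the Mehler series at \<rho> \<sigma> reappears. The map r stands for any change of the
  conditioning point off the support, where the first density is 0.\<close>

lemma nn_integral_f_CN_f_CN:
  assumes \<rho>: "\<bar>\<rho>\<bar> < 1" and \<sigma>: "\<bar>\<sigma>\<bar> < 1" and x: "x \<in> q_supp q"
    and r: "\<And>y. y \<in> q_supp q \<Longrightarrow> r y = y"
  shows "(\<integral>\<^sup>+y. ennreal (f_CN q \<rho> x y) * ennreal (f_CN q \<sigma> (r y) z) \<partial>lborel) = ennreal (f_CN q (\<rho> * \<sigma>) x z)"
proof (cases "z \<in> q_supp q")
  case z: True
  let ?a = "mehler_coeff \<rho> (scale * x)" and ?b = "mehler_coeff \<sigma> (scale * z)"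
  have "(\<integral>\<^sup>+y. ennreal (f_CN q \<rho> x y) * ennreal (f_CN q \<sigma> (r y) z) \<partial>lborel)
    = (\<integral>\<^sup>+y. ennreal (f_N q z) * (ennreal (rogers_series ?a (scale * y) * f_N q y) * ennreal (rogers_series ?b (scale * y))) \<partial>lborel)"
  proof (intro nn_integral_cong)
    fix y
    show "ennreal (f_CN q \<rho> x y) * ennreal (f_CN q \<sigma> (r y) z)
      = ennreal (f_N q z) * (ennreal (rogers_series ?a (scale * y) * f_N q y) * ennreal (rogers_series ?b (scale * y)))"
    proof (cases "y \<in> q_supp q")
      case y: True
      have "f_CN q \<rho> x y = rogers_series ?a (scale * y) * f_N q y"
        by (simp add: f_CN_eq_mehler[OF \<rho> x] mehler_eq_series'[of _ _ "scale * x"])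
      moreover have "ennreal (f_CN q \<sigma> (r y) z) = ennreal (f_N q z) * ennreal (rogers_series ?b (scale * y))"
        using y r by (simp add: f_CN_eq_mehler[OF \<sigma> y] mehler_eq_series ennreal_mult' f_N_nonneg)
      ultimately show ?thesis by (simp only: mult_ac)
    qed (simp add: f_CN_eq_mehler[OF \<rho> x] f_N_outside)
  qed
  also have "\<dots> = ennreal (f_N q z) * (\<integral>\<^sup>+y. ennreal (rogers_series ?a (scale * y) * f_N q y) * ennreal (rogers_series ?b (scale * y)) \<partial>lborel)"
    by (intro nn_integral_cmult) measurable
  also have "\<dots> = ennreal (f_N q z) * ennreal (\<Sum>n. ?a n * ?b n * q_poch q n)"
    using x z mehler_has_prod(1)[OF \<rho>, of "scale * x"] mehler_has_prod(1)[OF \<sigma>, of "scale * z"]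
    by (subst nn_integral_rogers_series)
       (auto simp: q_supp_iff mehler_eq_series[symmetric] intro: less_imp_le intro!: rogers_summable_mehler \<rho> \<sigma>)
  also have "(\<Sum>n. ?a n * ?b n * q_poch q n) = mehler (\<rho> * \<sigma>) (scale * z) (scale * x)"
    unfolding mehler_def mehler_coeff_def by (simp add: power_mult_distrib mult_ac)
  also have "ennreal (f_N q z) * \<dots> = ennreal (f_CN q (\<rho> * \<sigma>) x z)"
    using abs_mult_less[OF \<rho> \<sigma>] x by (simp add: f_CN_eq_mehler abs_mult ennreal_mult' f_N_nonneg)
  finally show ?thesis .
next
  case False
  then show ?thesis using q_neq_1 by (simp add: f_CN_def f_N_outside)
qed

lemma nn_integral_MN_f_CN:
  assumes t: "(1 - q) * t\<^sup>2 < 1" and \<sigma>: "\<bar>\<sigma>\<bar> < 1"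
    and r: "\<And>y. y \<in> q_supp q \<Longrightarrow> r y = y"
  shows "(\<integral>\<^sup>+y. ennreal (MN_density q t y) * ennreal (f_CN q \<sigma> (r y) z) \<partial>lborel) = ennreal (MN_density q (t * \<sigma>) z)"
proof (cases "z \<in> q_supp q")
  case z: True
  note t' = abs_scale_less[OF t]
  let ?a = "genf_coeff (scale * t)" and ?b = "mehler_coeff \<sigma> (scale * z)"
  have "(\<integral>\<^sup>+y. ennreal (MN_density q t y) * ennreal (f_CN q \<sigma> (r y) z) \<partial>lborel)
    = (\<integral>\<^sup>+y. ennreal (f_N q z) * (ennreal (rogers_series ?a (scale * y) * f_N q y) * ennreal (rogers_series ?b (scale * y))) \<partial>lborel)"
  proof (intro nn_integral_cong)
    fix y
    show "ennreal (MN_density q t y) * ennreal (f_CN q \<sigma> (r y) z)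
      = ennreal (f_N q z) * (ennreal (rogers_series ?a (scale * y) * f_N q y) * ennreal (rogers_series ?b (scale * y)))"
    proof (cases "y \<in> q_supp q")
      case y: True
      have "ennreal (f_CN q \<sigma> (r y) z) = ennreal (f_N q z) * ennreal (rogers_series ?b (scale * y))"
        using y r by (simp add: f_CN_eq_mehler[OF \<sigma> y] mehler_eq_series ennreal_mult' f_N_nonneg)
      then show ?thesis by (simp only: MN_density_eq genf_eq_series mult_ac)
    qed (simp add: MN_density_eq f_N_outside)
  qed
  also have "\<dots> = ennreal (f_N q z) * (\<integral>\<^sup>+y. ennreal (rogers_series ?a (scale * y) * f_N q y) * ennreal (rogers_series ?b (scale * y)) \<partial>lborel)"
    by (intro nn_integral_cmult) measurable
  also have "\<dots> = ennreal (f_N q z) * ennreal (\<Sum>n. ?a n * ?b n * q_poch q n)"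
    using z genf_pos[OF t'] mehler_has_prod(1)[OF \<sigma>, of "scale * z"]
    by (subst nn_integral_rogers_series)
       (auto simp: q_supp_iff mehler_eq_series[symmetric] genf_eq_series[symmetric] intro: less_imp_le intro!: rogers_summable_mehler rogers_summable_genf \<sigma> t')
  also have "(\<Sum>n. ?a n * ?b n * q_poch q n) = genf (scale * (t * \<sigma>)) (scale * z)"
    unfolding genf_def genf_coeff_def mehler_coeff_def by (simp add: power_mult_distrib mult_ac)
  also have "ennreal (f_N q z) * \<dots> = ennreal (MN_density q (t * \<sigma>) z)"
    by (simp add: MN_density_eq ennreal_mult' f_N_nonneg mult.commute)
  finally show ?thesis .
next
  case False
  then show ?thesis using q_neq_1 by (simp add: f_CN_def f_N_outside MN_density_eq)
qed

text \<open>Because r maps into the support, the Mehler series represents the kernel at every point,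
  and a pointwise sum of measurable terms is measurable.\<close>

lemma f_CN_measurable:
  assumes \<rho>: "\<bar>\<rho>\<bar> < 1" and [measurable]: "r \<in> borel_measurable borel" and r: "\<And>y. r y \<in> q_supp q"
  shows "(\<lambda>(y, x). f_CN q \<rho> (r y) x) \<in> borel_measurable (borel \<Otimes>\<^sub>M borel)"
  unfolding f_CN_eq_mehler[OF \<rho> r] mehler_def by measurable

lemma MN_density_measurable: "MN_density q t \<in> borel_measurable borel"
proof -
  have "(\<lambda>x. MN_density q t x) \<in> borel_measurable borel"
    unfolding MN_density_eq genf_eq_series by measurable
  then show ?thesis by simp
qed

end

section \<open>Marginals of chains of densities\<close>

text \<open>Common frame for q = 1 and |q| < 1: \<open>K\<close> is a Markov kernel multiplicative
  in its parameter, and \<open>g\<close> is a family of initial densities that \<open>K\<close> maps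
  into itself. All laws are demanded at every real point.\<close>

locale density_semigroup =
  fixes T R :: "real set" and g :: "real \<Rightarrow> real \<Rightarrow> ennreal" and K :: "real \<Rightarrow> real \<Rightarrow> real \<Rightarrow> ennreal"
  assumes R_mult: "\<rho> \<in> R \<Longrightarrow> \<sigma> \<in> R \<Longrightarrow> \<rho> * \<sigma> \<in> R"
    and T_mult: "t \<in> T \<Longrightarrow> \<rho> \<in> R \<Longrightarrow> t * \<rho> \<in> T"
    and g_measurable: "t \<in> T \<Longrightarrow> g t \<in> borel_measurable borel"
    and K_measurable: "\<rho> \<in> R \<Longrightarrow> (\<lambda>(y, x). K \<rho> y x) \<in> borel_measurable (borel \<Otimes>\<^sub>M borel)"
    and g_step: "t \<in> T \<Longrightarrow> \<rho> \<in> R \<Longrightarrow> (\<integral>\<^sup>+y. g t y * K \<rho> y z \<partial>lborel) = g (t * \<rho>) z"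
    and K_step: "\<rho> \<in> R \<Longrightarrow> \<sigma> \<in> R \<Longrightarrow> (\<integral>\<^sup>+y. K \<rho> x y * K \<sigma> y z \<partial>lborel) = K (\<rho> * \<sigma>) x z"
    and K_total: "\<rho> \<in> R \<Longrightarrow> (\<integral>\<^sup>+x. K \<rho> y x \<partial>lborel) = 1"
begin

abbreviation Leb :: "nat \<Rightarrow> (nat \<Rightarrow> real) measure" where
  "Leb n \<equiv> \<Pi>\<^sub>M i\<in>{1..n}. lborel"

text \<open>The initial density counts as the link into the first coordinate. Eliminating a leading
  coordinate then changes t just as eliminating a later one changes a correlation.\<close>

definition link :: "nat \<Rightarrow> (nat \<Rightarrow> real) \<Rightarrow> real \<Rightarrow> (nat \<Rightarrow> real) \<Rightarrow> real \<Rightarrow> ennreal" where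
  "link n \<rho> t x w = (if n = 0 then g t w else K (\<rho> n) (x n) w)"

definition chain :: "nat \<Rightarrow> (nat \<Rightarrow> real) \<Rightarrow> real \<Rightarrow> (nat \<Rightarrow> real) \<Rightarrow> ennreal" where
  "chain n \<rho> t x = (\<Prod>i<n. link i \<rho> t x (x (Suc i)))"

lemma chain_Suc: "chain (Suc n) \<rho> t x = chain n \<rho> t x * link n \<rho> t x (x (Suc n))"
  by (simp add: chain_def)

lemma link_cong: "(n = 0 \<Longrightarrow> t = t') \<Longrightarrow> (n \<noteq> 0 \<Longrightarrow> \<rho> n = \<rho>' n) \<Longrightarrow> (n \<noteq> 0 \<Longrightarrow> x n = x' n) \<Longrightarrow> link n \<rho> t x w = link n \<rho>' t' x' w"
  by (simp add: link_def)

lemma chain_cong: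
  assumes "n > 0 \<Longrightarrow> t = t'" "\<And>i. i \<in> {1..<n} \<Longrightarrow> \<rho> i = \<rho>' i" "\<And>i. i \<in> {1..n} \<Longrightarrow> x i = x' i"
  shows "chain n \<rho> t x = chain n \<rho>' t' x'"
  unfolding chain_def using assms by (intro prod.cong refl) (auto intro!: link_cong simp: Suc_le_eq)

lemma chain_upd: "chain (Suc n) \<rho> t (x(Suc n := w)) = chain n \<rho> t x * link n \<rho> t x w"
proof -
  have "chain n \<rho> t (x(Suc n := w)) = chain n \<rho> t x"
    by (rule chain_cong) auto
  moreover have "link n \<rho> t (x(Suc n := w)) w = link n \<rho> t x w"
    by (rule link_cong) auto
  ultimately show ?thesis by (simp add: chain_Suc)
qed

lemma component_measurable: "j \<in> I \<Longrightarrow> (\<lambda>x. x j) \<in> borel_measurable (\<Pi>\<^sub>M i\<in>I. lborel :: real measure)"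
  using measurable_component_singleton[of j I "\<lambda>_. lborel :: real measure"] by (simp add: measurable_lborel2)

lemma K_measurable': "\<rho> \<in> R \<Longrightarrow> a \<in> borel_measurable M \<Longrightarrow> b \<in> borel_measurable M \<Longrightarrow> (\<lambda>x. K \<rho> (a x) (b x)) \<in> borel_measurable M"
  using measurable_compose[OF measurable_Pair K_measurable, of a M b \<rho>] by simp

lemma g_measurable': "t \<in> T \<Longrightarrow> a \<in> borel_measurable M \<Longrightarrow> (\<lambda>x. g t (a x)) \<in> borel_measurable M"
  by (rule measurable_compose[OF _ g_measurable])

lemma link_measurable:
  assumes "t \<in> T" "n \<noteq> 0 \<Longrightarrow> \<rho> n \<in> R" "n \<noteq> 0 \<Longrightarrow> (\<lambda>z. x z n) \<in> borel_measurable M" "w \<in> borel_measurable M"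
  shows "(\<lambda>z. link n \<rho> t (x z) (w z)) \<in> borel_measurable M"
  unfolding link_def using assms by (cases "n = 0") (auto intro!: K_measurable' g_measurable')

lemma chain_measurable:
  assumes "t \<in> T" "\<And>i. i \<in> {1..<n} \<Longrightarrow> \<rho> i \<in> R"
  shows "chain n \<rho> t \<in> borel_measurable (Leb n)"
proof -
  have "(\<lambda>x. chain n \<rho> t x) \<in> borel_measurable (Leb n)"
    unfolding chain_def using assms
    by (intro borel_measurable_prod_ennreal link_measurable component_measurable) auto
  then show ?thesis by simp
qed

sublocale leb: product_sigma_finite "\<lambda>_::nat. lborel :: real measure"
  by standard

lemma nn_integral_Leb_Suc:
  assumes "f \<in> borel_measurable (Leb (Suc n))"
  shows "(\<integral>\<^sup>+x. f x \<partial>Leb (Suc n)) = (\<integral>\<^sup>+x. \<integral>\<^sup>+w. f (x(Suc n := w)) \<partial>lborel \<partial>Leb n)"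
  using leb.product_nn_integral_insert[of "{1..n}" "Suc n" f] assms
  by (simp add: atLeastAtMostSuc_conv)

lemma upd_measurable: "(\<lambda>(x, w). x(Suc n := w)) \<in> measurable (Leb n \<Otimes>\<^sub>M lborel) (Leb (Suc n))"
proof -
  have "(\<lambda>z. (fst z)(Suc n := snd z)) \<in> measurable (Leb n \<Otimes>\<^sub>M lborel) (Leb (Suc n))"
    by (rule measurable_fun_upd[where J = "{1..n}"]) auto
  then show ?thesis by (simp add: case_prod_beta')
qed

text \<open>Coordinates after e do not enter F, so each is integrated out from the end by
  \<open>K_total\<close>.\<close>

lemma chain_strip:
  assumes t: "t \<in> T" and \<rho>: "\<And>i. i \<in> {1..<d} \<Longrightarrow> \<rho> i \<in> R"
    and e: "1 \<le> e" "e \<le> d" and F: "F \<in> borel_measurable (Leb e)"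
  shows "(\<integral>\<^sup>+x. F (restrict x {1..e}) * chain d \<rho> t x \<partial>Leb d) = (\<integral>\<^sup>+x. F x * chain e \<rho> t x \<partial>Leb e)"
  using e(2) \<rho>
proof (induction d rule: dec_induct)
  case base
  show ?case
    by (intro nn_integral_cong) (auto simp: space_PiM PiE_restrict)
next
  case (step d)
  have \<rho>d: "\<rho> d \<in> R" using step e by auto
  have res: "(\<lambda>x. restrict x {1..e}) \<in> measurable (Leb n) (Leb e)" if "e \<le> n" for n
    using that by (intro measurable_restrict_subset) auto
  have m1: "(\<lambda>x. F (restrict x {1..e}) * chain (Suc d) \<rho> t x) \<in> borel_measurable (Leb (Suc d))"
    using step by (intro borel_measurable_times_ennreal measurable_compose[OF res F] chain_measurable t) auto
  have "(\<integral>\<^sup>+x. F (restrict x {1..e}) * chain (Suc d) \<rho> t x \<partial>Leb (Suc d))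
    = (\<integral>\<^sup>+x. \<integral>\<^sup>+w. F (restrict x {1..e}) * chain d \<rho> t x * K (\<rho> d) (x d) w \<partial>lborel \<partial>Leb d)"
    unfolding nn_integral_Leb_Suc[OF m1] chain_upd
  proof (intro nn_integral_cong)
    fix x :: "nat \<Rightarrow> real" and w :: real
    have "restrict (x(Suc d := w)) {1..e} = restrict x {1..e}"
      using step by (auto simp: restrict_def)
    then show "F (restrict (x(Suc d := w)) {1..e}) * (chain d \<rho> t x * link d \<rho> t x w) = F (restrict x {1..e}) * chain d \<rho> t x * K (\<rho> d) (x d) w"
      using step e by (simp add: link_def mult.assoc)
  qed
  also have "\<dots> = (\<integral>\<^sup>+x. F (restrict x {1..e}) * chain d \<rho> t x \<partial>Leb d)"
  proof (intro nn_integral_cong)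
    fix x
    have "(\<integral>\<^sup>+w. F (restrict x {1..e}) * chain d \<rho> t x * K (\<rho> d) (x d) w \<partial>lborel)
      = F (restrict x {1..e}) * chain d \<rho> t x * (\<integral>\<^sup>+w. K (\<rho> d) (x d) w \<partial>lborel)"
      by (intro nn_integral_cmult) (simp add: K_measurable' \<rho>d)
    then show "(\<integral>\<^sup>+w. F (restrict x {1..e}) * chain d \<rho> t x * K (\<rho> d) (x d) w \<partial>lborel) = F (restrict x {1..e}) * chain d \<rho> t x"
      by (simp add: K_total[OF \<rho>d])
  qed
  also have "\<dots> = (\<integral>\<^sup>+x. F x * chain e \<rho> t x \<partial>Leb e)"
    by (rule step.IH) (use step.prems in auto)
  finally show ?case .
qed

text \<open>Merges \<open>g_step\<close> and \<open>K_step\<close>. Only the parameter that the n-th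
  link reads matters, so multiplying all of them by \<sigma> is harmless.\<close>

lemma link_step:
  assumes "t \<in> T" "n \<noteq> 0 \<Longrightarrow> \<rho> n \<in> R" "\<sigma> \<in> R"
  shows "(\<integral>\<^sup>+v. link n \<rho> t x v * K \<sigma> v w \<partial>lborel) = link n (\<lambda>i. \<rho> i * \<sigma>) (t * \<sigma>) x w"
  using assms by (simp add: link_def g_step K_step)

definition marg_\<rho> :: "(nat \<Rightarrow> real) \<Rightarrow> (nat \<Rightarrow> nat) \<Rightarrow> nat \<Rightarrow> real" where
  "marg_\<rho> \<rho> idx j = (\<Prod>k\<in>{idx j..<idx (Suc j)}. \<rho> k)"

definition marg_t :: "real \<Rightarrow> (nat \<Rightarrow> real) \<Rightarrow> (nat \<Rightarrow> nat) \<Rightarrow> real" where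
  "marg_t t \<rho> idx = t * (\<Prod>k\<in>{1..<idx 1}. \<rho> k)"

lemma R_prod:
  assumes "finite A" "A \<noteq> {}" "\<And>i. i \<in> A \<Longrightarrow> \<rho> i \<in> R"
  shows "(\<Prod>i\<in>A. \<rho> i) \<in> R"
  using assms by (induction A rule: finite_ne_induct) (auto intro: R_mult)

lemma T_prod:
  assumes "finite A" "t \<in> T" "\<And>i. i \<in> A \<Longrightarrow> \<rho> i \<in> R"
  shows "t * (\<Prod>i\<in>A. \<rho> i) \<in> T"
proof (cases "A = {}")
  case False
  then show ?thesis using assms by (intro T_mult R_prod)
qed (use assms in simp)

lemma marg_\<rho>_R:
  assumes \<rho>: "\<And>i. i \<in> {1..<d} \<Longrightarrow> \<rho> i \<in> R"
    and idx: "strict_mono_on {1..p} idx" "idx ` {1..p} \<subseteq> {1..d}" and j: "j \<in> {1..<p}"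
  shows "marg_\<rho> \<rho> idx j \<in> R"
  unfolding marg_\<rho>_def
proof (rule R_prod)
  have "idx j < idx (Suc j)" using j by (intro strict_mono_onD[OF idx(1)]) auto
  then show "{idx j..<idx (Suc j)} \<noteq> {}" by simp
  have "idx j \<in> {1..d}" "idx (Suc j) \<in> {1..d}" using idx(2) j by (auto simp: image_subset_iff)
  then show "\<rho> i \<in> R" if "i \<in> {idx j..<idx (Suc j)}" for i using that by (intro \<rho>) auto
qed simp

lemma marg_t_T:
  assumes \<rho>: "\<And>i. i \<in> {1..<d} \<Longrightarrow> \<rho> i \<in> R" and t: "t \<in> T" and "idx 1 \<le> d"
  shows "marg_t t \<rho> idx \<in> T"
  unfolding marg_t_def using assms by (intro T_prod) auto

text \<open>Induction on \<open>d\<close>: the last coordinate is integrated out through a new test function. If the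
  coordinate \<open>d\<close> is not selected, it is swallowed by the semigroup law.\<close>
lemma chain_marginal_last:
  assumes t: "t \<in> T" and \<rho>: "\<And>i. i \<in> {1..<d} \<Longrightarrow> \<rho> i \<in> R" and d: "1 \<le> d"
    and p: "1 \<le> p" and idx: "strict_mono_on {1..p} idx" "idx ` {1..p} \<subseteq> {1..d}" "idx p = d"
    and F: "F \<in> borel_measurable (Leb p)"
  shows "(\<integral>\<^sup>+x. F (\<lambda>j\<in>{1..p}. x (idx j)) * chain d \<rho> t x \<partial>Leb d)
    = (\<integral>\<^sup>+y. F y * chain p (marg_\<rho> \<rho> idx) (marg_t t \<rho> idx) y \<partial>Leb p)"
  using d \<rho> p idx F
proof (induction d arbitrary: p idx F rule: dec_induct)
  case base
  have "p = 1"
  proof (rule ccontr)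
    assume "p \<noteq> 1"
    then have "idx 1 < idx p" using base by (intro strict_mono_onD[OF base(3)]) auto
    moreover have "1 \<le> idx 1" using base(4) \<open>1 \<le> p\<close> by (auto simp: image_subset_iff)
    ultimately show False using base by simp
  qed
  then have idx1: "idx 1 = 1" using base by simp
  have "chain 1 (marg_\<rho> \<rho> idx) (marg_t t \<rho> idx) x = chain 1 \<rho> t x" for x
    by (rule chain_cong) (auto simp: marg_t_def idx1[simplified])
  moreover have "(\<lambda>j\<in>{1..1}. x (idx j)) = x" if "x \<in> space (Leb 1)" for x
    using that idx1 by (auto simp: space_PiM PiE_def extensional_def restrict_def fun_eq_iff)
  ultimately show ?case
    unfolding \<open>p = 1\<close> by (intro nn_integral_cong) (simp only:)
next
  case (step d)
  obtain p' where p': "p = Suc p'" using step.prems by (cases p) auto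
  have \<rho>d: "\<rho> d \<in> R" using step by auto
  have \<rho>': "\<And>i. i \<in> {1..<d} \<Longrightarrow> \<rho> i \<in> R" using step.prems by auto
  have F: "F \<in> borel_measurable (Leb (Suc p'))" using step.prems by (simp add: p')
  have idxp: "idx (Suc p') = Suc d" using step.prems by (simp add: p')
  have idx_less: "idx j \<in> {1..d}" if "j \<in> {1..p'}" for j
  proof -
    have "idx j < idx (Suc p')" using that step.prems(3) p' by (intro strict_mono_onD[OF step.prems(3)]) auto
    moreover have "idx j \<in> {1..Suc d}" using that step.prems(4) p' by (auto simp: image_subset_iff)
    ultimately show ?thesis using idxp by auto
  qed
  have sel: "(\<lambda>x. \<lambda>j\<in>{1..m}. x (idx' j)) \<in> measurable (Leb n) (Leb m)" if "idx' ` {1..m} \<subseteq> {1..n}" for idx' n m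
    using that by (intro measurable_restrict) (auto simp: measurable_lborel2 intro!: component_measurable)
  have mF: "(\<lambda>(x, w). F (x(Suc p' := w))) \<in> borel_measurable (Leb p' \<Otimes>\<^sub>M lborel)"
    using measurable_compose[OF upd_measurable F] by (simp add: case_prod_beta')
  have mF1: "(\<lambda>w. F (u(Suc p' := w))) \<in> borel_measurable borel" if "u \<in> space (Leb p')" for u
    using measurable_compose[OF measurable_Pair1'[OF that] mF] by simp
  have m1: "(\<lambda>x. F (\<lambda>j\<in>{1..p}. x (idx j)) * chain (Suc d) \<rho> t x) \<in> borel_measurable (Leb (Suc d))"
    using step.prems by (intro borel_measurable_times_ennreal measurable_compose[OF sel] chain_measurable t) auto
  let ?\<rho> = "marg_\<rho> \<rho> idx" and ?t = "marg_t t \<rho> idx"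
  have \<rho>R: "\<And>j. j \<in> {1..<p} \<Longrightarrow> ?\<rho> j \<in> R" using marg_\<rho>_R[OF step.prems(1,3,4)] .
  have tT: "?t \<in> T" using step.prems p' by (intro marg_t_T[OF step.prems(1) t]) (auto simp: image_subset_iff)
  have lhs: "(\<integral>\<^sup>+x. F (\<lambda>j\<in>{1..p}. x (idx j)) * chain (Suc d) \<rho> t x \<partial>Leb (Suc d))
    = (\<integral>\<^sup>+x. \<integral>\<^sup>+w. F ((\<lambda>j\<in>{1..p'}. x (idx j))(Suc p' := w)) * (chain d \<rho> t x * K (\<rho> d) (x d) w) \<partial>lborel \<partial>Leb d)"
    unfolding nn_integral_Leb_Suc[OF m1] chain_upd
  proof (intro nn_integral_cong)
    fix x :: "nat \<Rightarrow> real" and w :: real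
    have "(\<lambda>j\<in>{1..p}. (x(Suc d := w)) (idx j)) = (\<lambda>j\<in>{1..p'}. x (idx j))(Suc p' := w)"
      using idx_less idxp by (fastforce simp: p' fun_eq_iff restrict_def le_Suc_eq)
    then show "F (\<lambda>j\<in>{1..p}. (x(Suc d := w)) (idx j)) * (chain d \<rho> t x * link d \<rho> t x w)
      = F ((\<lambda>j\<in>{1..p'}. x (idx j))(Suc p' := w)) * (chain d \<rho> t x * K (\<rho> d) (x d) w)"
      using step by (simp add: link_def)
  qed
  have mR: "(\<lambda>y. F y * chain p ?\<rho> ?t y) \<in> borel_measurable (Leb (Suc p'))"
    using F \<rho>R tT unfolding p' by (intro borel_measurable_times_ennreal chain_measurable) auto
  have rhs: "(\<integral>\<^sup>+y. F y * chain p ?\<rho> ?t y \<partial>Leb p)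
    = (\<integral>\<^sup>+y. \<integral>\<^sup>+w. F (y(Suc p' := w)) * (chain p' ?\<rho> ?t y * link p' ?\<rho> ?t y w) \<partial>lborel \<partial>Leb p')"
    using nn_integral_Leb_Suc[OF mR] unfolding p' chain_upd .
  show ?case
  proof (cases "p' \<noteq> 0 \<and> idx p' = d")
    case True
    \<comment> \<open>Coordinate d is selected as well, so the last transition starts from y p'.
      Integrated over w together with F it becomes a test function of the first p' selected
      coordinates.\<close>
    define F' where "F' = (\<lambda>y. \<integral>\<^sup>+w. F (y(Suc p' := w)) * K (\<rho> d) (y p') w \<partial>lborel)"
    have F': "F' \<in> borel_measurable (Leb p')"
      unfolding F'_def
    proof (rule lborel.borel_measurable_nn_integral)
      have "(\<lambda>z. K (\<rho> d) (fst z p') (snd z)) \<in> borel_measurable (Leb p' \<Otimes>\<^sub>M lborel)"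
        using True by (intro K_measurable' \<rho>d measurable_compose[OF measurable_fst component_measurable])
          (auto simp: measurable_lborel2[symmetric])
      then show "(\<lambda>(y, w). F (y(Suc p' := w)) * K (\<rho> d) (y p') w) \<in> borel_measurable (Leb p' \<Otimes>\<^sub>M lborel)"
        using mF by (simp add: case_prod_beta')
    qed
    have "(\<integral>\<^sup>+x. F (\<lambda>j\<in>{1..p}. x (idx j)) * chain (Suc d) \<rho> t x \<partial>Leb (Suc d))
      = (\<integral>\<^sup>+x. F' (\<lambda>j\<in>{1..p'}. x (idx j)) * chain d \<rho> t x \<partial>Leb d)"
      unfolding lhs
    proof (intro nn_integral_cong)
      fix x assume x: "x \<in> space (Leb d)"
      define y where "y = (\<lambda>j\<in>{1..p'}. x (idx j))"
      have y: "y \<in> space (Leb p')"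
        by (simp add: y_def space_PiM)
      have "y p' = x d" using True by (simp add: y_def)
      then have "F' y * chain d \<rho> t x = (\<integral>\<^sup>+w. F (y(Suc p' := w)) * K (\<rho> d) (x d) w * chain d \<rho> t x \<partial>lborel)"
        unfolding F'_def using mF1[OF y] by (subst nn_integral_multc) (auto intro!: borel_measurable_times_ennreal K_measurable' \<rho>d)
      then show "(\<integral>\<^sup>+w. F ((\<lambda>j\<in>{1..p'}. x (idx j))(Suc p' := w)) * (chain d \<rho> t x * K (\<rho> d) (x d) w) \<partial>lborel)
        = F' (\<lambda>j\<in>{1..p'}. x (idx j)) * chain d \<rho> t x"
        unfolding y_def by (simp add: mult_ac)
    qed
    also have "\<dots> = (\<integral>\<^sup>+y. F' y * chain p' ?\<rho> ?t y \<partial>Leb p')"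
    proof (rule step.IH[OF \<rho>'])
      show "strict_mono_on {1..p'} idx"
        using step.prems(3) by (rule monotone_on_subset) (auto simp: p')
    qed (use True idx_less F' in auto)
    also have "\<dots> = (\<integral>\<^sup>+y. F y * chain p ?\<rho> ?t y \<partial>Leb p)"
      unfolding rhs
    proof (intro nn_integral_cong)
      fix y assume y: "y \<in> space (Leb p')"
      have "?\<rho> p' = \<rho> d" using True idxp by (simp add: marg_\<rho>_def)
      then have l: "link p' ?\<rho> ?t y w = K (\<rho> d) (y p') w" for w
        using True by (simp add: link_def)
      have "F' y * chain p' ?\<rho> ?t y = (\<integral>\<^sup>+w. F (y(Suc p' := w)) * K (\<rho> d) (y p') w * chain p' ?\<rho> ?t y \<partial>lborel)"
        unfolding F'_def using mF1[OF y] by (subst nn_integral_multc) (auto intro!: borel_measurable_times_ennreal K_measurable' \<rho>d)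
      then show "F' y * chain p' ?\<rho> ?t y = (\<integral>\<^sup>+w. F (y(Suc p' := w)) * (chain p' ?\<rho> ?t y * link p' ?\<rho> ?t y w) \<partial>lborel)"
        unfolding l by (simp add: mult_ac)
    qed
    finally show ?thesis .
  next
    case False
    \<comment> \<open>Coordinate d is not selected. Moving the last selected index from d + 1 to d
      keeps the number of selected coordinates and meets the condition of the induction hypothesis
      that the last one is d. This includes p' = 0.\<close>
    define idx' where "idx' = idx(Suc p' := d)"
    define F' where "F' = (\<lambda>y. \<integral>\<^sup>+w. F (y(Suc p' := w)) * K (\<rho> d) (y (Suc p')) w \<partial>lborel)"
    have idx'_simps: "idx' (Suc p') = d" "j \<le> p' \<Longrightarrow> idx' j = idx j" for j
      by (auto simp: idx'_def)
    have less_d: "idx j < d" if "j \<in> {1..p'}" for j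
    proof (cases "j = p'")
      case True
      then show ?thesis using False idx_less[OF that] that by auto
    next
      case False
      then have "idx j < idx p'" using that step.prems(3) p' by (intro strict_mono_onD[OF step.prems(3)]) auto
      then show ?thesis using idx_less[of p'] that by auto
    qed
    have mono': "strict_mono_on {1..Suc p'} idx'"
    proof (rule strict_mono_onI)
      fix i j assume ij: "i \<in> {1..Suc p'}" "j \<in> {1..Suc p'}" "i < j"
      show "idx' i < idx' j"
      proof (cases "j = Suc p'")
        case True
        then show ?thesis using ij less_d[of i] by (simp add: idx'_simps)
      next
        case False
        then show ?thesis using ij step.prems(3) p' by (auto simp: idx'_simps intro!: strict_mono_onD[OF step.prems(3)])
      qed
    qed
    have range': "idx' ` {1..Suc p'} \<subseteq> {1..d}"
      using idx_less step.hyps by (auto simp: idx'_def)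
    have mF2: "(\<lambda>(y, w). F (y(Suc p' := w))) \<in> borel_measurable (Leb (Suc p') \<Otimes>\<^sub>M lborel)"
    proof -
      have "(\<lambda>z. (fst z)(Suc p' := snd z)) \<in> measurable (Leb (Suc p') \<Otimes>\<^sub>M lborel) (Leb (Suc p'))"
        by (rule measurable_fun_upd[where J = "{1..Suc p'}"]) auto
      from measurable_compose[OF this F] show ?thesis by (simp add: case_prod_beta')
    qed
    have F': "F' \<in> borel_measurable (Leb (Suc p'))"
      unfolding F'_def
    proof (rule lborel.borel_measurable_nn_integral)
      have "(\<lambda>z. K (\<rho> d) (fst z (Suc p')) (snd z)) \<in> borel_measurable (Leb (Suc p') \<Otimes>\<^sub>M lborel)"
        by (intro K_measurable' \<rho>d measurable_compose[OF measurable_fst component_measurable])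
          (auto simp: measurable_lborel2[symmetric])
      then show "(\<lambda>(y, w). F (y(Suc p' := w)) * K (\<rho> d) (y (Suc p')) w) \<in> borel_measurable (Leb (Suc p') \<Otimes>\<^sub>M lborel)"
        using mF2 by (simp add: case_prod_beta')
    qed
    let ?\<rho>' = "marg_\<rho> \<rho> idx'" and ?t' = "marg_t t \<rho> idx'"
    have \<rho>R': "\<And>j. j \<in> {1..<Suc p'} \<Longrightarrow> ?\<rho>' j \<in> R" using marg_\<rho>_R[OF \<rho>' mono' range'] .
    have tT': "?t' \<in> T" using range' by (intro marg_t_T[OF \<rho>' t]) (auto simp: image_subset_iff)
    have mR': "(\<lambda>y. F' y * chain (Suc p') ?\<rho>' ?t' y) \<in> borel_measurable (Leb (Suc p'))"
      using F' \<rho>R' tT' by (intro borel_measurable_times_ennreal chain_measurable) auto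
    have "(\<integral>\<^sup>+x. F (\<lambda>j\<in>{1..p}. x (idx j)) * chain (Suc d) \<rho> t x \<partial>Leb (Suc d))
      = (\<integral>\<^sup>+x. F' (\<lambda>j\<in>{1..Suc p'}. x (idx' j)) * chain d \<rho> t x \<partial>Leb d)"
      unfolding lhs
    proof (intro nn_integral_cong)
      fix x assume x: "x \<in> space (Leb d)"
      define y where "y = (\<lambda>j\<in>{1..p'}. x (idx j))"
      define y' where "y' = (\<lambda>j\<in>{1..Suc p'}. x (idx' j))"
      have y: "y \<in> space (Leb p')"
        by (simp add: y_def space_PiM)
      \<comment> \<open>F' reads the value at coordinate d before overwriting that slot by w, so the
        auxiliary selection of d leaves no trace.\<close>
      have y': "y' (Suc p') = x d" "y'(Suc p' := w) = y(Suc p' := w)" for w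
        by (auto simp: y_def y'_def idx'_simps fun_eq_iff restrict_def)
      have "F' y' * chain d \<rho> t x = (\<integral>\<^sup>+w. F (y(Suc p' := w)) * K (\<rho> d) (x d) w * chain d \<rho> t x \<partial>lborel)"
        unfolding F'_def y' using mF1[OF y] by (subst nn_integral_multc) (auto intro!: borel_measurable_times_ennreal K_measurable' \<rho>d)
      then show "(\<integral>\<^sup>+w. F ((\<lambda>j\<in>{1..p'}. x (idx j))(Suc p' := w)) * (chain d \<rho> t x * K (\<rho> d) (x d) w) \<partial>lborel)
        = F' (\<lambda>j\<in>{1..Suc p'}. x (idx' j)) * chain d \<rho> t x"
        unfolding y_def y'_def by (simp add: mult_ac)
    qed
    also have "\<dots> = (\<integral>\<^sup>+y. F' y * chain (Suc p') ?\<rho>' ?t' y \<partial>Leb (Suc p'))"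
      by (rule step.IH[OF \<rho>' _ mono' range' idx'_simps(1) F']) auto
    also have "\<dots> = (\<integral>\<^sup>+u. \<integral>\<^sup>+v. F' (u(Suc p' := v)) * (chain p' ?\<rho>' ?t' u * link p' ?\<rho>' ?t' u v) \<partial>lborel \<partial>Leb p')"
      unfolding nn_integral_Leb_Suc[OF mR'] chain_upd ..
    also have "\<dots> = (\<integral>\<^sup>+y. F y * chain p ?\<rho> ?t y \<partial>Leb p)"
      unfolding rhs
    proof (rule nn_integral_cong)
      fix u assume u: "u \<in> space (Leb p')"
      let ?C = "chain p' ?\<rho>' ?t' u"
      have C: "chain p' ?\<rho> ?t u = ?C"
        by (rule chain_cong) (auto simp: marg_t_def marg_\<rho>_def idx'_simps)
      have lm: "(\<lambda>v. link p' ?\<rho>' ?t' u v) \<in> borel_measurable borel"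
        using \<rho>R' tT' by (intro link_measurable) auto
      have Fv: "F' (u(Suc p' := v)) = (\<integral>\<^sup>+w. F (u(Suc p' := w)) * K (\<rho> d) v w \<partial>lborel)" for v
        by (simp add: F'_def)
      have "(\<integral>\<^sup>+v. F' (u(Suc p' := v)) * (?C * link p' ?\<rho>' ?t' u v) \<partial>lborel)
        = (\<integral>\<^sup>+v. \<integral>\<^sup>+w. F (u(Suc p' := w)) * ?C * (link p' ?\<rho>' ?t' u v * K (\<rho> d) v w) \<partial>lborel \<partial>lborel)"
        unfolding Fv using mF1[OF u]
        by (intro nn_integral_cong, subst nn_integral_multc[symmetric])
          (auto intro!: borel_measurable_times_ennreal K_measurable' \<rho>d simp: mult_ac)
      \<comment> \<open>Tonelli moves the unselected coordinate v inside, where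
        \<open>link_step\<close> integrates it out.\<close>
      also have "\<dots> = (\<integral>\<^sup>+w. \<integral>\<^sup>+v. F (u(Suc p' := w)) * ?C * (link p' ?\<rho>' ?t' u v * K (\<rho> d) v w) \<partial>lborel \<partial>lborel)"
      proof (rule lborel_pair.Fubini')
        have mfst: "(\<lambda>z. F (u(Suc p' := fst z))) \<in> borel_measurable (lborel \<Otimes>\<^sub>M lborel)"
          using mF1[OF u] by (intro measurable_compose[OF measurable_fst, where g = "\<lambda>w. F (u(Suc p' := w))"]) simp
        have msnd: "(\<lambda>z. link p' ?\<rho>' ?t' u (snd z)) \<in> borel_measurable (lborel \<Otimes>\<^sub>M lborel)"
          using lm by (intro measurable_compose[OF measurable_snd, where g = "link p' ?\<rho>' ?t' u"]) simp
        show "(\<lambda>(w, v). F (u(Suc p' := w)) * ?C * (link p' ?\<rho>' ?t' u v * K (\<rho> d) v w)) \<in> borel_measurable (lborel \<Otimes>\<^sub>M lborel)"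
          unfolding case_prod_beta'
          by (intro borel_measurable_times_ennreal K_measurable' \<rho>d borel_measurable_const mfst msnd)
            (auto simp: measurable_lborel2[symmetric])
      qed
      also have "\<dots> = (\<integral>\<^sup>+w. F (u(Suc p' := w)) * (chain p' ?\<rho> ?t u * link p' ?\<rho> ?t u w) \<partial>lborel)"
      proof (intro nn_integral_cong)
        fix w
        \<comment> \<open>The extra factor \<rho> d lengthens the product over the last gap by one
          index; for p' = 0 this gap is the initial segment that enters t.\<close>
        have "link p' (\<lambda>i. ?\<rho>' i * \<rho> d) (?t' * \<rho> d) u w = link p' ?\<rho> ?t u w"
        proof (rule link_cong)
          assume "p' = 0"
          then show "?t' * \<rho> d = ?t"
            using idxp idx'_simps(1) step.hyps by (simp add: marg_t_def mult.assoc)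
        next
          assume "p' \<noteq> 0"
          then show "?\<rho>' p' * \<rho> d = ?\<rho> p'"
            using idxp idx_less[of p'] by (simp add: marg_\<rho>_def idx'_simps)
        qed simp
        then have "(\<integral>\<^sup>+v. link p' ?\<rho>' ?t' u v * K (\<rho> d) v w \<partial>lborel) = link p' ?\<rho> ?t u w"
          using link_step[of ?t' p' ?\<rho>' "\<rho> d" u w] tT' \<rho>R' \<rho>d by simp
        moreover have "(\<integral>\<^sup>+v. F (u(Suc p' := w)) * ?C * (link p' ?\<rho>' ?t' u v * K (\<rho> d) v w) \<partial>lborel)
          = F (u(Suc p' := w)) * ?C * (\<integral>\<^sup>+v. link p' ?\<rho>' ?t' u v * K (\<rho> d) v w \<partial>lborel)"
          using lm by (intro nn_integral_cmult) (auto intro!: borel_measurable_times_ennreal K_measurable' \<rho>d)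
        ultimately show "(\<integral>\<^sup>+v. F (u(Suc p' := w)) * ?C * (link p' ?\<rho>' ?t' u v * K (\<rho> d) v w) \<partial>lborel)
          = F (u(Suc p' := w)) * (chain p' ?\<rho> ?t u * link p' ?\<rho> ?t u w)"
          unfolding C by (simp add: mult.assoc)
      qed
      finally show "(\<integral>\<^sup>+v. F' (u(Suc p' := v)) * (?C * link p' ?\<rho>' ?t' u v) \<partial>lborel)
        = (\<integral>\<^sup>+w. F (u(Suc p' := w)) * (chain p' ?\<rho> ?t u * link p' ?\<rho> ?t u w) \<partial>lborel)" .
    qed
    finally show ?thesis .
  qed
qed

text \<open>Everything beyond the largest selected index is stripped first, so that the last
  remaining coordinate is a selected one.\<close>

lemma chain_marginal:
  assumes t: "t \<in> T" and \<rho>: "\<And>i. i \<in> {1..<d} \<Longrightarrow> \<rho> i \<in> R"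
    and p: "1 \<le> p" and idx: "strict_mono_on {1..p} idx" "idx ` {1..p} \<subseteq> {1..d}"
    and F: "F \<in> borel_measurable (Leb p)"
  shows "(\<integral>\<^sup>+x. F (\<lambda>j\<in>{1..p}. x (idx j)) * chain d \<rho> t x \<partial>Leb d)
    = (\<integral>\<^sup>+y. F y * chain p (marg_\<rho> \<rho> idx) (marg_t t \<rho> idx) y \<partial>Leb p)"
proof -
  define e where "e = idx p"
  have e: "1 \<le> e" "e \<le> d" using idx(2) p by (auto simp: e_def image_subset_iff)
  have le: "idx j \<in> {1..e}" if "j \<in> {1..p}" for j
  proof -
    have "idx j \<le> e"
      using strict_mono_onD[OF idx(1), of j p] that p by (cases "j = p") (auto simp: e_def)
    then show ?thesis using idx(2) that by (auto simp: image_subset_iff)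
  qed
  have sel: "(\<lambda>x. \<lambda>j\<in>{1..p}. x (idx j)) \<in> measurable (Leb e) (Leb p)"
    using le by (intro measurable_restrict) (auto simp: measurable_lborel2 intro!: component_measurable)
  have "(\<integral>\<^sup>+x. F (\<lambda>j\<in>{1..p}. x (idx j)) * chain d \<rho> t x \<partial>Leb d)
    = (\<integral>\<^sup>+x. F (\<lambda>j\<in>{1..p}. (restrict x {1..e}) (idx j)) * chain d \<rho> t x \<partial>Leb d)"
    using le by (intro nn_integral_cong arg_cong2[where f = "(*)"] arg_cong[where f = F] refl) (auto simp: restrict_def fun_eq_iff)
  also have "\<dots> = (\<integral>\<^sup>+x. F (\<lambda>j\<in>{1..p}. x (idx j)) * chain e \<rho> t x \<partial>Leb e)"
    using chain_strip[OF t \<rho> e measurable_compose[OF sel F]] by simp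
  also have "\<dots> = (\<integral>\<^sup>+y. F y * chain p (marg_\<rho> \<rho> idx) (marg_t t \<rho> idx) y \<partial>Leb p)"
    using e le \<rho> by (intro chain_marginal_last t p idx F) (auto simp: e_def)
  finally show ?thesis .
qed

end

section \<open>The Gaussian case\<close>

text \<open>Bayes' formula for a Gaussian pair: density of y times that of z given y, rewritten as
  density of z times that of y given z. The proof completes the square in y.\<close>

lemma normal_density_product:
  fixes \<mu> \<sigma> s \<rho> y z :: real
  assumes "0 < \<sigma>" "0 < s"
  defines "v \<equiv> sqrt (s\<^sup>2 + \<rho>\<^sup>2 * \<sigma>\<^sup>2)"
  shows "normal_density \<mu> \<sigma> y * normal_density (\<rho> * y) s z
    = normal_density (\<rho> * \<mu>) v z * normal_density ((\<mu> * s\<^sup>2 + \<rho> * \<sigma>\<^sup>2 * z) / v\<^sup>2) (\<sigma> * s / v) y"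
proof -
  define A B V where "A = \<sigma>\<^sup>2" and "B = s\<^sup>2" and "V = B + \<rho>\<^sup>2 * A"
  have pos: "0 < A" "0 < B" "0 < V"
    using assms by (auto simp: A_def B_def V_def intro!: add_pos_nonneg)
  have v: "v\<^sup>2 = V" "0 < v" using pos by (auto simp: v_def V_def A_def B_def)
  have w: "(\<sigma> * s / v)\<^sup>2 = A * B / V"
    by (simp add: power_mult_distrib power_divide v A_def B_def)
  have root: "sqrt (2 * pi * A) * sqrt (2 * pi * B) = sqrt (2 * pi * V) * sqrt (2 * pi * (A * B / V))"
    using pos by (simp flip: real_sqrt_mult)
  have e: "- ((y - \<mu>)\<^sup>2 / (2 * A)) - (z - \<rho> * y)\<^sup>2 / (2 * B)
     = - ((z - \<rho> * \<mu>)\<^sup>2 / (2 * V)) - (y - (\<mu> * B + \<rho> * A * z) / V)\<^sup>2 / (2 * (A * B / V))"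
  proof -
    have "(y - (\<mu> * B + \<rho> * A * z) / V)\<^sup>2 = (V * y - (\<mu> * B + \<rho> * A * z))\<^sup>2 / V\<^sup>2"
      using pos by (simp add: power_divide[symmetric] diff_divide_distrib)
    then have 1: "(y - (\<mu> * B + \<rho> * A * z) / V)\<^sup>2 / (2 * (A * B / V)) = (V * y - (\<mu> * B + \<rho> * A * z))\<^sup>2 / (2 * A * B * V)"
      using pos by (simp add: power2_eq_square)
    have 2: "(y - \<mu>)\<^sup>2 / (2 * A) + (z - \<rho> * y)\<^sup>2 / (2 * B) = ((y - \<mu>)\<^sup>2 * B * V + (z - \<rho> * y)\<^sup>2 * A * V) / (2 * A * B * V)"
      using pos by (simp add: add_divide_distrib)
    have 3: "(z - \<rho> * \<mu>)\<^sup>2 / (2 * V) = ((z - \<rho> * \<mu>)\<^sup>2 * A * B) / (2 * A * B * V)"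
      using pos by simp
    \<comment> \<open>Over the common denominator 2 A B V only this polynomial identity
      remains.\<close>
    have "(y - \<mu>)\<^sup>2 * B * V + (z - \<rho> * y)\<^sup>2 * A * V = (z - \<rho> * \<mu>)\<^sup>2 * A * B + (V * y - (\<mu> * B + \<rho> * A * z))\<^sup>2"
      unfolding V_def power2_eq_square by (simp add: ring_distribs mult_ac)
    then have "(y - \<mu>)\<^sup>2 / (2 * A) + (z - \<rho> * y)\<^sup>2 / (2 * B) = (z - \<rho> * \<mu>)\<^sup>2 / (2 * V) + (y - (\<mu> * B + \<rho> * A * z) / V)\<^sup>2 / (2 * (A * B / V))"
      unfolding 1 2 3 by (simp only: add_divide_distrib)
    then show ?thesis by linarith
  qed
  have "normal_density \<mu> \<sigma> y * normal_density (\<rho> * y) s z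
    = 1 / (sqrt (2 * pi * A) * sqrt (2 * pi * B)) * exp (- ((y - \<mu>)\<^sup>2 / (2 * A)) - (z - \<rho> * y)\<^sup>2 / (2 * B))"
    by (simp add: normal_density_def A_def B_def exp_diff exp_minus field_simps)
  also have "\<dots> = normal_density (\<rho> * \<mu>) v z * normal_density ((\<mu> * s\<^sup>2 + \<rho> * \<sigma>\<^sup>2 * z) / v\<^sup>2) (\<sigma> * s / v) y"
    unfolding e root by (simp add: normal_density_def w v exp_diff exp_minus field_simps flip: A_def B_def)
  finally show ?thesis .
qed

lemma nn_integral_normal_density_kernel:
  fixes \<mu> \<sigma> s \<rho> z :: real
  assumes "0 < \<sigma>" "0 < s"
  shows "(\<integral>\<^sup>+y. ennreal (normal_density \<mu> \<sigma> y) * ennreal (normal_density (\<rho> * y) s z) \<partial>lborel)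
    = ennreal (normal_density (\<rho> * \<mu>) (sqrt (s\<^sup>2 + \<rho>\<^sup>2 * \<sigma>\<^sup>2)) z)"
proof -
  let ?v = "sqrt (s\<^sup>2 + \<rho>\<^sup>2 * \<sigma>\<^sup>2)"
  have v: "0 < ?v" using assms by (simp add: add_pos_nonneg)
  have "(\<integral>\<^sup>+y. ennreal (normal_density \<mu> \<sigma> y) * ennreal (normal_density (\<rho> * y) s z) \<partial>lborel)
    = (\<integral>\<^sup>+y. ennreal (normal_density (\<rho> * \<mu>) ?v z) * ennreal (normal_density ((\<mu> * s\<^sup>2 + \<rho> * \<sigma>\<^sup>2 * z) / ?v\<^sup>2) (\<sigma> * s / ?v) y) \<partial>lborel)"
    by (intro nn_integral_cong) (simp only: ennreal_mult'[symmetric] normal_density_nonneg normal_density_product[OF assms])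
  also have "\<dots> = ennreal (normal_density (\<rho> * \<mu>) ?v z) * (\<integral>\<^sup>+y. ennreal (normal_density ((\<mu> * s\<^sup>2 + \<rho> * \<sigma>\<^sup>2 * z) / ?v\<^sup>2) (\<sigma> * s / ?v) y) \<partial>lborel)"
    by (intro nn_integral_cmult) simp
  also have "(\<integral>\<^sup>+y. ennreal (normal_density ((\<mu> * s\<^sup>2 + \<rho> * \<sigma>\<^sup>2 * z) / ?v\<^sup>2) (\<sigma> * s / ?v) y) \<partial>lborel) = 1"
    using assms v by (subst nn_integral_eq_integral) (auto intro!: integrable_normal_density integral_normal_density)
  finally show ?thesis by simp
qed

text \<open>The factor n + 2 on the left makes the coefficients decay faster than any geometric
  sequence, so the radius of convergence is infinite.\<close>

lemma hermite_powser_summable: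
  fixes c :: "nat \<Rightarrow> real"
  assumes rec: "\<And>n. (real n + 2) * c (Suc (Suc n)) = x * c (Suc n) - c n"
  shows "summable (\<lambda>n. c n * t ^ n)"
proof -
  \<comment> \<open>This rate satisfies r |t| \<le> 1/2. Beyond the N chosen next, n + 2 absorbs the
    loss |x| / r + 1 / r^2 of one recurrence step, and C covers the finitely many earlier
    indices.\<close>
  define r where "r = 1 / (2 * (\<bar>t\<bar> + 1))"
  have r: "0 < r" "r * \<bar>t\<bar> \<le> 1 / 2" by (auto simp: r_def field_simps)
  obtain N :: nat where N: "\<bar>x\<bar> / r + 1 / r\<^sup>2 \<le> real N" using real_arch_simple by blast
  define C where "C = (\<Sum>n\<le>Suc N. \<bar>c n\<bar> / r ^ n)"
  have C: "0 \<le> C" unfolding C_def using r by (intro sum_nonneg) auto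
  have bound: "\<bar>c n\<bar> \<le> C * r ^ n" for n
  proof (induction n rule: induct_nat_012)
    case 0
    have "\<bar>c 0\<bar> / r ^ 0 \<le> C" unfolding C_def using r by (intro member_le_sum) auto
    then show ?case by simp
  next
    case 1
    have "\<bar>c 1\<bar> / r ^ 1 \<le> C" unfolding C_def using r by (intro member_le_sum) auto
    then show ?case using r by (simp add: field_simps)
  next
    case (ge2 n)
    show ?case
    proof (cases "Suc (Suc n) \<le> Suc N")
      case True
      have "\<bar>c (Suc (Suc n))\<bar> / r ^ Suc (Suc n) \<le> C" unfolding C_def using r True by (intro member_le_sum) auto
      then show ?thesis using r by (subst (asm) pos_divide_le_eq) auto
    next
      case False
      then have n: "real N \<le> real n + 2" by simp
      have "(real n + 2) * \<bar>c (Suc (Suc n))\<bar> = \<bar>x * c (Suc n) - c n\<bar>"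
        unfolding rec[symmetric] by (simp add: abs_mult)
      also have "\<dots> \<le> \<bar>x\<bar> * \<bar>c (Suc n)\<bar> + \<bar>c n\<bar>"
        using abs_triangle_ineq4[of "x * c (Suc n)" "c n"] by (simp add: abs_mult)
      also have "\<dots> \<le> \<bar>x\<bar> * (C * r ^ Suc n) + C * r ^ n"
        using ge2 by (intro add_mono mult_left_mono) auto
      also have "\<dots> = C * r ^ Suc (Suc n) * (\<bar>x\<bar> / r + 1 / r\<^sup>2)"
        using r by (simp add: field_simps power2_eq_square)
      also have "\<dots> \<le> C * r ^ Suc (Suc n) * (real n + 2)"
        using C r N n by (intro mult_left_mono) auto
      finally have "(real n + 2) * \<bar>c (Suc (Suc n))\<bar> \<le> (real n + 2) * (C * r ^ Suc (Suc n))"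
        by (simp only: mult_ac)
      then show ?thesis by (subst (asm) mult_le_cancel_left_pos) auto
    qed
  qed
  have "summable (\<lambda>n. C * (1 / 2 :: real) ^ n)"
    by (intro summable_mult) (simp add: summable_geometric)
  then show ?thesis
  proof (rule summable_comparison_test'[where N = 0])
    fix n
    have "\<bar>c n\<bar> * \<bar>t\<bar> ^ n \<le> C * r ^ n * \<bar>t\<bar> ^ n"
      using bound by (intro mult_right_mono) auto
    also have "\<dots> = C * (r * \<bar>t\<bar>) ^ n" by (simp add: power_mult_distrib mult_ac)
    also have "\<dots> \<le> C * (1 / 2) ^ n" using C r by (intro mult_left_mono power_mono) auto
    finally show "norm (c n * t ^ n) \<le> C * (1 / 2) ^ n" by (simp add: abs_mult power_abs)
  qed
qed

text \<open>The recurrence makes the series F a solution of F' = (x - u) F, so F(u) exp (u^2/2 - x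
  u) is constant and equal to its value 1 at 0.\<close>

lemma q_Hermite_gf_1: "q_Hermite_gf 1 t x = exp (x * t - t\<^sup>2 / 2)"
proof -
  define c where "c = (\<lambda>n. q_Hermite 1 n x / q_fact 1 n)"
  define F where "F = (\<lambda>u. \<Sum>n. c n * u ^ n)"
  have br: "q_bracket 1 n = real n" for n by (simp add: q_bracket_def)
  have fS: "q_fact 1 (Suc n) = q_fact 1 n * (real n + 1)" for n
    by (simp add: q_fact_def br add.commute)
  have f0: "q_fact 1 0 = 1" by (simp add: q_fact_def)
  have fnz: "q_fact 1 n \<noteq> 0" for n
    by (induction n) (use f0 in \<open>auto simp: fS\<close>)
  have c01: "c 0 = 1" "c (Suc 0) = x" using fS[of 0] f0 by (auto simp: c_def)
  have rec: "(real n + 2) * c (Suc (Suc n)) = x * c (Suc n) - c n" for n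
  proof -
    have "m2 * ((x * B - m1 * A) / (P * m1 * m2)) = x * (B / (P * m1)) - A / P"
      if "P \<noteq> 0" "m1 \<noteq> 0" "m2 \<noteq> 0" for A B P m1 m2 :: real
      using that by (simp add: field_simps)
    from this[OF fnz[of n], of "real n + 1" "real n + 2"] show ?thesis
      unfolding c_def q_Hermite.simps br fS by (simp add: add.commute)
  qed
  have sm: "summable (\<lambda>n. c n * u ^ n)" for u
    by (rule hermite_powser_summable[OF rec])
  have diffs: "diffs c n = x * c n - shift_seq 1 c n" for n
    using rec by (cases n) (auto simp: diffs_def c01 algebra_simps)
  have deriv: "(F has_field_derivative (x - u) * F u) (at u)" for u
  proof -
    have "(F has_field_derivative (\<Sum>n. diffs c n * u ^ n)) (at u)"
      unfolding F_def by (rule termdiffs_strong_converges_everywhere[OF sm])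
    moreover have "(\<lambda>n. x * (c n * u ^ n) - shift_seq 1 c n * u ^ n) sums (x * F u - u ^ 1 * F u)"
      unfolding F_def by (intro sums_diff sums_mult summable_sums sums_shift_seq sm)
    then have "(\<Sum>n. diffs c n * u ^ n) = x * F u - u ^ 1 * F u"
      unfolding diffs by (simp add: sums_iff algebra_simps)
    ultimately have "(F has_field_derivative x * F u - u ^ 1 * F u) (at u)" by (simp only:)
    then show ?thesis by (simp add: left_diff_distrib)
  qed
  define G where "G = (\<lambda>u. F u * exp (u\<^sup>2 / 2 - x * u))"
  have "(G has_field_derivative 0) (at u)" for u
    unfolding G_def by (auto intro!: derivative_eq_intros deriv simp: algebra_simps)
  then have "G t = G 0" by (intro DERIV_isconst_all) auto
  moreover have "G 0 = 1" by (simp add: G_def F_def c01)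
  ultimately have "F t * exp (t\<^sup>2 / 2 - x * t) = 1" by (simp add: G_def)
  then have "F t = 1 / exp (t\<^sup>2 / 2 - x * t)" by (simp add: field_simps)
  also have "\<dots> = exp (x * t - t\<^sup>2 / 2)" by (simp flip: exp_minus add: inverse_eq_divide[symmetric])
  finally show ?thesis by (simp add: F_def c_def q_Hermite_gf_def mult.commute)
qed

lemma MN_density_1: "MN_density 1 t x = normal_density t 1 x"
proof -
  have "x * t - t\<^sup>2 / 2 + - x\<^sup>2 / 2 = - (x - t)\<^sup>2 / 2"
    by (simp add: power2_eq_square field_simps)
  then have "exp (x * t - t\<^sup>2 / 2) * exp (- x\<^sup>2 / 2) = exp (- (x - t)\<^sup>2 / 2)"
    unfolding exp_add[symmetric] by simp
  then show ?thesis
    by (simp add: MN_density_def q_Hermite_gf_1 f_N_def normal_density_def)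
qed

section \<open>One pair of kernels for all q in (-1, 1]\<close>

definition supp_proj :: "real \<Rightarrow> real \<Rightarrow> real" where
  "supp_proj q y = (if y \<in> q_supp q then y else 0)"

lemma zero_in_q_supp: "q \<le> 1 \<Longrightarrow> 0 \<in> q_supp q"
  by (simp add: q_supp_def)

lemma supp_proj_in: "q \<le> 1 \<Longrightarrow> supp_proj q y \<in> q_supp q"
  by (simp add: supp_proj_def zero_in_q_supp)

lemma supp_proj_measurable [measurable]: "supp_proj q \<in> borel_measurable borel"
proof -
  have [measurable]: "q_supp q \<in> sets borel" by (simp add: q_supp_def)
  have "(\<lambda>y. if y \<in> q_supp q then y else 0 :: real) \<in> borel_measurable borel" by measurable
  then show ?thesis by (simp add: supp_proj_def[abs_def])
qed

text \<open>The value of \<^const>\<open>f_CN\<close> at a conditioning point outside the support is arbitrary; moving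
  such points to \<open>0\<close> makes the semigroup laws hold everywhere.\<close>
definition cn_kernel :: "real \<Rightarrow> real \<Rightarrow> real \<Rightarrow> real \<Rightarrow> ennreal" where
  "cn_kernel q \<rho> y x = ennreal (f_CN q \<rho> (supp_proj q y) x)"

definition mn_kernel :: "real \<Rightarrow> real \<Rightarrow> real \<Rightarrow> ennreal" where
  "mn_kernel q t x = ennreal (MN_density q t x)"

abbreviation corr_params :: "real set" where
  "corr_params \<equiv> {-1<..<1} - {0}"

lemma corr_params_mult: "\<rho> \<in> corr_params \<Longrightarrow> \<sigma> \<in> corr_params \<Longrightarrow> \<rho> * \<sigma> \<in> corr_params"
  using abs_mult_less[of \<rho> 1 \<sigma> 1] by (auto simp: abs_mult[symmetric] abs_less_iff)

lemma shift_params_mult: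
  assumes "q \<le> 1" "(1 - q) * t\<^sup>2 < 1" "\<rho> \<in> corr_params"
  shows "(1 - q) * (t * \<rho>)\<^sup>2 < 1"
proof -
  have "\<rho>\<^sup>2 \<le> 1" using assms(3) by (simp add: abs_square_le_1 abs_le_iff)
  then have "(1 - q) * t\<^sup>2 * \<rho>\<^sup>2 \<le> (1 - q) * t\<^sup>2 * 1" using assms(1) by (intro mult_left_mono) auto
  then show ?thesis using assms(2) by (simp add: power_mult_distrib mult.assoc)
qed

lemma density_semigroup_q:
  assumes "-1 < q" "q \<le> 1"
  shows "density_semigroup {t. (1 - q) * t\<^sup>2 < 1} corr_params (mn_kernel q) (cn_kernel q)"
proof (cases "q = 1")
  case True
  have proj: "supp_proj 1 y = y" for y by (simp add: supp_proj_def q_supp_def)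
  have cn: "cn_kernel 1 \<rho> y x = ennreal (normal_density (\<rho> * y) (sqrt (1 - \<rho>\<^sup>2)) x)" for \<rho> y x
    by (simp add: cn_kernel_def proj f_CN_def)
  have mn: "mn_kernel 1 t x = ennreal (normal_density t 1 x)" for t x
    by (simp add: mn_kernel_def MN_density_1)
  have sd: "0 < sqrt (1 - \<rho>\<^sup>2)" "(sqrt (1 - \<rho>\<^sup>2))\<^sup>2 = 1 - \<rho>\<^sup>2" if "\<rho> \<in> corr_params" for \<rho>
  proof -
    have "\<rho>\<^sup>2 < 1" using that by (simp add: abs_square_less_1 abs_less_iff)
    then show "0 < sqrt (1 - \<rho>\<^sup>2)" "(sqrt (1 - \<rho>\<^sup>2))\<^sup>2 = 1 - \<rho>\<^sup>2" by auto
  qed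
  show ?thesis
    unfolding True
  proof
    fix \<rho> \<sigma> t x y z :: real
    show "\<rho> \<in> corr_params \<Longrightarrow> \<sigma> \<in> corr_params \<Longrightarrow> \<rho> * \<sigma> \<in> corr_params"
      by (rule corr_params_mult)
    show "t * \<rho> \<in> {t. (1 - 1) * t\<^sup>2 < 1}" by simp
    show "mn_kernel 1 t \<in> borel_measurable borel"
      unfolding mn[abs_def] by measurable
    show "(\<lambda>(y, x). cn_kernel 1 \<rho> y x) \<in> borel_measurable (borel \<Otimes>\<^sub>M borel)"
      unfolding cn normal_density_def by measurable
    show "(\<integral>\<^sup>+y. mn_kernel 1 t y * cn_kernel 1 \<rho> y z \<partial>lborel) = mn_kernel 1 (t * \<rho>) z" if "\<rho> \<in> corr_params"
      unfolding cn mn using sd[OF that] by (subst nn_integral_normal_density_kernel) (auto simp: mult.commute)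
    \<comment> \<open>The variances match since (1 - \<sigma>^2) + \<sigma>^2 (1 - \<rho>^2) = 1 -
      (\<rho> \<sigma>)^2; in the preceding law they add up to (1 - \<rho>^2) + \<rho>^2 =
      1.\<close>
    show "(\<integral>\<^sup>+y. cn_kernel 1 \<rho> x y * cn_kernel 1 \<sigma> y z \<partial>lborel) = cn_kernel 1 (\<rho> * \<sigma>) x z"
      if "\<rho> \<in> corr_params" "\<sigma> \<in> corr_params"
      unfolding cn using sd[OF that(1)] sd[OF that(2)]
      by (subst nn_integral_normal_density_kernel) (auto simp: algebra_simps power_mult_distrib)
    show "(\<integral>\<^sup>+x. cn_kernel 1 \<rho> y x \<partial>lborel) = 1" if "\<rho> \<in> corr_params"
      unfolding cn using sd[OF that]
      by (subst nn_integral_eq_integral) (auto intro!: integrable_normal_density integral_normal_density)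
  qed
next
  case False
  then interpret q_disc q
    using assms by unfold_locales auto
  have proj: "y \<in> q_supp q \<Longrightarrow> supp_proj q y = y" for y by (simp add: supp_proj_def)
  note proj_in = supp_proj_in[OF assms(2)]
  have less: "\<bar>\<rho>\<bar> < 1" if "\<rho> \<in> corr_params" for \<rho> using that by (auto simp: abs_less_iff)
  show ?thesis
  proof
    fix \<rho> \<sigma> t x y z :: real
    show "\<rho> \<in> corr_params \<Longrightarrow> \<sigma> \<in> corr_params \<Longrightarrow> \<rho> * \<sigma> \<in> corr_params"
      by (rule corr_params_mult)
    show "t \<in> {t. (1 - q) * t\<^sup>2 < 1} \<Longrightarrow> \<rho> \<in> corr_params \<Longrightarrow> t * \<rho> \<in> {t. (1 - q) * t\<^sup>2 < 1}"
      using shift_params_mult[OF assms(2)] by blast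
    show "mn_kernel q t \<in> borel_measurable borel"
      unfolding mn_kernel_def[abs_def] using MN_density_measurable[of t] by measurable
    show "(\<lambda>(y, x). cn_kernel q \<rho> y x) \<in> borel_measurable (borel \<Otimes>\<^sub>M borel)" if "\<rho> \<in> corr_params"
      unfolding cn_kernel_def using f_CN_measurable[OF less[OF that] supp_proj_measurable proj_in]
      by (simp add: case_prod_beta')
    show "(\<integral>\<^sup>+y. mn_kernel q t y * cn_kernel q \<rho> y z \<partial>lborel) = mn_kernel q (t * \<rho>) z"
      if "t \<in> {t. (1 - q) * t\<^sup>2 < 1}" "\<rho> \<in> corr_params"
      unfolding mn_kernel_def cn_kernel_def using that by (intro nn_integral_MN_f_CN less proj) auto
    show "(\<integral>\<^sup>+y. cn_kernel q \<rho> x y * cn_kernel q \<sigma> y z \<partial>lborel) = cn_kernel q (\<rho> * \<sigma>) x z"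
      if "\<rho> \<in> corr_params" "\<sigma> \<in> corr_params"
      unfolding cn_kernel_def using that by (intro nn_integral_f_CN_f_CN less proj proj_in)
    show "(\<integral>\<^sup>+x. cn_kernel q \<rho> y x \<partial>lborel) = 1" if "\<rho> \<in> corr_params"
      unfolding cn_kernel_def using that by (intro nn_integral_f_CN less proj_in)
  qed
qed

lemma f_CN_nonneg':
  assumes "-1 < q" "q \<le> 1" "\<rho> \<in> corr_params" "y \<in> q_supp q"
  shows "0 \<le> f_CN q \<rho> y x"
proof (cases "q = 1")
  case False
  then interpret q_disc q using assms by unfold_locales auto
  show ?thesis using assms by (intro f_CN_nonneg) (auto simp: abs_less_iff)
qed (simp add: f_CN_def)

lemma f_CN_outside: "q \<noteq> 1 \<Longrightarrow> x \<notin> q_supp q \<Longrightarrow> f_CN q \<rho> y x = 0"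
  by (simp add: f_CN_def f_N_def)

lemma MN_density_nonneg':
  assumes "-1 < q" "q \<le> 1" "(1 - q) * t\<^sup>2 < 1"
  shows "0 \<le> MN_density q t x"
proof (cases "q = 1")
  case False
  then interpret q_disc q using assms by unfold_locales auto
  show ?thesis using assms by (intro MN_density_nonneg)
qed (simp add: MN_density_1)

section \<open>From identities between densities to distributions of random vectors\<close>

lemma distributed_transform:
  assumes X: "distributed M N X f" and \<pi>: "\<pi> \<in> measurable N N'" and g: "g \<in> borel_measurable N'"
    and Y: "\<And>\<omega>. \<pi> (X \<omega>) = Y \<omega>"
    and int: "\<And>A. A \<in> sets N' \<Longrightarrow> (\<integral>\<^sup>+x. f x * indicator A (\<pi> x) \<partial>N) = (\<integral>\<^sup>+x. g x * indicator A x \<partial>N')"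
  shows "distributed M N' Y g"
proof -
  have X': "distr M N X = density N f" "f \<in> borel_measurable N" "X \<in> measurable M N"
    using X by (auto simp: distributed_def)
  have Ym: "Y \<in> measurable M N'"
    using measurable_compose[OF X'(3) \<pi>] by (simp add: Y)
  have "distr M N' Y = distr (distr M N X) N' \<pi>"
    using X'(3) \<pi> by (subst distr_distr) (simp_all add: comp_def Y)
  also have "\<dots> = density N' g"
    unfolding X'(1)
  proof (rule measure_eqI)
    fix A assume "A \<in> sets (distr (density N f) N' \<pi>)"
    then have A: "A \<in> sets N'" by simp
    have "emeasure (distr (density N f) N' \<pi>) A = emeasure (density N f) (\<pi> -` A \<inter> space N)"
      using A \<pi> by (subst emeasure_distr) simp_all
    also have "\<dots> = (\<integral>\<^sup>+x. f x * indicator (\<pi> -` A \<inter> space N) x \<partial>N)"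
      using X'(2) \<pi> A by (intro emeasure_density measurable_sets)
    also have "\<dots> = (\<integral>\<^sup>+x. f x * indicator A (\<pi> x) \<partial>N)"
      by (intro nn_integral_cong) (auto split: split_indicator)
    also have "\<dots> = emeasure (density N' g) A"
      unfolding int[OF A] using g A by (rule emeasure_density[symmetric])
    finally show "emeasure (distr (density N f) N' \<pi>) A = emeasure (density N' g) A" .
  qed simp
  finally show ?thesis
    using g Ym by (simp add: distributed_def)
qed

context
  fixes q :: real
  assumes q: "-1 < q" "q \<le> 1"
begin

interpretation density_semigroup "{t. (1 - q) * t\<^sup>2 < 1}" corr_params "mn_kernel q" "cn_kernel q"
  by (rule density_semigroup_q[OF q])

text \<open>The three claims support each other. If the last coordinate is off the support, the
  density is already 0 and the altered kernel does no harm; otherwise \<open>f_CN\<close> is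
  nonnegative, which is what lets \<open>ennreal\<close> split the product.\<close>

lemma MMN_density_eq_chain:
  assumes t: "(1 - q) * t\<^sup>2 < 1" and \<rho>: "\<And>i. i \<in> {1..<d} \<Longrightarrow> \<rho> i \<in> corr_params" and d: "1 \<le> d"
  shows "0 \<le> MMN_density d \<rho> q t x \<and> ennreal (MMN_density d \<rho> q t x) = chain d \<rho> t x
    \<and> (x d \<notin> q_supp q \<longrightarrow> MMN_density d \<rho> q t x = 0)"
  using d \<rho>
proof (induction d rule: dec_induct)
  case base
  have "MN_density q t (x 1) = 0" if "x 1 \<notin> q_supp q"
    using that by (cases "q = 1") (auto simp: q_supp_def MN_density_def f_N_def)
  moreover have "chain 1 \<rho> t x = ennreal (MN_density q t (x 1))"
    unfolding mn_kernel_def[symmetric] by (simp add: chain_def link_def)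
  ultimately show ?case
    using MN_density_nonneg'[OF q t, of "x 1"]
    by (simp add: MMN_density_def)
next
  case (step d)
  have \<rho>d: "\<rho> d \<in> corr_params" using step by auto
  have IH: "0 \<le> MMN_density d \<rho> q t x" "ennreal (MMN_density d \<rho> q t x) = chain d \<rho> t x"
    "x d \<notin> q_supp q \<Longrightarrow> MMN_density d \<rho> q t x = 0"
    using step by auto
  have S: "MMN_density (Suc d) \<rho> q t x = MMN_density d \<rho> q t x * f_CN q (\<rho> d) (x d) (x (Suc d))"
    using step.hyps by (simp add: MMN_density_def prod.atLeastLessThan_Suc mult.assoc)
  have C: "chain (Suc d) \<rho> t x = chain d \<rho> t x * cn_kernel q (\<rho> d) (x d) (x (Suc d))"
    using step.hyps by (simp add: chain_Suc link_def)
  have out: "f_CN q (\<rho> d) (x d) (x (Suc d)) = 0" if "x (Suc d) \<notin> q_supp q"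
    using that f_CN_outside[of q] by (cases "q = 1") (auto simp: q_supp_def)
  show ?case
  proof (cases "x d \<in> q_supp q")
    case True
    have "0 \<le> f_CN q (\<rho> d) (x d) (x (Suc d))" using True by (intro f_CN_nonneg' q \<rho>d)
    then show ?thesis
      unfolding S C using IH True out by (simp add: ennreal_mult cn_kernel_def supp_proj_def)
  next
    case False
    then show ?thesis unfolding S C using IH by simp
  qed
qed

lemma nn_integral_MMN_marginal:
  assumes "(1 - q) * t\<^sup>2 < 1" "\<And>i. i \<in> {1..<d} \<Longrightarrow> \<rho> i \<in> corr_params" "1 \<le> d"
    and "1 \<le> p" "strict_mono_on {1..p} idx" "idx ` {1..p} \<subseteq> {1..d}" and "F \<in> borel_measurable (Leb p)"
  shows "(\<integral>\<^sup>+x. F (\<lambda>j\<in>{1..p}. x (idx j)) * ennreal (MMN_density d \<rho> q t x) \<partial>Leb d)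
    = (\<integral>\<^sup>+y. F y * ennreal (MMN_density p (marg_\<rho> \<rho> idx) q (marg_t t \<rho> idx) y) \<partial>Leb p)"
proof -
  have \<rho>': "marg_\<rho> \<rho> idx j \<in> corr_params" if "j \<in> {1..<p}" for j
    by (rule marg_\<rho>_R[OF assms(2,5,6) that])
  have t': "(1 - q) * (marg_t t \<rho> idx)\<^sup>2 < 1"
    using marg_t_T[OF assms(2), where t = t and idx = idx] assms(1,4,6) by (auto simp: image_subset_iff)
  show ?thesis
    using chain_marginal[OF _ assms(2,4-7)] assms(1)
      MMN_density_eq_chain[OF assms(1-3)] MMN_density_eq_chain[OF t' \<rho>' assms(4)]
    by simp
qed

lemma MMN_density_measurable:
  assumes "(1 - q) * t\<^sup>2 < 1" "\<And>i. i \<in> {1..<d} \<Longrightarrow> \<rho> i \<in> corr_params" "1 \<le> d"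
  shows "(\<lambda>x. ennreal (MMN_density d \<rho> q t x)) \<in> borel_measurable (Leb d)"
  using chain_measurable[of t d \<rho>] assms MMN_density_eq_chain[OF assms] by simp

lemma has_MMN_marginal:
  assumes t: "(1 - q) * t\<^sup>2 < 1" and \<rho>: "\<And>i. i \<in> {1..<d} \<Longrightarrow> \<rho> i \<in> corr_params" and d: "1 \<le> d"
    and p: "1 \<le> p" and idx: "strict_mono_on {1..p} idx" "idx ` {1..p} \<subseteq> {1..d}"
    and X: "has_MMN M d X \<rho> q t"
  shows "(\<forall>j\<in>{1..<p}. marg_\<rho> \<rho> idx j \<in> corr_params)" "(1 - q) * (marg_t t \<rho> idx)\<^sup>2 < 1"
    and "has_MMN M p (\<lambda>j. X (idx j)) (marg_\<rho> \<rho> idx) q (marg_t t \<rho> idx)"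
proof -
  show \<rho>': "\<forall>j\<in>{1..<p}. marg_\<rho> \<rho> idx j \<in> corr_params"
    by (intro ballI marg_\<rho>_R[OF \<rho> idx])
  show t': "(1 - q) * (marg_t t \<rho> idx)\<^sup>2 < 1"
    using marg_t_T[OF \<rho>, where t = t and idx = idx] t p idx(2) by (auto simp: image_subset_iff)
  have sel: "(\<lambda>x. \<lambda>j\<in>{1..p}. x (idx j)) \<in> measurable (Leb d) (Leb p)"
    using idx(2) by (intro measurable_restrict) (auto simp: measurable_lborel2 image_subset_iff intro!: component_measurable)
  show "has_MMN M p (\<lambda>j. X (idx j)) (marg_\<rho> \<rho> idx) q (marg_t t \<rho> idx)"
    unfolding has_MMN_def
  proof (rule distributed_transform[OF X[unfolded has_MMN_def] sel])
    show "(\<lambda>x. ennreal (MMN_density p (marg_\<rho> \<rho> idx) q (marg_t t \<rho> idx) x)) \<in> borel_measurable (Leb p)"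
      using \<rho>' by (intro MMN_density_measurable t' p) auto
    show "(\<lambda>j\<in>{1..p}. (\<lambda>i\<in>{1..d}. X i \<omega>) (idx j)) = (\<lambda>j\<in>{1..p}. X (idx j) \<omega>)" for \<omega>
      using idx(2) by (intro restrict_ext) (auto simp: image_subset_iff)
    fix A assume "A \<in> sets (Leb p)"
    then have "indicator A \<in> borel_measurable (Leb p)" by simp
    from nn_integral_MMN_marginal[OF t \<rho> d p idx this]
    show "(\<integral>\<^sup>+x. ennreal (MMN_density d \<rho> q t x) * indicator A (\<lambda>j\<in>{1..p}. x (idx j)) \<partial>Leb d)
      = (\<integral>\<^sup>+x. ennreal (MMN_density p (marg_\<rho> \<rho> idx) q (marg_t t \<rho> idx) x) * indicator A x \<partial>Leb p)"
      by (simp add: mult.commute)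
  qed
qed

text \<open>A one-dimensional vector is still a function on {1..1}; evaluation at 1 carries its
  density to the real line.\<close>

lemma has_MMN_1:
  assumes t: "(1 - q) * t\<^sup>2 < 1" and X: "has_MMN M 1 (\<lambda>j. Y) \<rho> q t"
  shows "has_MN M Y q t"
  unfolding has_MN_def
proof (rule distributed_transform[OF X[unfolded has_MMN_def], of "\<lambda>x. x 1"])
  show "(\<lambda>x. x 1) \<in> measurable (Leb 1) lborel" by simp
  have g: "(\<lambda>x. ennreal (MN_density q t x)) \<in> borel_measurable borel"
    using g_measurable[of t] t by (simp add: mn_kernel_def[abs_def])
  then show "(\<lambda>x. ennreal (MN_density q t x)) \<in> borel_measurable lborel" by simp
  show "(\<lambda>i\<in>{1..1::nat}. Y \<omega>) 1 = Y \<omega>" for \<omega> by simp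
  fix A :: "real set" assume A: "A \<in> sets lborel"
  have "(\<integral>\<^sup>+x. ennreal (MN_density q t (x 1)) * indicator A (x 1) \<partial>Leb 1)
    = (\<integral>\<^sup>+x. ennreal (MN_density q t x) * indicator A x \<partial>lborel)"
    using leb.product_nn_integral_singleton[of "\<lambda>x. ennreal (MN_density q t x) * indicator A x" "1::nat"] g A by simp
  then show "(\<integral>\<^sup>+x. ennreal (MMN_density 1 \<rho> q t x) * indicator A (x 1) \<partial>Leb 1)
    = (\<integral>\<^sup>+x. ennreal (MN_density q t x) * indicator A x \<partial>lborel)"
    by (simp add: MMN_density_def)
qed

end

theorem proposition5:
  fixes M :: "'a measure" and X :: "nat \<Rightarrow> 'a \<Rightarrow> real"
    and q t :: real and d :: nat and \<rho> :: "nat \<Rightarrow> real"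
  assumes "prob_space M"
    and "-1 < q" and "q \<le> 1"
    and "(1 - q) * t\<^sup>2 < 1"
    and "1 \<le> d"
    and "\<forall>i\<in>{1..<d}. \<rho> i \<in> {-1<..<1} - {0}"
    and "has_MMN M d X \<rho> q t"
  shows "(\<forall>p idx. 1 \<le> p \<and> strict_mono_on {1..p} idx \<and> idx ` {1..p} \<subseteq> {1..d} \<longrightarrow>
            (\<exists>\<rho>' t'. (\<forall>j\<in>{1..<p}. \<rho>' j \<in> {-1<..<1} - {0}) \<and> (1 - q) * t'\<^sup>2 < 1 \<and>
               has_MMN M p (\<lambda>j. X (idx j)) \<rho>' q t'))
       \<and> (\<forall>i\<in>{1..d}. has_MN M (X i) q (t * (\<Prod>k\<in>{1..<i}. \<rho> k)))"
proof -
  interpret density_semigroup "{t. (1 - q) * t\<^sup>2 < 1}" corr_params "mn_kernel q" "cn_kernel q"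
    by (rule density_semigroup_q[OF assms(2,3)])
  have \<rho>: "\<And>i. i \<in> {1..<d} \<Longrightarrow> \<rho> i \<in> corr_params" using assms(6) by blast
  note marginal = has_MMN_marginal[OF assms(2-4) \<rho> assms(5) _ _ _ assms(7)]
  show ?thesis
  proof (intro conjI allI impI ballI)
    fix p :: nat and idx :: "nat \<Rightarrow> nat" assume *: "1 \<le> p \<and> strict_mono_on {1..p} idx \<and> idx ` {1..p} \<subseteq> {1..d}"
    then show "\<exists>\<rho>' t'. (\<forall>j\<in>{1..<p}. \<rho>' j \<in> {-1<..<1} - {0}) \<and> (1 - q) * t'\<^sup>2 < 1 \<and> has_MMN M p (\<lambda>j. X (idx j)) \<rho>' q t'"
      using marginal[of p idx] by blast
  next
    fix i assume i: "i \<in> {1..d}"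
    \<comment> \<open>A single coordinate is the case p = 1 with a constant index map, for which
      strict monotonicity is vacuous and the new t is multiplied by the correlations before
      i.\<close>
    have "strict_mono_on {1..1} (\<lambda>_::nat. i)" by (rule strict_mono_onI) simp
    then have "has_MMN M 1 (\<lambda>j. X i) (marg_\<rho> \<rho> (\<lambda>_. i)) q (marg_t t \<rho> (\<lambda>_. i))"
      and "(1 - q) * (marg_t t \<rho> (\<lambda>_. i))\<^sup>2 < 1"
      using marginal[of 1 "\<lambda>_. i"] i by auto
    then show "has_MN M (X i) q (t * (\<Prod>k\<in>{1..<i}. \<rho> k))"
      using has_MMN_1[OF assms(2,3)] by (simp add: marg_t_def)
  qed
qed

end
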